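(* Let $d$ and $p$ be positive integers with $d\le p$, and let $A\subset\mathbb R^p$ be a nonempty compact strongly $(\mathcal H_d,d)$-rectifiable set. If $s>d$, then the limits $h_{s,d}(A)$ and $h_{s,d}^*(A)$ exist as extended real numbers and $$h_{s,d}(A)=h_{s,d}^*(A)=\frac{\sigma_{s,d}}{[\mathcal H_d(A)]^{s/d}}.$$ Moreover, if $\mathcal H_d(A)>0$, then for any asymptotically $K_s$-extremal sequence $\Omega=\{\omega_N\}_{N\ge1}$ of $N$-point configurations (for either the constrained or the unconstrained polarization problem) we have the weak-$*$ convergence $$\frac1N\sum_{x_i\in\omega_N}\delta_{x_i}\ \stackrel{*}{\rightharpoonup}\ \frac{\mathcal H_d|_A}{\mathcal H_d(A)}\qquad\text{as }N\to\infty,$$ where $\mathcal H_d|_A:=\mathcal H_d(\cdot\cap A)$ is the restriction to $A$ of the Hausdorff measure $\mathcal H_d$.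
   Context: For $s>0$, $K_s(x,y)=|x-y|^{-s}$ with $K_s(x,x)=+\infty$. Configurations $\omega_N=\{x_1,\dots,x_N\}$ are $N$-point multisets (repetitions allowed). For nonempty $A\subset\mathbb R^p$, $$P_s(A,\omega_N):=\inf_{y\in A}\sum_{i=1}^N K_s(x_i,y),\quad \mathcal P_s(A,N):=\sup_{\omega_N\subset A}P_s(A,\omega_N),\quad \mathcal P_s^*(A,N):=\sup_{\omega_N\subset\mathbb R^p}P_s(A,\omega_N).$$ For $s>d$ set $$h_{s,d}(A):=\lim_{N\to\infty}\frac{\mathcal P_s(A,N)}{N^{s/d}},\qquad h_{s,d}^*(A):=\lim_{N\to\infty}\frac{\mathcal P_s^*(A,N)}{N^{s/d}}$$ when the limits exist as extended real numbers. $\sigma_{s,d}:=h_{s,d}([0,1]^d)$ is the limit for the unit cube in $\mathbb R^d$, known (from earlier work) to exist as a finite positive number. $\mathcal H_d$ is $d$-dimensional Hausdorff measure, normalized so that an embedded $d$-dimensional unit cube has measure $1$. When $\mathcal H_d(A)=0$ the quotient $\sigma_{s,d}/[\mathcal H_d(A)]^{s/d}$ is interpreted as $+\infty$. A sequence $\{\omega_N\}_{N\ge1}$ of $N$-point configurations in $\mathbb R^p$ is asymptotically $K_s$-extremal for the unconstrained problem if $\lim_{N\to\infty}P_s(A,\omega_N)/\mathcal P_s^*(A,N)=1$; for the constrained problem if $\omega_N\subset A$ for all $N$ and $\lim_{N\to\infty}P_s(A,\omega_N)/\mathcal P_s(A,N)=1$. Upper Minkowski content: $\overline{\mathcal M}_d(S):=\limsup_{r\downarrow0}\mathcal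 L_p(S_r)/(\beta_{p-d}r^{p-d})$, where $S_r=\{x\in\mathbb R^p:\operatorname{dist}(x,S)<r\}$, $\mathcal L_p$ is Lebesgue measure and $\beta_k=\pi^{k/2}/\Gamma(k/2+1)$ is the volume of the $k$-dimensional unit ball ($\beta_0=1$). For $\epsilon>0$, a $d$-dimensional $\epsilon$-Lipschitz graph in $\mathbb R^p$ is a set $\{h+\psi(h):h\in H\}$ where $H\subset\mathbb R^p$ is a $d$-dimensional linear subspace and $\psi:H\to H^\perp$ is $\epsilon$-Lipschitz. A set $A\subset\mathbb R^p$ is strongly $(\mathcal H_d,d)$-rectifiable if for each $\epsilon>0$ there exist a compact set $R_\epsilon\subset\mathbb R^p$ with $\overline{\mathcal M}_d(R_\epsilon)<\epsilon$ and finitely many compact, pairwise disjoint sets $\widetilde K_1,\dots,\widetilde K_k\subset\mathbb R^p$ such that $A=R_\epsilon\cup\bigcup_{j=1}^k\widetilde K_j$ and each $\widetilde K_j$ is contained in some $d$-dimensional $\epsilon$-Lipschitz graph in $\mathbb R^p$. *)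

theory Defs
  imports "HOL-Probability.Probability"
begin

section \<open>Riesz polarization\<close>

text \<open>The quantities below are nonnegative extended reals, hence of type \<^typ>\<open>ennreal\<close>.\<close>

definition riesz_kernel :: "real \<Rightarrow> 'a::euclidean_space \<Rightarrow> 'a \<Rightarrow> ennreal" where
  "riesz_kernel s x y = (if x = y then \<infinity> else ennreal (norm (x - y) powr (- s)))"

definition polarization :: "real \<Rightarrow> 'a::euclidean_space set \<Rightarrow> 'a multiset \<Rightarrow> ennreal" where
  "polarization s A \<omega> = (INF y\<in>A. \<Sum>x\<in>#\<omega>. riesz_kernel s x y)"

definition max_polarization :: "real \<Rightarrow> 'a::euclidean_space set \<Rightarrow> nat \<Rightarrow> ennreal" where
  "max_polarization s A N = (SUP \<omega>\<in>{\<omega>. size \<omega> = N \<and> set_mset \<omega> \<subseteq> A}. polarization s A \<omega>)"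

definition max_polarization_unconstrained :: "real \<Rightarrow> 'a::euclidean_space set \<Rightarrow> nat \<Rightarrow> ennreal" where
  "max_polarization_unconstrained s A N = (SUP \<omega>\<in>{\<omega>. size \<omega> = N}. polarization s A \<omega>)"

definition scaled_polarization :: "real \<Rightarrow> nat \<Rightarrow> 'a::euclidean_space set \<Rightarrow> nat \<Rightarrow> ennreal" where
  "scaled_polarization s d A N = max_polarization s A N / ennreal (real N powr (s / real d))"

definition scaled_polarization_unconstrained ::
    "real \<Rightarrow> nat \<Rightarrow> 'a::euclidean_space set \<Rightarrow> nat \<Rightarrow> ennreal" where
  "scaled_polarization_unconstrained s d A N =
     max_polarization_unconstrained s A N / ennreal (real N powr (s / real d))"

text \<open>As usual for \<^const>\<open>lim\<close>, the next two values are meaningful only if the sequence converges.\<close>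

definition polarization_limit :: "real \<Rightarrow> nat \<Rightarrow> 'a::euclidean_space set \<Rightarrow> ennreal" where
  "polarization_limit s d A = lim (scaled_polarization s d A)"

definition polarization_limit_unconstrained :: "real \<Rightarrow> nat \<Rightarrow> 'a::euclidean_space set \<Rightarrow> ennreal" where
  "polarization_limit_unconstrained s d A = lim (scaled_polarization_unconstrained s d A)"

text \<open>The dimension \<open>d\<close> is passed as the cardinality of the index type \<open>'d\<close> wherever the
  space of real \<open>d\<close>-tuples itself is involved.\<close>

definition unit_cube :: "(real ^ 'd::finite) set" where
  "unit_cube = {x. \<forall>i. 0 \<le> x $ i \<and> x $ i \<le> 1}"

definition cube_polarization_const :: "'d::finite itself \<Rightarrow> real \<Rightarrow> ennreal" where
  "cube_polarization_const _ s = polarization_limit s CARD('d) (unit_cube :: (real ^ 'd) set)"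

definition asymp_extremal :: "real \<Rightarrow> 'a::euclidean_space set \<Rightarrow> (nat \<Rightarrow> 'a multiset) \<Rightarrow> bool" where
  "asymp_extremal s A \<omega> \<longleftrightarrow>
     (\<forall>N\<ge>1. size (\<omega> N) = N \<and> set_mset (\<omega> N) \<subseteq> A) \<and>
     (\<lambda>N. polarization s A (\<omega> N) / max_polarization s A N) \<longlonglongrightarrow> 1"

definition asymp_extremal_unconstrained ::
    "real \<Rightarrow> 'a::euclidean_space set \<Rightarrow> (nat \<Rightarrow> 'a multiset) \<Rightarrow> bool" where
  "asymp_extremal_unconstrained s A \<omega> \<longleftrightarrow>
     (\<forall>N\<ge>1. size (\<omega> N) = N) \<and>
     (\<lambda>N. polarization s A (\<omega> N) / max_polarization_unconstrained s A N) \<longlonglongrightarrow> 1"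


section \<open>Hausdorff measure\<close>

text \<open>For \<open>d \<ge> 1\<close>. Countable covers suffice, and finite ones are included because the empty
  set has diameter 0.\<close>

definition hausdorff_premeasure :: "nat \<Rightarrow> real \<Rightarrow> 'a::metric_space set \<Rightarrow> ennreal" where
  "hausdorff_premeasure d \<delta> S =
     (INF U\<in>{U :: nat \<Rightarrow> 'a set. S \<subseteq> (\<Union>i. U i) \<and> (\<forall>i. bounded (U i) \<and> diameter (U i) \<le> \<delta>)}.
        \<Sum>i. ennreal (diameter (U i) ^ d))"

definition hausdorff_outer :: "nat \<Rightarrow> 'a::metric_space set \<Rightarrow> ennreal" where
  "hausdorff_outer d S = (SUP \<delta>\<in>{0<..}. hausdorff_premeasure d \<delta> S)"

text \<open>Since \<^const>\<open>hausdorff_outer\<close> is invariant under isometric embeddings, dividing by its value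
  on the unit cube normalizes every embedded \<open>d\<close>-dimensional unit cube to have measure 1.\<close>

definition hausdorff_measure :: "'d::finite itself \<Rightarrow> 'a::euclidean_space measure" where
  "hausdorff_measure _ = measure_of UNIV (sets borel)
     (\<lambda>S. hausdorff_outer CARD('d) S / hausdorff_outer CARD('d) (unit_cube :: (real ^ 'd) set))"


section \<open>Strong rectifiability\<close>

text \<open>The union of balls is the set of points at distance less than \<open>r\<close> from \<open>S\<close>; unlike
  \<^const>\<open>infdist\<close>, it gives the empty set for empty \<open>S\<close>.\<close>

definition upper_minkowski_content :: "nat \<Rightarrow> 'a::euclidean_space set \<Rightarrow> ennreal" where
  "upper_minkowski_content d S =
     Limsup (at_right 0) (\<lambda>r. emeasure lborel (\<Union>x\<in>S. ball x r) /
       ennreal (unit_ball_vol (real (DIM('a) - d)) * r ^ (DIM('a) - d)))"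

definition lipschitz_graph :: "nat \<Rightarrow> real \<Rightarrow> 'a::euclidean_space set \<Rightarrow> bool" where
  "lipschitz_graph d \<epsilon> G \<longleftrightarrow>
     (\<exists>H \<psi>. subspace H \<and> dim H = d \<and> \<psi> ` H \<subseteq> orthogonal_comp H \<and> lipschitz_on \<epsilon> H \<psi> \<and>
        G = {h + \<psi> h | h. h \<in> H})"

definition strongly_rectifiable :: "nat \<Rightarrow> 'a::euclidean_space set \<Rightarrow> bool" where
  "strongly_rectifiable d A \<longleftrightarrow>
     (\<forall>\<epsilon>>0. \<exists>R (k::nat) K.
        compact R \<and> upper_minkowski_content d R < ennreal \<epsilon> \<and>
        (\<forall>j\<in>{1..k}. compact (K j)) \<and> disjoint_family_on K {1..k} \<and>
        A = R \<union> (\<Union>j\<in>{1..k}. K j) \<and>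
        (\<forall>j\<in>{1..k}. \<exists>G. lipschitz_graph d \<epsilon> G \<and> K j \<subseteq> G))"


section \<open>Weak-* convergence and the limit value\<close>

definition empirical_measure :: "'a::euclidean_space multiset \<Rightarrow> 'a measure" where
  "empirical_measure \<omega> = distr (measure_pmf (pmf_of_multiset \<omega>)) borel (\<lambda>x. x)"

text \<open>Testing against bounded continuous functions; for probability measures with a probability
  measure as limit this agrees with testing against compactly supported ones.\<close>

definition weak_star_conv :: "(nat \<Rightarrow> 'a::euclidean_space measure) \<Rightarrow> 'a measure \<Rightarrow> bool" where
  "weak_star_conv \<mu> \<nu> \<longleftrightarrow>
     (\<forall>f :: 'a \<Rightarrow> real. continuous_on UNIV f \<and> bounded (range f) \<longrightarrow>
        (\<lambda>N. integral\<^sup>L (\<mu> N) f) \<longlonglongrightarrow> integral\<^sup>L \<nu> f)"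

text \<open>\<open>x\<close> to the power \<open>t\<close>, for \<open>t > 0\<close>.\<close>

definition ennreal_powr :: "ennreal \<Rightarrow> real \<Rightarrow> ennreal" where
  "ennreal_powr x t = (if x = \<infinity> then \<infinity> else ennreal (enn2real x powr t))"

definition limit_value :: "'d::finite itself \<Rightarrow> real \<Rightarrow> 'a::euclidean_space set \<Rightarrow> ennreal" where
  "limit_value D s A =
     (if emeasure (hausdorff_measure D) A = 0 then \<infinity>
      else cube_polarization_const D s /
        ennreal_powr (emeasure (hausdorff_measure D) A) (s / real CARD('d)))"

end

theory Submission
  imports Defs
begin

text \<open>
  For small \<open>r\<close>, let \<open>n r\<close> be the least number of points whose Riesz potential is at least
  \<open>r powr - s\<close> everywhere on \<open>A\<close>. The limit of the polarization is determined by the limit of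
  \<open>n r * r ^ d\<close>, a quantity that behaves like the \<open>d\<close>-dimensional measure of \<open>A\<close>: it is subadditive,
  and additive for disjoint compact sets because \<open>s > d\<close> makes the influence of far points negligible;
  under a Lipschitz map it changes by at most the factor \<open>L ^ d\<close>. For the unit cube, let \<open>\<theta>\<close> be the
  infimum of \<open>n r * r ^ d\<close> over all \<open>r\<close>. A compact set \<open>B\<close> of full dimension is compared with grid
  cells of side proportional to \<open>r\<close>: up to a negligible fraction, the cells meeting \<open>B\<close> are so densely
  filled by \<open>B\<close> that points can be moved into \<open>B\<close>, and lower bounds for the potential can be carried
  over from \<open>B\<close> to the whole cell, at almost no cost. Hence \<open>n r * r ^ d\<close> tends to \<open>\<theta>\<close> times the volume of \<open>B\<close>.
  Strongly rectifiable sets are, up to a set of small Minkowski content, finite disjoint unions of almost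
  isometric images of such sets. Applied to the compact subsets of \<open>A\<close>, the same result bounds from
  below the number of points of an extremal configuration near such a subset, which gives the weak convergence.
\<close>

section \<open>Hausdorff measure\<close>

text \<open>The polarization asks for the best level that \<open>N\<close> points reach; the proof
  asks for the fewest points that reach a given level. A count adds and scales like a volume, and a
  cost \<open>a\<close> turns back into the limit \<open>a powr - (s / d)\<close> through the level
  \<open>r\<close> with \<open>N * r ^ d = a\<close>; this is the origin of the exponent of the
  measure. Upper and lower bounds for full-dimensional sets are not alike. From above, cells can be
  filled one by one. From below, points in one cell help its neighbours, so a configuration cannot
  be cut along the grid. The way around is complementation: since \<open>\<theta>\<close> is an
  infimum, cubes obey an exact inequality at every scale, and if \<open>B\<close> were too cheap,
  filling the rest of a big cube with near-optimal cells would beat that infimum. That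
  \<open>\<theta>\<close> is positive is again due to \<open>s > d\<close>, which makes the kernel
  integrable away from its pole. For the weak convergence lower bounds suffice: the total mass is 1,
  so lower bounds on open sets already determine the limit.\<close>

lemma hausdorff_premeasure_mono:
  "S \<subseteq> T \<Longrightarrow> hausdorff_premeasure d \<delta> S \<le> hausdorff_premeasure d \<delta> T"
  unfolding hausdorff_premeasure_def by (rule INF_superset_mono) auto

lemma hausdorff_premeasure_antimono:
  "\<delta> \<le> \<delta>' \<Longrightarrow> hausdorff_premeasure d \<delta>' S \<le> hausdorff_premeasure d \<delta> S"
  unfolding hausdorff_premeasure_def by (rule INF_superset_mono) (auto intro: order_trans)

lemma hausdorff_premeasure_le:
  assumes "S \<subseteq> (\<Union>i. U i)" "\<And>i. bounded (U i)" "\<And>i. diameter (U i) \<le> \<delta>"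
  shows "hausdorff_premeasure d \<delta> S \<le> (\<Sum>i. ennreal (diameter (U i) ^ d))"
  unfolding hausdorff_premeasure_def using assms by (intro INF_lower) auto

lemma hausdorff_premeasure_empty:
  assumes "d > 0" "\<delta> > 0" shows "hausdorff_premeasure d \<delta> ({} :: 'a::metric_space set) = 0"
proof -
  have "hausdorff_premeasure d \<delta> ({} :: 'a set) \<le> (\<Sum>i::nat. ennreal (diameter ({}::'a set) ^ d))"
    by (rule hausdorff_premeasure_le) (use assms in auto)
  also have "\<dots> = 0" using assms by (simp add: diameter_empty zero_power)
  finally show ?thesis by simp
qed

lemma hausdorff_premeasure_le_outer:
  "\<delta> > 0 \<Longrightarrow> hausdorff_premeasure d \<delta> S \<le> hausdorff_outer d S"
  unfolding hausdorff_outer_def by (rule SUP_upper) auto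

lemma hausdorff_outer_mono: "S \<subseteq> T \<Longrightarrow> hausdorff_outer d S \<le> hausdorff_outer d T"
  unfolding hausdorff_outer_def by (intro SUP_mono) (auto intro: hausdorff_premeasure_mono)

lemma hausdorff_outer_empty: "d > 0 \<Longrightarrow> hausdorff_outer d {} = 0"
  unfolding hausdorff_outer_def by (simp add: hausdorff_premeasure_empty SUP_eq_const)

lemma hausdorff_premeasure_UN:
  fixes A :: "nat \<Rightarrow> 'a::metric_space set"
  assumes \<delta>: "\<delta> > 0"
  shows "hausdorff_premeasure d \<delta> (\<Union>n. A n) \<le> (\<Sum>n. hausdorff_premeasure d \<delta> (A n))"
proof (rule ennreal_le_epsilon)
  fix e :: real assume e: "e > 0" and fin: "(\<Sum>n. hausdorff_premeasure d \<delta> (A n)) < top"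
  have fin': "hausdorff_premeasure d \<delta> (A n) < top" for n
  proof -
    have "hausdorff_premeasure d \<delta> (A n) = (\<Sum>i\<in>{n}. hausdorff_premeasure d \<delta> (A i))" by simp
    also have "\<dots> \<le> (\<Sum>n. hausdorff_premeasure d \<delta> (A n))" by (rule sum_le_suminf) auto
    finally show ?thesis using fin by (rule order.strict_trans1)
  qed
  have "\<exists>U. A n \<subseteq> (\<Union>i. U i) \<and> (\<forall>i. bounded (U i) \<and> diameter (U i) \<le> \<delta>) \<and>
      (\<Sum>i. ennreal (diameter (U i) ^ d)) < hausdorff_premeasure d \<delta> (A n) + ennreal (e * (1/2)^Suc n)" for n
  proof -
    have "hausdorff_premeasure d \<delta> (A n) < hausdorff_premeasure d \<delta> (A n) + ennreal (e * (1/2)^Suc n)"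
      using fin'[of n] e ennreal_add_left_cancel_less[of "hausdorff_premeasure d \<delta> (A n)" 0 "ennreal (e * (1/2)^Suc n)"]
      by (simp add: less_top)
    then show ?thesis
      unfolding hausdorff_premeasure_def[of d \<delta> "A n"] INF_less_iff by auto
  qed
  then obtain U where U: "\<And>n. A n \<subseteq> (\<Union>i::nat. U n i)" "\<And>n i. bounded (U n i)" "\<And>n i. diameter (U n i) \<le> \<delta>"
     "\<And>n. (\<Sum>i. ennreal (diameter (U n i) ^ d)) < hausdorff_premeasure d \<delta> (A n) + ennreal (e * (1/2)^Suc n)"
    by metis
  define V where "V k = U (fst (prod_decode k)) (snd (prod_decode k))" for k
  have "(\<Union>n. A n) \<subseteq> (\<Union>k. V k)"
  proof safe
    fix x n assume "x \<in> A n"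
    then obtain i where "x \<in> U n i" using U(1) by blast
    then have "x \<in> V (prod_encode (n,i))" by (simp add: V_def)
    then show "x \<in> (\<Union>k. V k)" by blast
  qed
  then have "hausdorff_premeasure d \<delta> (\<Union>n. A n) \<le> (\<Sum>k. ennreal (diameter (V k) ^ d))"
    using U by (intro hausdorff_premeasure_le) (auto simp: V_def)
  also have "\<dots> = (\<Sum>n. \<Sum>i. ennreal (diameter (U n i) ^ d))"
    using suminf_ennreal_2dimen[where f="\<lambda>(n,i). ennreal (diameter (U n i) ^ d)"
        and g="\<lambda>n. \<Sum>i. ennreal (diameter (U n i) ^ d)"]
    by (simp add: V_def split_beta)
  also have "\<dots> \<le> (\<Sum>n. hausdorff_premeasure d \<delta> (A n) + ennreal (e * (1/2)^Suc n))"
    using U(4) by (intro suminf_le) (auto intro: less_imp_le)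
  also have "\<dots> = (\<Sum>n. hausdorff_premeasure d \<delta> (A n)) + (\<Sum>n. ennreal (e * (1/2)^Suc n))"
    by (simp add: suminf_add)
  also have "(\<Sum>n. ennreal (e * (1/2)^Suc n)) = ennreal e"
    using sums_mult[OF power_half_series, of e] e
    by (intro suminf_ennreal_eq) (auto simp: power_Suc)
  finally show "hausdorff_premeasure d \<delta> (\<Union>n. A n) \<le> (\<Sum>n. hausdorff_premeasure d \<delta> (A n)) + ennreal e" .
qed

lemma hausdorff_outer_UN:
  fixes A :: "nat \<Rightarrow> 'a::metric_space set"
  shows "hausdorff_outer d (\<Union>n. A n) \<le> (\<Sum>n. hausdorff_outer d (A n))"
  unfolding hausdorff_outer_def[of d "\<Union>n. A n"]
proof (rule SUP_least)
  fix \<delta> :: real assume "\<delta> \<in> {0<..}"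
  then have \<delta>: "\<delta> > 0" by simp
  have "hausdorff_premeasure d \<delta> (\<Union>n. A n) \<le> (\<Sum>n. hausdorff_premeasure d \<delta> (A n))"
    by (rule hausdorff_premeasure_UN[OF \<delta>])
  also have "\<dots> \<le> (\<Sum>n. hausdorff_outer d (A n))"
    by (intro suminf_le hausdorff_premeasure_le_outer \<delta>) auto
  finally show "hausdorff_premeasure d \<delta> (\<Union>n. A n) \<le> \<dots>" .
qed

section \<open>Caratheodory measurability of the Borel sets\<close>

lemma outer_measure_space_hausdorff:
  "d > 0 \<Longrightarrow> outer_measure_space UNIV (hausdorff_outer d)"
  unfolding outer_measure_space_def positive_def increasing_def countably_subadditive_def
  by (auto simp: hausdorff_outer_empty hausdorff_outer_mono hausdorff_outer_UN)

lemma hausdorff_outer_Un: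
  assumes "d > 0"
  shows "hausdorff_outer d (S \<union> T) \<le> hausdorff_outer d S + hausdorff_outer d T"
proof -
  have sa: "subadditive UNIV (hausdorff_outer d)"
    using sigma_algebra_Pow[of UNIV] outer_measure_space_hausdorff[OF assms]
    by (metis Pow_UNIV outer_measure_space_def algebra.axioms(1) ring_of_sets.countably_subadditive_subadditive sigma_algebra.axioms(1))
  have "hausdorff_outer d (S \<union> T) = hausdorff_outer d (S \<union> (T - S))" by (simp add: Un_Diff_cancel)
  also have "\<dots> \<le> hausdorff_outer d S + hausdorff_outer d (T - S)"
    using subadditiveD[OF sa, of S "T - S"] by auto
  also have "\<dots> \<le> hausdorff_outer d S + hausdorff_outer d T"
    by (intro add_left_mono hausdorff_outer_mono) auto
  finally show ?thesis .
qed

text \<open>A set of diameter at most \<open>\<delta>\<close> cannot meet both \<open>S\<close> and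
  \<open>T\<close>, so a cover of the union splits into one cover of each. The vacated members
  become empty and cost nothing because \<open>d > 0\<close>.\<close>

lemma hausdorff_premeasure_separated:
  assumes d: "d > 0" and sep: "\<And>x y. x \<in> S \<Longrightarrow> y \<in> T \<Longrightarrow> \<delta> < dist x y" and \<delta>: "\<delta> > 0"
  shows "hausdorff_premeasure d \<delta> S + hausdorff_premeasure d \<delta> T \<le> hausdorff_premeasure d \<delta> (S \<union> T)"
  unfolding hausdorff_premeasure_def[of d \<delta> "S \<union> T"]
proof (rule INF_greatest, clarify)
  fix U :: "nat \<Rightarrow> 'a set"
  assume cov: "S \<union> T \<subseteq> (\<Union>i. U i)" and U: "\<forall>i. bounded (U i) \<and> diameter (U i) \<le> \<delta>"
  define U1 where "U1 i = (if U i \<inter> S = {} then {} else U i)" for i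
  define U2 where "U2 i = (if U i \<inter> S = {} then U i else {})" for i
  have T: "U i \<inter> T = {}" if meets: "U i \<inter> S \<noteq> {}" for i
  proof (rule ccontr)
    assume "U i \<inter> T \<noteq> {}"
    then obtain x y where "x \<in> U i" "x \<in> S" "y \<in> U i" "y \<in> T" using meets by blast
    then have "dist x y \<le> diameter (U i)" "\<delta> < dist x y"
      using U sep diameter_bounded_bound[of "U i" x y] by auto
    with U show False by (meson leD order_trans)
  qed
  have "hausdorff_premeasure d \<delta> S \<le> (\<Sum>i. ennreal (diameter (U1 i) ^ d))"
  proof (intro hausdorff_premeasure_le)
    show "S \<subseteq> (\<Union>i. U1 i)"
    proof
      fix x assume "x \<in> S"
      then obtain i where "x \<in> U i" using cov by blast
      then have "x \<in> U1 i" using \<open>x \<in> S\<close> by (auto simp: U1_def)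
      then show "x \<in> (\<Union>i. U1 i)" by blast
    qed
  qed (use U \<delta> in \<open>auto simp: U1_def\<close>)
  moreover have "hausdorff_premeasure d \<delta> T \<le> (\<Sum>i. ennreal (diameter (U2 i) ^ d))"
  proof (intro hausdorff_premeasure_le)
    show "T \<subseteq> (\<Union>i. U2 i)"
    proof
      fix x assume "x \<in> T"
      then obtain i where i: "x \<in> U i" using cov by blast
      then have "x \<in> U2 i" using T[of i] \<open>x \<in> T\<close> by (auto simp: U2_def)
      then show "x \<in> (\<Union>i. U2 i)" by blast
    qed
  qed (use U \<delta> in \<open>auto simp: U2_def\<close>)
  ultimately have "hausdorff_premeasure d \<delta> S + hausdorff_premeasure d \<delta> T \<le>
     (\<Sum>i. ennreal (diameter (U1 i) ^ d)) + (\<Sum>i. ennreal (diameter (U2 i) ^ d))"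
    by (rule add_mono)
  also have "\<dots> = (\<Sum>i. ennreal (diameter (U1 i) ^ d) + ennreal (diameter (U2 i) ^ d))"
    by (simp add: suminf_add)
  also have "\<dots> = (\<Sum>i. ennreal (diameter (U i) ^ d))"
    using d by (intro suminf_cong) (auto simp: U1_def U2_def)
  finally show "hausdorff_premeasure d \<delta> S + hausdorff_premeasure d \<delta> T \<le> \<dots>" .
qed

lemma hausdorff_outer_separated:
  assumes d: "d > 0" and sep: "\<And>x y. x \<in> S \<Longrightarrow> y \<in> T \<Longrightarrow> \<eta> \<le> dist x y" and \<eta>: "\<eta> > 0"
  shows "hausdorff_outer d (S \<union> T) = hausdorff_outer d S + hausdorff_outer d T"
proof (rule antisym[OF hausdorff_outer_Un[OF d]])
  have *: "hausdorff_premeasure d a S + hausdorff_premeasure d b T \<le> hausdorff_outer d (S \<union> T)"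
    if "a > 0" "b > 0" for a b
  proof -
    define c where "c = min (min a b) (\<eta>/2)"
    have c: "c > 0" "c \<le> a" "c \<le> b" "c < \<eta>" using that \<eta> by (auto simp: c_def)
    have "hausdorff_premeasure d a S + hausdorff_premeasure d b T \<le> hausdorff_premeasure d c S + hausdorff_premeasure d c T"
      using c by (intro add_mono hausdorff_premeasure_antimono) auto
    also have "\<dots> \<le> hausdorff_premeasure d c (S \<union> T)"
      using c sep by (intro hausdorff_premeasure_separated d) (auto intro: order.strict_trans2)
    also have "\<dots> \<le> hausdorff_outer d (S \<union> T)"
      by (rule hausdorff_premeasure_le_outer[OF c(1)])
    finally show ?thesis .
  qed
  have "hausdorff_outer d S + hausdorff_premeasure d b T \<le> hausdorff_outer d (S \<union> T)" if "b > 0" for b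
    unfolding hausdorff_outer_def[of d S]
    by (subst ennreal_SUP_add_left[symmetric]) (auto intro!: SUP_least * that)
  then show "hausdorff_outer d S + hausdorff_outer d T \<le> hausdorff_outer d (S \<union> T)"
    unfolding hausdorff_outer_def[of d T]
    by (subst ennreal_SUP_add_right) (auto intro!: SUP_least)
qed


text \<open>Caratheodory's criterion for a metric outer measure. The part of \<open>X\<close> at
  distance at least \<open>1/(n+1)\<close> from \<open>C\<close> is separated from
  \<open>X \<inter> C\<close>, so these two add. The rest of \<open>X - C\<close> consists of the
  shells \<open>D i\<close> with \<open>i \<ge> n\<close>, whose outer measures form a convergent
  series, so it becomes negligible.\<close>

lemma hausdorff_outer_closed_measurable:
  fixes C :: "'a::metric_space set"
  assumes d: "d > 0" and C: "closed C"
  shows "hausdorff_outer d (X \<inter> C) + hausdorff_outer d (X - C) = hausdorff_outer d X"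
proof (rule antisym)
  let ?H = "hausdorff_outer d"
  show "?H X \<le> ?H (X \<inter> C) + ?H (X - C)"
    using hausdorff_outer_Un[OF d, of "X \<inter> C" "X - C"] by (simp add: Int_Diff_Un)
  show "?H (X \<inter> C) + ?H (X - C) \<le> ?H X"
  proof (cases "C = {} \<or> ?H X = top")
    case True then show ?thesis by (auto simp: hausdorff_outer_empty[OF d])
  next
    case False
    then have ne: "C \<noteq> {}" and fin: "?H X < top" by (auto simp: less_top)
    define Y where "Y n = {x\<in>X. 1 / real (n+1) \<le> infdist x C}" for n
    define D where "D n = {x\<in>X. 1 / real (n+2) \<le> infdist x C \<and> infdist x C < 1 / real (n+1)}" for n
    have lip: "infdist x C - infdist y C \<le> dist x y" for x y :: 'a
      using infdist_triangle[of x C y] by simp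
    \<comment> \<open>Adjacent shells may touch; between shell \<open>n\<close> and shell
      \<open>n + 2\<close> there is a gap of width \<open>1/(n+2) - 1/(n+3)\<close>.\<close>
    have DD: "?H (S \<union> D m) = ?H S + ?H (D m)"
      if "\<And>x. x \<in> S \<Longrightarrow> 1 / real (n+2) \<le> infdist x C" "n + 2 \<le> m" for S n m
    proof (rule hausdorff_outer_separated[OF d, where \<eta>="1/real(n+2) - 1/real(n+3)"])
      fix x y assume "x \<in> S" "y \<in> D m"
      then have "infdist y C < 1/real (m+1)" "1/real(n+2) \<le> infdist x C" using that by (auto simp: D_def)
      moreover have "1/real(m+1) \<le> 1/real(n+3)" using that by (intro divide_left_mono) auto
      ultimately show "1/real(n+2) - 1/real(n+3) \<le> dist x y" using lip[of x y] by linarith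
    qed (simp add: frac_less2)
    \<comment> \<open>\<open>c\<close> selects the even or the odd shells. Every second shell is
      separated from all earlier ones, so either sum stays below \<open>?H X\<close> and the full
      series converges.\<close>
    have part: "(\<Sum>i<N. ?H (D (2*i+c))) \<le> ?H X" for N c
    proof -
      have "(\<Sum>i<N. ?H (D (2*i+c))) = ?H (\<Union>i<N. D (2*i+c))"
      proof (induction N)
        case (Suc N)
        show ?case
        proof (cases N)
          case (Suc M)
          have "?H ((\<Union>i<N. D (2*i+c)) \<union> D (2*N+c)) = ?H (\<Union>i<N. D (2*i+c)) + ?H (D (2*N+c))"
          proof (rule DD[of _ "2*M+c" "2*N+c"])
            fix x assume "x \<in> (\<Union>i<N. D (2*i+c))"
            then obtain i where "i < N" "x \<in> D (2*i+c)" by blast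
            then have "1/real(2*i+c+2) \<le> infdist x C" "1/real(2*M+c+2) \<le> 1/real(2*i+c+2)"
              using Suc by (auto simp: D_def intro!: divide_left_mono)
            then show "1/real(2*M+c+2) \<le> infdist x C" by linarith
          qed (use Suc in auto)
          then show ?thesis using Suc.IH by (simp add: lessThan_Suc Un_commute add.commute)
        qed (simp add: lessThan_Suc)
      qed (simp add: hausdorff_outer_empty[OF d])
      also have "\<dots> \<le> ?H X" by (rule hausdorff_outer_mono) (auto simp: D_def)
      finally show ?thesis .
    qed
    have "(\<Sum>i<N. ?H (D i)) \<le> ?H X + ?H X" for N
    proof -
      have "(\<Sum>i<N. ?H (D i)) \<le> (\<Sum>i<2*N. ?H (D i))" by (rule sum_mono2) auto
      also have "\<dots> = (\<Sum>i<N. ?H (D (2*i+0))) + (\<Sum>i<N. ?H (D (2*i+1)))"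
        by (induction N) (simp_all add: algebra_simps)
      also have "\<dots> \<le> ?H X + ?H X" by (intro add_mono part)
      finally show ?thesis .
    qed
    then have "(\<Sum>i. ?H (D i)) \<le> ?H X + ?H X"
      by (intro suminf_le_const summableI) auto
    also have "\<dots> < top" using fin by (simp add: less_top)
    finally have sfin: "(\<Sum>i. ?H (D i)) \<noteq> top" by simp
    define f where "f n = enn2real (?H (D n))" for n
    have Df: "?H (D n) = ennreal (f n)" for n
    proof -
      have "?H (D n) \<le> ?H X" by (rule hausdorff_outer_mono) (auto simp: D_def)
      then show ?thesis using fin unfolding f_def by (simp add: order.strict_trans1)
    qed
    have f0: "f n \<ge> 0" for n by (simp add: f_def)
    have sf: "summable f"
      using sfin f0 unfolding Df by (intro summable_suminf_not_top) auto
    show ?thesis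
    proof (rule ennreal_le_epsilon)
      fix e :: real assume e: "e > 0"
      obtain n where n: "norm (\<Sum>i. f (i + n)) < e" using suminf_exist_split[OF e sf] by blast
      have "X - C \<subseteq> Y n \<union> (\<Union>i. D (i + n))"
      proof
        fix x assume x: "x \<in> X - C"
        then have pos: "infdist x C > 0"
          using C ne by (metis DiffD2 in_closed_iff_infdist_zero infdist_nonneg order_le_less)
        show "x \<in> Y n \<union> (\<Union>i. D (i + n))"
        proof (cases "1 / real (n+1) \<le> infdist x C")
          case False
          obtain k where k: "inverse (real (Suc k)) < infdist x C" using reals_Archimedean[OF pos] by blast
          define m where "m = (LEAST m. 1 / real (m+2) \<le> infdist x C)"
          have ex: "1 / real (k+2) \<le> infdist x C"
          proof -
            have "1 / real (k+2) \<le> 1/real (k+1)" by (intro divide_left_mono) auto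
            then show ?thesis using k by (simp add: inverse_eq_divide)
          qed
          have m: "1 / real (m+2) \<le> infdist x C" unfolding m_def using ex by (rule LeastI)
          have nm: "n \<le> m"
          proof (rule ccontr)
            assume "\<not> n \<le> m"
            then have "1/real(n+1) \<le> 1/real(m+2)" by (intro divide_left_mono) auto
            with m False show False by linarith
          qed
          have "infdist x C < 1 / real (m+1)"
          proof (cases "m = n")
            case True then show ?thesis using False by simp
          next
            case neq: False
            then have "\<not> 1 / real ((m - 1)+2) \<le> infdist x C"
              using nm not_less_Least[of "m-1" "\<lambda>m. 1 / real (m+2) \<le> infdist x C"] unfolding m_def[symmetric] by simp
            moreover have "(m-1)+2 = m+1" using neq nm by simp
            ultimately show ?thesis by simp
          qed
          then have "x \<in> D ((m-n)+n)" using m x nm by (auto simp: D_def)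
          then show ?thesis by blast
        qed (use x in \<open>auto simp: Y_def\<close>)
      qed
      then have "?H (X - C) \<le> ?H (Y n \<union> (\<Union>i. D (i + n)))" by (rule hausdorff_outer_mono)
      also have "\<dots> \<le> ?H (Y n) + ?H (\<Union>i. D (i + n))" by (rule hausdorff_outer_Un[OF d])
      also have "?H (\<Union>i. D (i + n)) \<le> (\<Sum>i. ?H (D (i+n)))" by (rule hausdorff_outer_UN)
      also have "\<dots> = ennreal (\<Sum>i. f (i+n))" unfolding Df
        by (rule suminf_ennreal2) (use f0 sf summable_ignore_initial_segment in auto)
      also have "\<dots> \<le> ennreal e" using n by (intro ennreal_leI) auto
      finally have 1: "?H (X - C) \<le> ?H (Y n) + ennreal e" by (simp add: add_left_mono)
      have "?H (X \<inter> C) + ?H (Y n) = ?H ((X \<inter> C) \<union> Y n)"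
      proof (rule hausdorff_outer_separated[OF d, symmetric, where \<eta>="1/real(n+1)"])
        fix x y assume "x \<in> X \<inter> C" "y \<in> Y n"
        then show "1/real(n+1) \<le> dist x y" using lip[of y x] by (auto simp: Y_def dist_commute)
      qed simp
      also have "\<dots> \<le> ?H X" by (rule hausdorff_outer_mono) (auto simp: Y_def)
      finally have 2: "?H (X \<inter> C) + ?H (Y n) \<le> ?H X" .
      have "?H (X \<inter> C) + ?H (X - C) \<le> ?H (X \<inter> C) + (?H (Y n) + ennreal e)"
        by (intro add_left_mono 1)
      also have "\<dots> \<le> ?H X + ennreal e" using 2 by (simp add: add.assoc[symmetric] add_right_mono)
      finally show "?H (X \<inter> C) + ?H (X - C) \<le> ?H X + ennreal e" .
    qed
  qed
qed

lemma measure_space_hausdorff_outer: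
  assumes d: "d > 0"
  shows "measure_space UNIV (sets (borel :: 'a::metric_space measure)) (hausdorff_outer d)"
proof -
  interpret sigma_algebra UNIV "UNIV :: 'a set set" using sigma_algebra_Pow[of UNIV] by simp
  let ?L = "lambda_system UNIV UNIV (hausdorff_outer d) :: 'a set set"
  have ms: "measure_space UNIV ?L (hausdorff_outer d)"
    using caratheodory_lemma[OF outer_measure_space_hausdorff[OF d]] .
  then have sa: "sigma_algebra UNIV ?L" by (simp add: measure_space_def)
  have cl: "C \<in> ?L" if "closed C" for C
    unfolding lambda_system_eq using hausdorff_outer_closed_measurable[OF d that] by auto
  have "sets (borel :: 'a measure) = sigma_sets UNIV {S. closed S}"
    by (simp add: borel_eq_closed)
  also have "\<dots> \<subseteq> ?L"
    using cl by (intro sigma_algebra.sigma_sets_subset[OF sa]) auto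
  finally show ?thesis
    using measure_down[OF ms] sets.sigma_algebra_axioms[of "borel::'a measure"] by simp
qed

section \<open>Counting grid cells\<close>

text \<open>Cells are half-open cubes of side \<open>\<delta>\<close>, named by integer vectors:
  they partition the space, so they can be counted without overlaps.\<close>

definition grid_cell :: "real \<Rightarrow> real ^ 'd::finite \<Rightarrow> int ^ 'd" where
  "grid_cell \<delta> x = (\<chi> i. \<lfloor>x $ i / \<delta>\<rfloor>)"

definition grid_count :: "real \<Rightarrow> (real ^ 'd::finite) set \<Rightarrow> nat" where
  "grid_count \<delta> B = card (grid_cell \<delta> ` B)"

lemma grid_cell_eq_iff:
  assumes "\<delta> > 0"
  shows "grid_cell \<delta> x = k \<longleftrightarrow> (\<forall>i. \<delta> * of_int (k $ i) \<le> x $ i \<and> x $ i < \<delta> * (of_int (k $ i) + 1))"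
  using assms by (auto simp: grid_cell_def vec_eq_iff floor_eq_iff field_simps)

text \<open>The similarity of ratio \<open>\<delta>\<close> that carries \<open>unit_cube\<close>
  onto the closure of cell \<open>k\<close>; it transplants configurations of the unit cube into
  cells.\<close>

definition cell_point :: "real \<Rightarrow> int ^ 'd::finite \<Rightarrow> real ^ 'd \<Rightarrow> real ^ 'd" where
  "cell_point \<delta> k x = \<delta> *\<^sub>R ((\<chi> i. of_int (k $ i)) + x)"

lemma grid_cell_point:
  assumes "\<delta> > 0" "grid_cell \<delta> y = k"
  obtains x where "x \<in> unit_cube" "y = cell_point \<delta> k x"
proof
  have y: "\<delta> * of_int (k $ i) \<le> y $ i" "y $ i < \<delta> * (of_int (k $ i) + 1)" for i
    using grid_cell_eq_iff[OF assms(1)] assms(2) by auto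
  show "y = cell_point \<delta> k (y /\<^sub>R \<delta> - (\<chi> i. of_int (k $ i)))"
    using assms(1) by (simp add: cell_point_def)
  show "y /\<^sub>R \<delta> - (\<chi> i. of_int (k $ i)) \<in> unit_cube"
    unfolding unit_cube_def using y assms(1) by (auto simp: field_simps less_imp_le)
qed

lemma dist_cell_point:
  assumes "\<delta> > 0" shows "norm (cell_point \<delta> k x - cell_point \<delta> k y) = \<delta> * norm (x - y)"
proof -
  have "cell_point \<delta> k x - cell_point \<delta> k y = \<delta> *\<^sub>R (x - y)"
    by (simp add: cell_point_def algebra_simps)
  then show ?thesis using assms by simp
qed

lemma finite_vec_box:
  fixes S :: "'d::finite \<Rightarrow> 'b set"
  assumes "\<And>i. finite (S i)"
  shows "finite {k :: 'b ^ 'd. \<forall>i. k $ i \<in> S i}" (is "finite ?A")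
    and "card {k :: 'b ^ 'd. \<forall>i. k $ i \<in> S i} \<le> (\<Prod>i\<in>UNIV. card (S i))"
proof -
  have fin: "finite (Pi\<^sub>E UNIV S)" using assms by (intro finite_PiE) auto
  have eq: "?A \<subseteq> vec_lambda ` Pi\<^sub>E UNIV S"
  proof
    fix k assume "k \<in> ?A"
    then have "k = vec_lambda (\<lambda>i. k $ i)" "(\<lambda>i. k $ i) \<in> Pi\<^sub>E UNIV S" by auto
    then show "k \<in> vec_lambda ` Pi\<^sub>E UNIV S" by blast
  qed
  then show "finite ?A" using fin by (meson finite_imageI finite_subset)
  have "card ?A \<le> card (vec_lambda ` Pi\<^sub>E UNIV S)" using eq fin by (intro card_mono) auto
  also have "\<dots> \<le> card (Pi\<^sub>E UNIV S)" by (rule card_image_le[OF fin])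
  also have "\<dots> = (\<Prod>i\<in>UNIV. card (S i))" by (simp add: card_PiE)
  finally show "card ?A \<le> (\<Prod>i\<in>UNIV. card (S i))" .
qed

lemma finite_grid_cells:
  assumes "bounded B" "\<delta> > 0" shows "finite (grid_cell \<delta> ` B)"
proof -
  obtain b where b: "\<And>x. x \<in> B \<Longrightarrow> norm x \<le> b" using assms(1) bounded_iff by blast
  have "grid_cell \<delta> ` B \<subseteq> {k. \<forall>i. k $ i \<in> {\<lfloor>- b / \<delta>\<rfloor>..\<lfloor>b / \<delta>\<rfloor>}}"
  proof clarify
    fix x i assume "x \<in> B"
    then have "\<bar>x $ i\<bar> \<le> b" using b component_le_norm_cart[of x i] order_trans by blast
    then have "- b \<le> x $ i" "x $ i \<le> b" by auto
    then have "- b / \<delta> \<le> x $ i / \<delta>" "x $ i / \<delta> \<le> b / \<delta>"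
      using assms(2) by (intro divide_right_mono; simp)+
    then show "grid_cell \<delta> x $ i \<in> {\<lfloor>- b / \<delta>\<rfloor>..\<lfloor>b / \<delta>\<rfloor>}"
      by (simp add: grid_cell_def floor_mono)
  qed
  then show ?thesis by (rule finite_subset) (intro finite_vec_box finite_atLeastAtMost_int)
qed

lemma grid_cell_dist:
  fixes x y :: "real ^ 'd::finite"
  assumes "\<delta> > 0" "grid_cell \<delta> x = grid_cell \<delta> y"
  shows "dist x y \<le> real CARD('d) * \<delta>"
proof -
  have "\<bar>(x - y) $ i\<bar> \<le> \<delta>" for i
    using assms(2)[symmetric] grid_cell_eq_iff[OF assms(1), of x "grid_cell \<delta> y"]
      grid_cell_eq_iff[OF assms(1), of y "grid_cell \<delta> y"]
    by (simp add: abs_le_iff algebra_simps) (smt (verit))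
  then have "(\<Sum>i\<in>UNIV. \<bar>(x - y) $ i\<bar>) \<le> real CARD('d) * \<delta>"
    using sum_bounded_above[of UNIV "\<lambda>i. \<bar>(x - y) $ i\<bar>" \<delta>] by simp
  then show ?thesis using norm_le_l1_cart[of "x - y"] by (simp add: dist_norm)
qed

lemma
  fixes k :: "int ^ 'd::finite"
  assumes "\<delta> > 0"
  shows sets_grid_cell: "{x. grid_cell \<delta> x = k} \<in> sets borel"
    and emeasure_grid_cell: "emeasure lborel {x. grid_cell \<delta> x = k} = ennreal (\<delta> ^ CARD('d))"
proof -
  let ?l = "\<chi> i. \<delta> * of_int (k $ i)" and ?u = "\<chi> i. \<delta> * (of_int (k $ i) + 1)"
  show meas: "{x. grid_cell \<delta> x = k} \<in> sets borel"
    unfolding grid_cell_eq_iff[OF assms] by measurable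
  have ne: "?l $ i \<le> ?u $ i" for i using assms by (simp add: algebra_simps)
  have c: "measure lborel (cbox ?l ?u) = \<delta> ^ CARD('d)"
  proof -
    have "?l \<in> cbox ?l ?u" using ne by (simp add: mem_box_cart)
    then have "cbox ?l ?u \<noteq> {}" by blast
    then show ?thesis by (subst content_cbox_cart) (auto simp: algebra_simps)
  qed
  have e: "emeasure lborel (cbox ?l ?u) = ennreal (\<delta> ^ CARD('d))"
    using emeasure_eq_ennreal_measure[of lborel "cbox ?l ?u"] emeasure_lborel_cbox_finite[of ?l ?u] c
    by (simp add: less_top)
  have e': "emeasure lborel (box ?l ?u) = ennreal (\<delta> ^ CARD('d))"
    using e by (simp add: emeasure_lborel_box_eq emeasure_lborel_cbox_eq)
  have "emeasure lborel (box ?l ?u) \<le> emeasure lborel {x. grid_cell \<delta> x = k}"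
    using meas by (intro emeasure_mono) (auto simp: mem_box_cart grid_cell_eq_iff[OF assms] less_imp_le)
  moreover have "emeasure lborel {x. grid_cell \<delta> x = k} \<le> emeasure lborel (cbox ?l ?u)"
    by (intro emeasure_mono) (auto simp: mem_box_cart grid_cell_eq_iff[OF assms] less_imp_le)
  ultimately show "emeasure lborel {x. grid_cell \<delta> x = k} = ennreal (\<delta> ^ CARD('d))"
    unfolding e e' by (rule antisym[rotated])
qed

lemma emeasure_grid_cells:
  fixes K :: "(int ^ 'd::finite) set"
  assumes "finite K" "\<delta> > 0"
  shows "emeasure lborel (\<Union>k\<in>K. {x. grid_cell \<delta> x = k}) = ennreal (real (card K) * \<delta> ^ CARD('d))"
proof -
  have "emeasure lborel (\<Union>k\<in>K. {x. grid_cell \<delta> x = k}) = (\<Sum>k\<in>K. emeasure lborel {x. grid_cell \<delta> x = k})"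
    using assms sets_grid_cell by (intro sum_emeasure[symmetric]) (auto simp: disjoint_family_on_def)
  then show ?thesis using assms
    by (simp add: emeasure_grid_cell ennreal_mult ennreal_of_nat_eq_real_of_nat)
qed

lemma measure_le_grid_count:
  fixes B :: "(real ^ 'd::finite) set"
  assumes "bounded B" "\<delta> > 0"
  shows "measure lborel B \<le> real (grid_count \<delta> B) * \<delta> ^ CARD('d)"
\<comment> \<open>Off the Borel sets \<open>measure\<close> is 0 by convention, which settles the
  second case.\<close>
proof (cases "B \<in> sets borel")
  case True
  have "emeasure lborel B \<le> emeasure lborel (\<Union>k\<in>grid_cell \<delta> ` B. {x. grid_cell \<delta> x = k})"
    using finite_grid_cells[OF assms] sets_grid_cell[OF assms(2)]
    by (intro emeasure_mono sets.finite_UN) auto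
  also have "\<dots> = ennreal (real (grid_count \<delta> B) * \<delta> ^ CARD('d))"
    unfolding grid_count_def by (rule emeasure_grid_cells[OF finite_grid_cells[OF assms] assms(2)])
  finally show ?thesis unfolding measure_def using assms by (intro enn2real_leI) auto
qed (use assms in \<open>simp add: measure_notin_sets\<close>)

lemma eventually_at_right_small: "c > 0 \<Longrightarrow> \<forall>\<^sub>F r in at_right (0::real). 0 < r \<and> r < c"
  using eventually_at_right_real[of 0 c] by simp

lemma eventually_at_right_ex:
  assumes "\<forall>\<^sub>F r in at_right (0::real). P r" obtains r where "r > 0" "P r"
proof -
  obtain b where b: "b > 0" "\<And>y. y > 0 \<Longrightarrow> y < b \<Longrightarrow> P y"
    using assms eventually_at_right[of 0 1 P] by auto
  show thesis by (rule that[of "b/2"]) (use b in auto)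
qed

text \<open>Outer regularity puts \<open>B\<close> into an open \<open>T\<close> of nearly the same
  measure. By compactness a whole neighbourhood of \<open>B\<close> lies in \<open>T\<close>, so
  small cells meeting \<open>B\<close> are disjoint subsets of \<open>T\<close>.\<close>

lemma grid_count_le_measure:
  fixes B :: "(real ^ 'd::finite) set"
  assumes "compact B" "e > 0"
  shows "\<forall>\<^sub>F \<delta> in at_right 0. real (grid_count \<delta> B) * \<delta> ^ CARD('d) \<le> measure lborel B + e"
proof -
  have Bb: "B \<in> sets borel" using assms(1) by (rule borel_compact)
  obtain T where T: "open T" "B \<subseteq> T" "emeasure lebesgue (T - B) < ennreal e"
    using sets_lebesgue_outer_open[of B e] assms Bb by (metis sets_completionI_sets sets_lborel)
  obtain \<epsilon> where \<epsilon>: "\<epsilon> > 0" "(\<Union>x\<in>B. ball x \<epsilon>) \<subseteq> T"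
    using compact_subset_open_imp_ball_epsilon_subset[OF assms(1) T(1,2)] .
  have Tb: "T \<in> sets borel" using T by simp
  have "emeasure lborel T = emeasure lborel B + emeasure lborel (T - B)"
    using Bb Tb T(2) by (subst plus_emeasure) (auto simp: Un_absorb1)
  also have "\<dots> \<le> ennreal (measure lborel B) + ennreal e"
    using T(3) Bb Tb emeasure_compact_finite[OF assms(1)]
    by (intro add_mono) (auto simp: emeasure_eq_ennreal_measure less_top less_imp_le)
  finally have eT: "emeasure lborel T \<le> ennreal (measure lborel B + e)" using assms by simp
  have "\<forall>\<^sub>F \<delta> in at_right 0. 0 < \<delta> \<and> \<delta> < \<epsilon> / real CARD('d)"
    using \<epsilon> by (intro eventually_at_right_small) simp
  then show ?thesis
  proof eventually_elim
    case (elim \<delta>)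
    then have \<delta>: "\<delta> > 0" "real CARD('d) * \<delta> < \<epsilon>" by (auto simp: field_simps)
    note fin = finite_grid_cells[OF compact_imp_bounded[OF assms(1)] \<delta>(1)]
    have sub: "(\<Union>k\<in>grid_cell \<delta> ` B. {x. grid_cell \<delta> x = k}) \<subseteq> T"
    proof clarify
      fix x y assume "x \<in> B" "grid_cell \<delta> y = grid_cell \<delta> x"
      then have "dist x y < \<epsilon>" using grid_cell_dist[OF \<delta>(1), of x y] \<delta>(2) by simp
      then have "y \<in> ball x \<epsilon>" by simp
      then show "y \<in> T" using \<epsilon>(2) \<open>x \<in> B\<close> by blast
    qed
    have "ennreal (real (grid_count \<delta> B) * \<delta> ^ CARD('d)) = emeasure lborel (\<Union>k\<in>grid_cell \<delta> ` B. {x. grid_cell \<delta> x = k})"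
      unfolding grid_count_def by (rule emeasure_grid_cells[OF fin \<delta>(1), symmetric])
    also have "\<dots> \<le> emeasure lborel T" using sub Tb by (intro emeasure_mono) auto
    also note eT
    finally show ?case using assms by (subst (asm) ennreal_le_iff) auto
  qed
qed

section \<open>Refining the grid: cells that a set fills only partly\<close>

lemma grid_cell_coarsen:
  assumes "m > 0"
  shows "grid_cell (real m * \<delta>) x = (\<chi> i. grid_cell \<delta> x $ i div int m)"
proof -
  have "\<lfloor>x $ i / (real m * \<delta>)\<rfloor> = \<lfloor>x $ i / \<delta>\<rfloor> div int m" for i
    using floor_divide_real_eq_div[of "int m" "x $ i / \<delta>"] by (simp add: field_simps)
  then show ?thesis by (simp add: grid_cell_def vec_eq_iff)
qed

definition subcells :: "nat \<Rightarrow> int ^ 'd::finite \<Rightarrow> (int ^ 'd) set" where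
  "subcells m k = {j. \<forall>i. j $ i div int m = k $ i}"

lemma
  fixes k :: "int ^ 'd::finite"
  assumes "m > 0"
  shows finite_subcells: "finite (subcells m k)"
    and card_subcells: "card (subcells m k) \<le> m ^ CARD('d)"
proof -
  let ?A = "{j :: int ^ 'd. \<forall>i. j $ i \<in> {int m * k $ i ..< int m * k $ i + int m}}"
  have sub: "subcells m k \<subseteq> ?A"
  proof
    fix j assume "j \<in> subcells m k"
    then have "k $ i = j $ i div int m" for i by (simp add: subcells_def)
    then show "j \<in> ?A" using assms
      by (auto simp: ) (metis div_mult_mod_eq le_add_same_cancel1 mult.commute of_nat_0_less_iff pos_mod_sign,
          metis add_left_cancel add_less_cancel_left mult.commute div_mult_mod_eq of_nat_0_less_iff pos_mod_bound)
  qed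
  have fin: "finite ?A" by (intro finite_vec_box) auto
  show "finite (subcells m k)" using sub fin by (rule finite_subset)
  have "card (subcells m k) \<le> card ?A" using fin sub by (rule card_mono)
  also have "\<dots> \<le> (\<Prod>i\<in>(UNIV::'d set). card {int m * k $ i ..< int m * k $ i + int m})"
    by (intro finite_vec_box) auto
  also have "\<dots> = m ^ CARD('d)" by simp
  finally show "card (subcells m k) \<le> m ^ CARD('d)" .
qed

text \<open>In every other cell that meets \<open>B\<close>, each point of the cell is within
  \<open>CARD('d) * \<rho> / m\<close> of \<open>B\<close>. This closeness is what allows
  configurations and potential bounds to be moved between the cell and \<open>B\<close>.\<close>

definition bad_cells :: "nat \<Rightarrow> real \<Rightarrow> (real ^ 'd::finite) set \<Rightarrow> (int ^ 'd) set" where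
  "bad_cells m \<rho> B = {k \<in> grid_cell \<rho> ` B. \<not> subcells m k \<subseteq> grid_cell (\<rho> / real m) ` B}"

lemma subcells_cell:
  assumes "m > 0" shows "grid_cell (\<rho> / real m) x \<in> subcells m (grid_cell \<rho> x)"
  using grid_cell_coarsen[OF assms, of "\<rho> / real m" x] assms by (simp add: subcells_def)

text \<open>Each bad cell owns a subcell that misses \<open>B\<close>, and distinct cells own
  distinct ones; so the bad cells are at most as many as the subcells left unoccupied.\<close>

lemma card_bad_cells:
  fixes B :: "(real ^ 'd::finite) set"
  assumes "bounded B" "\<rho> > 0" "m > 0"
  shows "card (bad_cells m \<rho> B) + grid_count (\<rho> / real m) B \<le> m ^ CARD('d) * grid_count \<rho> B"
proof -
  let ?C = "grid_cell \<rho> ` B" and ?F = "grid_cell (\<rho> / real m) ` B"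
  let ?all = "\<Union>k\<in>?C. subcells m k"
  have finC: "finite ?C" and finF: "finite ?F"
    using assms by (auto intro!: finite_grid_cells)
  have finall: "finite ?all" using finC finite_subcells[OF assms(3)] by (intro finite_UN_I)
  have "?F \<subseteq> ?all" using subcells_cell[OF assms(3)] by blast
  have "bad_cells m \<rho> B \<subseteq> (\<lambda>j. \<chi> i. j $ i div int m) ` (?all - ?F)"
  proof
    fix k assume "k \<in> bad_cells m \<rho> B"
    then obtain j where "k \<in> ?C" "j \<in> subcells m k" "j \<notin> ?F" by (auto simp: bad_cells_def)
    then show "k \<in> (\<lambda>j. \<chi> i. j $ i div int m) ` (?all - ?F)"
      by (intro image_eqI[of _ _ j]) (auto simp: subcells_def vec_eq_iff)
  qed
  then have "card (bad_cells m \<rho> B) \<le> card (?all - ?F)"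
    using finall by (meson card_image_le card_mono finite_Diff finite_imageI order_trans)
  also have "\<dots> = card ?all - card ?F" using \<open>?F \<subseteq> ?all\<close> finF by (simp add: card_Diff_subset)
  finally have "card (bad_cells m \<rho> B) + card ?F \<le> card ?all"
    using card_mono[OF finall \<open>?F \<subseteq> ?all\<close>] by simp
  also have "\<dots> \<le> (\<Sum>k\<in>?C. card (subcells m k))" by (rule card_UN_le[OF finC])
  also have "\<dots> \<le> (\<Sum>k\<in>?C. m ^ CARD('d))" by (intro sum_mono card_subcells assms)
  finally show ?thesis by (simp add: grid_count_def mult.commute)
qed

text \<open>A discrete density theorem. The fine cells meeting \<open>B\<close> have at least the
  volume of \<open>B\<close>, the coarse ones only slightly more, and every bad cell puts a whole
  fine cell into the difference.\<close>

lemma bad_cells_negligible: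
  fixes B :: "(real ^ 'd::finite) set"
  assumes "compact B" "m > 0" "e > 0"
  shows "\<forall>\<^sub>F \<rho> in at_right 0. real (card (bad_cells m \<rho> B)) * \<rho> ^ CARD('d) \<le> e"
proof -
  let ?M = "real (m ^ CARD('d))"
  have M: "?M > 0" using assms by simp
  have "\<forall>\<^sub>F \<rho> in at_right 0. real (grid_count \<rho> B) * \<rho> ^ CARD('d) \<le> measure lborel B + e / ?M"
    using assms M by (intro grid_count_le_measure) auto
  moreover have "\<forall>\<^sub>F \<rho> in at_right (0::real). \<rho> > 0" by (simp add: eventually_at_right_less)
  ultimately show ?thesis
  proof eventually_elim
    case (elim \<rho>)
    have "real (card (bad_cells m \<rho> B)) + real (grid_count (\<rho> / real m) B) \<le> ?M * real (grid_count \<rho> B)"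
      using card_bad_cells[OF compact_imp_bounded[OF assms(1)] elim(2) assms(2)]
      by (metis of_nat_add of_nat_le_iff of_nat_mult)
    then have "real (card (bad_cells m \<rho> B)) * \<rho> ^ CARD('d) + real (grid_count (\<rho> / real m) B) * \<rho> ^ CARD('d)
        \<le> ?M * real (grid_count \<rho> B) * \<rho> ^ CARD('d)"
      using elim(2) by (metis distrib_right mult_right_mono zero_le_power less_imp_le)
    also have "\<dots> \<le> ?M * (measure lborel B + e / ?M)"
      using elim(1) M by (simp add: mult.assoc mult_left_mono)
    also have "\<dots> = ?M * measure lborel B + e" using M by (simp add: distrib_left)
    also have "measure lborel B \<le> real (grid_count (\<rho> / real m) B) * (\<rho> / real m) ^ CARD('d)"
      using measure_le_grid_count[OF compact_imp_bounded[OF assms(1)], of "\<rho> / real m"] elim(2) assms(2) by simp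
    also have "?M * (real (grid_count (\<rho> / real m) B) * (\<rho> / real m) ^ CARD('d)) = real (grid_count (\<rho> / real m) B) * \<rho> ^ CARD('d)"
      using assms(2) by (simp add: power_divide)
    finally show ?case using M by simp
  qed
qed

section \<open>Hausdorff measure and Lebesgue measure\<close>

lemma bounded_lipschitz_image:
  assumes "lipschitz_on L S f" "bounded S" shows "bounded (f ` S)"
proof (cases "S = {}")
  case False
  then obtain a where a: "a \<in> S" by blast
  obtain e where "\<And>x. x \<in> S \<Longrightarrow> dist a x \<le> e" using assms(2) bounded_any_center by blast
  then have "dist (f a) (f x) \<le> L * e" if "x \<in> S" for x
    using lipschitz_onD[OF assms(1) a that] lipschitz_on_nonneg[OF assms(1)] that
    by (meson mult_left_mono order_trans)
  then show ?thesis by (auto simp: bounded_def)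
qed simp

lemma diameter_lipschitz_image:
  fixes f :: "'a::euclidean_space \<Rightarrow> 'b::euclidean_space"
  assumes "lipschitz_on L S f" "bounded S" shows "diameter (f ` S) \<le> L * diameter S"
proof (rule diameter_le)
  show "f ` S \<noteq> {} \<or> 0 \<le> L * diameter S"
    using lipschitz_on_nonneg[OF assms(1)] diameter_ge_0[OF assms(2)] by simp
  fix x y assume "x \<in> f ` S" "y \<in> f ` S"
  then obtain a b where ab: "a \<in> S" "b \<in> S" "x = f a" "y = f b" by blast
  have "dist x y \<le> L * dist a b" using lipschitz_onD[OF assms(1)] ab by blast
  also have "\<dots> \<le> L * diameter S"
    using lipschitz_on_nonneg[OF assms(1)] diameter_bounded_bound[OF assms(2)] ab by (intro mult_left_mono) auto
  finally show "norm (x - y) \<le> L * diameter S" by (simp add: dist_norm)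
qed

lemma hausdorff_outer_lipschitz_image:
  fixes f :: "'a::euclidean_space \<Rightarrow> 'b::euclidean_space"
  assumes L: "lipschitz_on L S f" "L > 0"
  shows "hausdorff_outer d (f ` S) \<le> ennreal (L ^ d) * hausdorff_outer d S"
  unfolding hausdorff_outer_def[of d "f ` S"]
proof (rule SUP_least)
  fix \<delta> :: real assume "\<delta> \<in> {0<..}"
  then have \<delta>: "\<delta> > 0" by simp
  have cancel: "ennreal (1 / L ^ d) * (ennreal (L ^ d) * a) = a" "ennreal (L ^ d) * (ennreal (1 / L ^ d) * a) = a" for a
    using L(2) by (simp_all add: mult.assoc[symmetric] ennreal_mult[symmetric])
  \<comment> \<open>The factor is moved to the left, so that the right side is a bare infimum over
    covers of \<open>S\<close>.\<close>
  have "ennreal (1 / L ^ d) * hausdorff_premeasure d \<delta> (f ` S) \<le> hausdorff_premeasure d (\<delta> / L) S"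
    unfolding hausdorff_premeasure_def[of d "\<delta>/L"]
  proof (rule INF_greatest, clarify)
      fix U :: "nat \<Rightarrow> 'a set"
      assume cov: "S \<subseteq> (\<Union>i. U i)" and U: "\<forall>i. bounded (U i) \<and> diameter (U i) \<le> \<delta> / L"
      define V where "V i = f ` (U i \<inter> S)" for i
      have lip: "lipschitz_on L (U i \<inter> S) f" for i using L(1) by (rule lipschitz_on_subset) auto
      have bd: "bounded (U i \<inter> S)" for i using U by (meson bounded_subset inf_le1)
      have dV: "diameter (V i) \<le> L * diameter (U i)" for i
      proof -
        have "diameter (V i) \<le> L * diameter (U i \<inter> S)"
          unfolding V_def by (rule diameter_lipschitz_image[OF lip bd])
        also have "\<dots> \<le> L * diameter (U i)"
          using L(2) U by (intro mult_left_mono diameter_subset) auto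
        finally show ?thesis .
      qed
      have bV: "bounded (V i)" for i unfolding V_def by (rule bounded_lipschitz_image[OF lip bd])
      have "hausdorff_premeasure d \<delta> (f ` S) \<le> (\<Sum>i. ennreal (diameter (V i) ^ d))"
      proof (rule hausdorff_premeasure_le)
        show "f ` S \<subseteq> (\<Union>i. V i)" using cov unfolding V_def by blast
        show "diameter (V i) \<le> \<delta>" for i
        proof -
          have "L * diameter (U i) \<le> L * (\<delta> / L)" using U L(2) by (intro mult_left_mono) auto
          then show ?thesis using dV[of i] L(2) by simp
        qed
      qed (rule bV)
      also have "\<dots> \<le> (\<Sum>i. ennreal (L ^ d) * ennreal (diameter (U i) ^ d))"
      proof (rule suminf_le)
        show "ennreal (diameter (V i) ^ d) \<le> ennreal (L ^ d) * ennreal (diameter (U i) ^ d)" for i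
          using power_mono[OF dV diameter_ge_0[OF bV], of i d] U L(2)
          by (simp add: ennreal_mult[symmetric] power_mult_distrib diameter_ge_0 ennreal_leI)
      qed auto
      also have "\<dots> = ennreal (L ^ d) * (\<Sum>i. ennreal (diameter (U i) ^ d))" by simp
      finally have "ennreal (1 / L ^ d) * hausdorff_premeasure d \<delta> (f ` S) \<le> ennreal (1 / L ^ d) * \<dots>"
        by (rule mult_left_mono) simp
      then show "ennreal (1 / L ^ d) * hausdorff_premeasure d \<delta> (f ` S) \<le> (\<Sum>i. ennreal (diameter (U i) ^ d))"
        unfolding cancel .
  qed
  also have "\<dots> \<le> hausdorff_outer d S" using \<delta> L(2) by (intro hausdorff_premeasure_le_outer) simp
  finally have "ennreal (L ^ d) * (ennreal (1 / L ^ d) * hausdorff_premeasure d \<delta> (f ` S)) \<le> ennreal (L ^ d) * hausdorff_outer d S"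
    by (rule mult_left_mono) simp
  also have "ennreal (L ^ d) * (ennreal (1 / L ^ d) * hausdorff_premeasure d \<delta> (f ` S)) = hausdorff_premeasure d \<delta> (f ` S)"
    by (rule cancel)
  finally show "hausdorff_premeasure d \<delta> (f ` S) \<le> ennreal (L ^ d) * hausdorff_outer d S" .
qed

lemma hausdorff_premeasure_le_card:
  fixes S :: "'a::euclidean_space set"
  assumes "finite F" "S \<subseteq> (\<Union>x\<in>F. cball x \<rho>)" "\<rho> \<ge> 0" "2 * \<rho> \<le> \<delta>" "d > 0"
  shows "hausdorff_premeasure d \<delta> S \<le> ennreal (real (card F) * (2 * \<rho>) ^ d)"
proof -
  obtain f where f: "bij_betw f {..<card F} F"
    using ex_bij_betw_nat_finite[OF assms(1)] by (auto simp: atLeast0LessThan)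
  define U where "U i = (if i < card F then cball (f i) \<rho> else {})" for i
  have "F = f ` {..<card F}" using f by (simp add: bij_betw_def)
  then have "S \<subseteq> (\<Union>i. U i)" using assms(2) by (force simp: U_def)
  then have "hausdorff_premeasure d \<delta> S \<le> (\<Sum>i. ennreal (diameter (U i) ^ d))"
    using assms by (intro hausdorff_premeasure_le) (auto simp: U_def)
  also have "\<dots> = (\<Sum>i<card F. ennreal (diameter (U i) ^ d))"
    using assms by (intro suminf_finite) (auto simp: U_def zero_power)
  also have "\<dots> = ennreal (real (card F) * (2 * \<rho>) ^ d)"
    using assms by (simp add: U_def ennreal_mult ennreal_of_nat_eq_real_of_nat)
  finally show ?thesis .
qed

lemma unit_cube_cbox: "(unit_cube :: (real ^ 'd::finite) set) = cbox 0 1"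
  by (auto simp: unit_cube_def mem_box_cart)

lemma compact_unit_cube: "compact (unit_cube :: (real ^ 'd::finite) set)"
  and convex_unit_cube: "convex (unit_cube :: (real ^ 'd::finite) set)"
  and zero_in_unit_cube: "0 \<in> (unit_cube :: (real ^ 'd::finite) set)"
  and emeasure_unit_cube: "emeasure lborel (unit_cube :: (real ^ 'd::finite) set) = 1"
proof -
  show "compact (unit_cube :: (real ^ 'd::finite) set)" "convex (unit_cube :: (real ^ 'd::finite) set)"
    by (simp_all add: unit_cube_cbox compact_cbox)
  show z: "0 \<in> (unit_cube :: (real ^ 'd::finite) set)" by (simp add: unit_cube_def)
  have "measure lborel (cbox 0 1 :: (real ^ 'd::finite) set) = 1"
    using z by (subst content_cbox_cart) (auto simp: unit_cube_cbox)
  then show "emeasure lborel (unit_cube :: (real ^ 'd::finite) set) = 1"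
    using emeasure_eq_ennreal_measure[of lborel "cbox 0 1 :: (real^'d) set"] emeasure_lborel_cbox_finite[of "0::real^'d" 1]
    by (simp add: unit_cube_cbox less_top)
qed

definition hausdorff_cube :: "'d::finite itself \<Rightarrow> ennreal" where
  "hausdorff_cube _ = hausdorff_outer CARD('d) (unit_cube :: (real ^ 'd) set)"

lemma grid_cover:
  fixes B :: "(real ^ 'd::finite) set"
  assumes "bounded B" "\<delta> > 0"
  obtains F where "finite F" "F \<subseteq> B" "card F \<le> grid_count \<delta> B" "B \<subseteq> (\<Union>x\<in>F. cball x (real CARD('d) * \<delta>))"
proof -
  define g where "g k = (SOME x. x \<in> B \<and> grid_cell \<delta> x = k)" for k
  have g: "g (grid_cell \<delta> x) \<in> B \<and> grid_cell \<delta> (g (grid_cell \<delta> x)) = grid_cell \<delta> x" if "x \<in> B" for x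
    unfolding g_def by (rule someI[of _ x]) (use that in auto)
  let ?F = "g ` grid_cell \<delta> ` B"
  note fin = finite_grid_cells[OF assms]
  show ?thesis
  proof (rule that)
    show "finite ?F" using fin by blast
    show "?F \<subseteq> B" using g by auto
    show "card ?F \<le> grid_count \<delta> B" unfolding grid_count_def by (rule card_image_le[OF fin])
    show "B \<subseteq> (\<Union>x\<in>?F. cball x (real CARD('d) * \<delta>))"
    proof
      fix x assume "x \<in> B"
      then have "dist (g (grid_cell \<delta> x)) x \<le> real CARD('d) * \<delta>" using grid_cell_dist[OF assms(2)] g by blast
      then show "x \<in> (\<Union>x\<in>?F. cball x (real CARD('d) * \<delta>))" using \<open>x \<in> B\<close> by (auto simp: mem_cball)
    qed
  qed
qed


text \<open>Balls around one point of each occupied cell cover \<open>B\<close>; their number is at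
  most a constant over \<open>r ^ CARD('d)\<close>, so the sums stay bounded as \<open>r\<close>
  shrinks.\<close>

lemma hausdorff_outer_compact_finite:
  fixes B :: "(real ^ 'd::finite) set"
  assumes "compact B" shows "hausdorff_outer CARD('d) B < \<infinity>"
proof -
  let ?d = "real CARD('d)"
  let ?C = "(measure lborel B + 1) * (2 * ?d) ^ CARD('d)"
  have "hausdorff_outer CARD('d) B \<le> ennreal ?C"
    unfolding hausdorff_outer_def
  proof (rule SUP_least)
    fix \<delta> :: real assume "\<delta> \<in> {0<..}"
    then have "\<forall>\<^sub>F r in at_right 0. 0 < r \<and> r < \<delta> / (2 * ?d)" by (intro eventually_at_right_small) simp
    moreover have "\<forall>\<^sub>F r in at_right 0. real (grid_count r B) * r ^ CARD('d) \<le> measure lborel B + 1"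
      by (rule grid_count_le_measure[OF assms]) simp
    ultimately have "\<forall>\<^sub>F r in at_right 0. 0 < r \<and> r < \<delta> / (2 * ?d) \<and> real (grid_count r B) * r ^ CARD('d) \<le> measure lborel B + 1"
      by eventually_elim blast
    then obtain r where r: "0 < r" "r < \<delta> / (2 * ?d)" "real (grid_count r B) * r ^ CARD('d) \<le> measure lborel B + 1"
      by (rule eventually_at_right_ex) blast
    obtain F where F: "finite F" "F \<subseteq> B" "card F \<le> grid_count r B" "B \<subseteq> (\<Union>x\<in>F. cball x (?d * r))"
      by (rule grid_cover[OF compact_imp_bounded[OF assms] r(1)])
    have "hausdorff_premeasure CARD('d) \<delta> B \<le> ennreal (real (card F) * (2 * (?d * r)) ^ CARD('d))"
    proof (rule hausdorff_premeasure_le_card[OF F(1,4)])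
      show "2 * (?d * r) \<le> \<delta>" using r(2) by (simp add: field_simps)
    qed (use r(1) in auto)
    also have "\<dots> \<le> ennreal ?C"
    proof (rule ennreal_leI)
      have "real (card F) * (2 * (?d * r)) ^ CARD('d) = (real (card F) * r ^ CARD('d)) * (2 * ?d) ^ CARD('d)"
        by (simp add: power_mult_distrib)
      also have "\<dots> \<le> (real (grid_count r B) * r ^ CARD('d)) * (2 * ?d) ^ CARD('d)"
        using F(3) r(1) by (intro mult_right_mono) auto
      also have "\<dots> \<le> ?C" using r(3) by (intro mult_right_mono) auto
      finally show "real (card F) * (2 * (?d * r)) ^ CARD('d) \<le> ?C" .
    qed
    finally show "hausdorff_premeasure CARD('d) \<delta> B \<le> ennreal ?C" .
  qed
  also have "ennreal ?C < \<infinity>" by simp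
  finally show ?thesis .
qed

lemma hausdorff_cube_finite: "hausdorff_cube TYPE('d::finite) < \<infinity>"
  unfolding hausdorff_cube_def by (rule hausdorff_outer_compact_finite[OF compact_unit_cube])

text \<open>A bounded set lies in a ball whose radius is its diameter, so covering the cube costs at
  least its volume divided by that of the unit ball. The bound is crude, but the normalization only
  needs a divisor that is neither 0 nor infinite.\<close>

lemma hausdorff_cube_pos: "hausdorff_cube TYPE('d::finite) > 0"
proof -
  let ?d = "CARD('d)"
  define \<beta> where "\<beta> = unit_ball_vol (real ?d)"
  have \<beta>: "\<beta> > 0" by (simp add: \<beta>_def)
  have "ennreal (1 / \<beta>) \<le> hausdorff_premeasure ?d 1 (unit_cube :: (real ^ 'd) set)"
    unfolding hausdorff_premeasure_def
  proof (rule INF_greatest, clarify)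
    fix U :: "nat \<Rightarrow> (real ^ 'd) set"
    assume cov: "unit_cube \<subseteq> (\<Union>i. U i)" and U: "\<forall>i. bounded (U i) \<and> diameter (U i) \<le> 1"
    define V where "V i = (if U i = {} then {} else cball (SOME x. x \<in> U i) (diameter (U i)))" for i
    have UV: "U i \<subseteq> V i" for i
    proof
      fix x assume x: "x \<in> U i"
      then have "(SOME x. x \<in> U i) \<in> U i" by (rule someI)
      then show "x \<in> V i" using x U diameter_bounded_bound[of "U i"] by (auto simp: V_def)
    qed
    have eV: "emeasure lborel (V i) \<le> ennreal \<beta> * ennreal (diameter (U i) ^ ?d)" for i
      using U diameter_ge_0[of "U i"] \<beta>
      by (auto simp: V_def emeasure_cball \<beta>_def ennreal_mult)
    have "1 = emeasure lborel (unit_cube :: (real ^ 'd) set)" by (simp add: emeasure_unit_cube)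
    also have "\<dots> \<le> emeasure lborel (\<Union>i. V i)"
    proof (rule emeasure_mono)
      show "unit_cube \<subseteq> (\<Union>i. V i)" using cov UV by blast
    qed (auto simp: V_def)
    also have "\<dots> \<le> (\<Sum>i. emeasure lborel (V i))"
      by (rule emeasure_subadditive_countably) (auto simp: V_def)
    also have "\<dots> \<le> (\<Sum>i. ennreal \<beta> * ennreal (diameter (U i) ^ ?d))"
      by (intro suminf_le eV) auto
    also have "\<dots> = ennreal \<beta> * (\<Sum>i. ennreal (diameter (U i) ^ ?d))" by simp
    finally have "ennreal (1/\<beta>) * 1 \<le> ennreal (1/\<beta>) * (ennreal \<beta> * (\<Sum>i. ennreal (diameter (U i) ^ ?d)))"
      by (rule mult_left_mono) simp
    also have "\<dots> = (\<Sum>i. ennreal (diameter (U i) ^ ?d))"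
      using \<beta> by (simp add: mult.assoc[symmetric] ennreal_mult[symmetric])
    finally show "ennreal (1 / \<beta>) \<le> (\<Sum>i. ennreal (diameter (U i) ^ ?d))" by simp
  qed
  also have "\<dots> \<le> hausdorff_cube TYPE('d)"
    unfolding hausdorff_cube_def by (rule hausdorff_premeasure_le_outer) simp
  finally have "ennreal (1/\<beta>) \<le> hausdorff_cube TYPE('d)" .
  moreover have "ennreal (1/\<beta>) > 0" using \<beta> by simp
  ultimately show ?thesis by (rule order.strict_trans2[rotated])
qed

section \<open>The normalized Hausdorff measure on full-dimensional sets\<close>

lemma sets_hausdorff_measure [simp]: "sets (hausdorff_measure D :: 'a::euclidean_space measure) = sets borel"
  and space_hausdorff_measure [simp]: "space (hausdorff_measure D :: 'a::euclidean_space measure) = UNIV"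
  unfolding hausdorff_measure_def
  using sets.sigma_sets_eq[of "borel :: 'a measure"] by (simp_all add: space_measure_of sets_measure_of)

lemma emeasure_hausdorff_measure:
  fixes S :: "'a::euclidean_space set"
  assumes "S \<in> sets borel"
  shows "emeasure (hausdorff_measure TYPE('d::finite)) S = hausdorff_outer CARD('d) S / hausdorff_cube TYPE('d)"
proof -
  have ms: "measure_space UNIV (sets (borel :: 'a measure)) (hausdorff_outer CARD('d))"
    by (rule measure_space_hausdorff_outer) simp
  have ca: "countably_additive (sets (borel :: 'a measure)) (hausdorff_outer CARD('d))"
    using ms by (simp add: measure_space_def)
  show ?thesis
    unfolding hausdorff_measure_def
  proof (subst emeasure_measure_of_sigma)
    show "sigma_algebra UNIV (sets (borel :: 'a measure))" using ms by (simp add: measure_space_def)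
    show "positive (sets borel) (\<lambda>S :: 'a set. hausdorff_outer CARD('d) S / hausdorff_outer CARD('d) (unit_cube :: (real ^ 'd) set))"
      by (simp add: positive_def hausdorff_outer_empty)
    show "countably_additive (sets borel) (\<lambda>S :: 'a set. hausdorff_outer CARD('d) S / hausdorff_outer CARD('d) (unit_cube :: (real ^ 'd) set))"
      using ca unfolding countably_additive_def by (simp add: divide_ennreal_def)
  qed (use assms in \<open>simp_all add: hausdorff_cube_def\<close>)
qed

lemma hausdorff_measure_lipschitz_image:
  fixes f :: "'a::euclidean_space \<Rightarrow> 'b::euclidean_space"
  assumes "lipschitz_on L S f" "L > 0" "S \<in> sets borel" "f ` S \<in> sets borel"
  shows "emeasure (hausdorff_measure TYPE('d::finite)) (f ` S) \<le> ennreal (L ^ CARD('d)) * emeasure (hausdorff_measure TYPE('d)) S"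
  using hausdorff_outer_lipschitz_image[OF assms(1,2), of "CARD('d)"] assms(3,4)
  by (simp add: emeasure_hausdorff_measure ennreal_times_divide divide_right_mono_ennreal)

lemma hausdorff_measure_unit_cube:
  "emeasure (hausdorff_measure TYPE('d)) (unit_cube :: (real ^ 'd::finite) set) = 1"
  using hausdorff_cube_finite[where 'd='d] hausdorff_cube_pos[where 'd='d]
  unfolding emeasure_hausdorff_measure[OF borel_compact[OF compact_unit_cube]] hausdorff_cube_def[of "TYPE('d)", symmetric]
  by simp

lemma hausdorff_measure_grid_cell:
  fixes k :: "int ^ 'd::finite"
  assumes "\<delta> > 0"
  shows "emeasure (hausdorff_measure TYPE('d)) {x. grid_cell \<delta> x = k} \<le> ennreal (\<delta> ^ CARD('d))"
proof -
  let ?f = "cell_point \<delta> k"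
  have lip: "lipschitz_on \<delta> unit_cube ?f"
    using assms by (auto intro!: lipschitz_onI simp: dist_norm dist_cell_point)
  have sub: "{x. grid_cell \<delta> x = k} \<subseteq> ?f ` unit_cube"
  proof
    fix y assume "y \<in> {x. grid_cell \<delta> x = k}"
    then have y: "grid_cell \<delta> y = k" by simp
    obtain x where "x \<in> unit_cube" "y = ?f x" by (rule grid_cell_point[OF assms y])
    then show "y \<in> ?f ` unit_cube" by blast
  qed
  have cont: "continuous_on unit_cube ?f" by (rule lipschitz_on_continuous_on[OF lip])
  have b: "?f ` unit_cube \<in> sets borel"
    using compact_continuous_image[OF cont compact_unit_cube] by (rule borel_compact)
  have "emeasure (hausdorff_measure TYPE('d)) {x. grid_cell \<delta> x = k} \<le> emeasure (hausdorff_measure TYPE('d)) (?f ` unit_cube)"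
    using sub b by (intro emeasure_mono) auto
  also have "\<dots> \<le> ennreal (\<delta> ^ CARD('d)) * emeasure (hausdorff_measure TYPE('d)) (unit_cube :: (real ^ 'd) set)"
    by (intro hausdorff_measure_lipschitz_image lip assms b borel_compact compact_unit_cube)
  finally show ?thesis by (simp add: hausdorff_measure_unit_cube)
qed

text \<open>By the normalization a cell has Hausdorff measure at most its volume, and the cells
  meeting \<open>B\<close> have total volume close to the measure of \<open>B\<close>.\<close>

lemma hausdorff_measure_compact_le:
  fixes B :: "(real ^ 'd::finite) set"
  assumes "compact B"
  shows "emeasure (hausdorff_measure TYPE('d)) B \<le> emeasure lborel B"
proof (rule ennreal_le_epsilon)
  let ?M = "hausdorff_measure TYPE('d) :: (real ^ 'd) measure"
  fix e :: real assume e: "e > 0"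
  obtain \<delta> where \<delta>: "\<delta> > 0" "real (grid_count \<delta> B) * \<delta> ^ CARD('d) \<le> measure lborel B + e"
    by (rule eventually_at_right_ex[OF grid_count_le_measure[OF assms e]])
  note fin = finite_grid_cells[OF compact_imp_bounded[OF assms] \<delta>(1)]
  have "emeasure ?M B \<le> emeasure ?M (\<Union>k\<in>grid_cell \<delta> ` B. {x. grid_cell \<delta> x = k})"
  proof (rule emeasure_mono)
    show "(\<Union>k\<in>grid_cell \<delta> ` B. {x. grid_cell \<delta> x = k}) \<in> sets ?M"
      using fin sets_grid_cell[OF \<delta>(1)] by (intro sets.finite_UN) auto
  qed auto
  also have "\<dots> \<le> (\<Sum>k\<in>grid_cell \<delta> ` B. emeasure ?M {x. grid_cell \<delta> x = k})"
    using fin sets_grid_cell[OF \<delta>(1)] by (intro emeasure_subadditive_finite) auto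
  also have "\<dots> \<le> (\<Sum>k\<in>grid_cell \<delta> ` B. ennreal (\<delta> ^ CARD('d)))"
    by (intro sum_mono hausdorff_measure_grid_cell \<delta>)
  also have "\<dots> = ennreal (real (grid_count \<delta> B) * \<delta> ^ CARD('d))"
    using \<delta>(1) by (simp add: grid_count_def ennreal_mult ennreal_of_nat_eq_real_of_nat)
  also have "\<dots> \<le> ennreal (measure lborel B + e)" by (rule ennreal_leI[OF \<delta>(2)])
  also have "\<dots> = emeasure lborel B + ennreal e"
    using e emeasure_compact_finite[OF assms] by (simp add: emeasure_eq_ennreal_measure less_top)
  finally show "emeasure ?M B \<le> emeasure lborel B + ennreal e" .
qed

text \<open>Open sets are exhausted by compact ones, and a Borel set sits in an open set of barely
  larger Lebesgue measure.\<close>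

lemma hausdorff_measure_borel_le:
  fixes B :: "(real ^ 'd::finite) set"
  assumes "B \<in> sets borel"
  shows "emeasure (hausdorff_measure TYPE('d)) B \<le> emeasure lborel B"
proof -
  let ?M = "hausdorff_measure TYPE('d) :: (real ^ 'd) measure"
  have op: "emeasure ?M T \<le> emeasure lborel T" if T: "open T" for T
  proof -
    obtain C where C: "\<And>n. compact (C n)" "\<And>n. C n \<subseteq> T" "\<And>n. C n \<subseteq> interior (C (Suc n))" "(\<Union>n. C n) = T"
      using open_Union_compact_subsets[OF T] by metis
    have inc: "incseq C" using C(3) interior_subset by (intro incseq_SucI) blast
    have "emeasure ?M T = (SUP n. emeasure ?M (C n))"
      using C(1) inc unfolding C(4)[symmetric] by (intro SUP_emeasure_incseq[symmetric]) (auto simp: borel_compact)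
    also have "\<dots> \<le> emeasure lborel T"
    proof (rule SUP_least)
      fix n
      have "emeasure ?M (C n) \<le> emeasure lborel (C n)" by (rule hausdorff_measure_compact_le[OF C(1)])
      also have "\<dots> \<le> emeasure lborel T" using T C(2) by (intro emeasure_mono) auto
      finally show "emeasure ?M (C n) \<le> emeasure lborel T" .
    qed
    finally show ?thesis .
  qed
  show ?thesis
  proof (rule ennreal_le_epsilon)
    fix e :: real assume e: "e > 0"
    obtain T where T: "open T" "B \<subseteq> T" "emeasure lebesgue (T - B) < ennreal e"
      using sets_lebesgue_outer_open[of B e] assms e by (metis sets_completionI_sets sets_lborel)
    have "emeasure ?M B \<le> emeasure ?M T" using T by (intro emeasure_mono) auto
    also have "\<dots> \<le> emeasure lborel T" by (rule op[OF T(1)])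
    also have "\<dots> = emeasure lborel B + emeasure lborel (T - B)"
      using assms T by (subst plus_emeasure) (auto simp: Un_absorb1)
    also have "emeasure lborel (T - B) \<le> ennreal e"
      using T assms by (auto intro: less_imp_le)
    finally show "emeasure ?M B \<le> emeasure lborel B + ennreal e" by (simp add: add_left_mono)
  qed
qed

definition centered_cube :: "real \<Rightarrow> (real ^ 'd::finite) set" where
  "centered_cube b = cbox (- (\<chi> i. b)) (\<chi> i. b)"

definition cube_map :: "real \<Rightarrow> real ^ 'd::finite \<Rightarrow> real ^ 'd" where
  "cube_map b x = (1 / (2 * b)) *\<^sub>R (x + (\<chi> i. b))"

lemma bounded_subset_centered_cube:
  fixes B :: "(real ^ 'd::finite) set"
  assumes "bounded B" obtains b where "b > 0" "B \<subseteq> centered_cube b"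
proof -
  obtain b where b: "b > 0" "\<And>x. x \<in> B \<Longrightarrow> norm x \<le> b" using assms bounded_pos by blast
  have "B \<subseteq> centered_cube b"
  proof
    fix x assume "x \<in> B"
    then have "\<bar>x $ i\<bar> \<le> b" for i using b component_le_norm_cart order_trans by blast
    then show "x \<in> centered_cube b" by (auto simp: centered_cube_def mem_box_cart abs_le_iff minus_le_iff)
  qed
  then show thesis using b(1) that by blast
qed

lemma emeasure_centered_cube:
  assumes "b > 0"
  shows "emeasure lborel (centered_cube b :: (real ^ 'd::finite) set) = ennreal ((2 * b) ^ CARD('d))"
proof -
  let ?W = "cbox (- (\<chi> i. b)) (\<chi> i. b) :: (real ^ 'd) set"
  have "0 \<in> ?W" using assms by (simp add: mem_box_cart)
  then have "measure lborel ?W = (2 * b) ^ CARD('d)" by (subst content_cbox_cart) auto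
  then show ?thesis
    using emeasure_eq_ennreal_measure[of lborel ?W] emeasure_lborel_cbox_finite[of "- (\<chi> i. b) :: real ^ 'd" "\<chi> i. b"]
    by (simp add: centered_cube_def less_top)
qed

lemma norm_cube_map:
  assumes "b > 0" shows "norm (cube_map b x - cube_map b y) = 1 / (2 * b) * norm (x - y)"
proof -
  have "cube_map b x - cube_map b y = (1 / (2 * b)) *\<^sub>R (x - y)"
    by (simp only: cube_map_def scaleR_diff_right[symmetric] add_diff_cancel_right)
  then show ?thesis using assms by simp
qed

lemma cube_map_image:
  assumes "b > 0" shows "cube_map b ` centered_cube b = (unit_cube :: (real ^ 'd::finite) set)"
proof (intro equalityI subsetI)
  fix y :: "real ^ 'd" assume "y \<in> cube_map b ` centered_cube b"
  then obtain x where x: "x \<in> centered_cube b" "y = cube_map b x" by blast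
  have "- b \<le> x $ i" "x $ i \<le> b" for i using x(1) by (auto simp: mem_box_cart centered_cube_def)
  then have "0 \<le> x $ i + b" "x $ i + b \<le> 2 * b" for i by (smt (verit))+
  then show "y \<in> unit_cube" using assms by (auto simp: unit_cube_def x(2) cube_map_def)
next
  fix y :: "real ^ 'd" assume "y \<in> unit_cube"
  then have y: "0 \<le> y $ i" "y $ i \<le> 1" for i by (auto simp: unit_cube_def)
  show "y \<in> cube_map b ` centered_cube b"
  proof (rule image_eqI)
    show "y = cube_map b ((2 * b) *\<^sub>R y - (\<chi> i. b))" using assms by (simp add: cube_map_def)
    have "2 * b * y $ i \<le> 2 * b" "0 \<le> 2 * b * y $ i" for i
      using y assms by (auto simp: mult_left_le)
    then show "(2 * b) *\<^sub>R y - (\<chi> i. b) \<in> centered_cube b" by (auto simp: mem_box_cart centered_cube_def)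
  qed
qed

text \<open>The inequality \<open>\<le>\<close> is known for all Borel sets. A large cube
  \<open>W\<close> is a scaled unit cube and satisfies the reverse inequality; as both
  \<open>B\<close> and \<open>W - B\<close> satisfy \<open>\<le>\<close>, neither can be
  strict.\<close>

lemma hausdorff_measure_eq_lborel:
  fixes B :: "(real ^ 'd::finite) set"
  assumes "B \<in> sets borel" "bounded B"
  shows "emeasure (hausdorff_measure TYPE('d)) B = emeasure lborel B"
proof -
  let ?M = "hausdorff_measure TYPE('d) :: (real ^ 'd) measure"
  obtain b where b: "b > 0" and W: "B \<subseteq> centered_cube b" by (rule bounded_subset_centered_cube[OF assms(2)])
  let ?W = "centered_cube b :: (real ^ 'd) set" and ?f = "cube_map b :: real ^ 'd \<Rightarrow> real ^ 'd"
  have Wb: "?W \<in> sets borel" by (simp add: centered_cube_def)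
  note mW = emeasure_centered_cube[OF b, where 'd='d] and img = cube_map_image[OF b, where 'd='d]
  have lip: "lipschitz_on (1 / (2 * b)) ?W ?f"
    by (rule lipschitz_onI) (use b in \<open>simp_all add: dist_norm norm_cube_map\<close>)
  have fb: "?f ` ?W \<in> sets borel" unfolding img by (rule borel_compact[OF compact_unit_cube])
  have "emeasure ?M (?f ` ?W) \<le> ennreal ((1 / (2 * b)) ^ CARD('d)) * emeasure ?M ?W"
    by (rule hausdorff_measure_lipschitz_image[OF lip _ Wb fb]) (use b in simp)
  then have "1 \<le> ennreal ((1 / (2 * b)) ^ CARD('d)) * emeasure ?M ?W"
    unfolding img hausdorff_measure_unit_cube .
  then have "ennreal ((2 * b) ^ CARD('d)) * 1 \<le> ennreal ((2 * b) ^ CARD('d)) * (ennreal ((1 / (2 * b)) ^ CARD('d)) * emeasure ?M ?W)"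
    by (rule mult_left_mono) simp
  also have "\<dots> = emeasure ?M ?W"
  proof -
    have "(2 * b) ^ CARD('d) * (1 / (2 * b)) ^ CARD('d) = 1"
      unfolding power_mult_distrib[symmetric] using b by simp
    then have "ennreal ((2 * b) ^ CARD('d)) * ennreal ((1 / (2 * b)) ^ CARD('d)) = 1"
      using b ennreal_mult[of "(2 * b) ^ CARD('d)" "(1 / (2 * b)) ^ CARD('d)"] by (simp only: zero_le_power) simp
    then show ?thesis by (simp only: mult.assoc[symmetric] mult_1)
  qed
  finally have MW: "emeasure lborel ?W \<le> emeasure ?M ?W" by (simp add: mW)
  have "emeasure lborel B + emeasure lborel (?W - B) = emeasure lborel ?W"
    using assms W Wb by (subst plus_emeasure) (auto simp: Un_absorb1)
  also have "\<dots> \<le> emeasure ?M ?W" by (rule MW)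
  also have "\<dots> = emeasure ?M B + emeasure ?M (?W - B)"
    using assms W Wb by (subst plus_emeasure) (auto simp: Un_absorb1)
  also have "\<dots> \<le> emeasure ?M B + emeasure lborel (?W - B)"
    using assms Wb by (intro add_left_mono hausdorff_measure_borel_le) auto
  finally have "emeasure lborel (?W - B) + emeasure lborel B \<le> emeasure lborel (?W - B) + emeasure ?M B"
    by (simp add: add.commute)
  moreover have "emeasure lborel (?W - B) \<noteq> top"
    using emeasure_mono[of "?W - B" ?W lborel] mW Wb by (auto simp: top_unique)
  ultimately have "emeasure lborel B \<le> emeasure ?M B" by (simp add: ennreal_add_left_cancel_le)
  then show ?thesis using hausdorff_measure_borel_le[OF assms(1)] by (rule antisym[rotated])
qed

section \<open>Riesz potentials\<close>

definition potential :: "real \<Rightarrow> 'a::euclidean_space multiset \<Rightarrow> 'a \<Rightarrow> ennreal" where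
  "potential s \<omega> y = (\<Sum>x\<in>#\<omega>. riesz_kernel s x y)"

text \<open>Levels are parametrized by a length: at level \<open>r\<close> one point takes care of
  the ball of radius \<open>r\<close> around it, and a similarity of ratio \<open>c\<close> turns
  level \<open>r\<close> into \<open>c * r\<close>. The number of points times \<open>r ^ d\<close>
  is then a cost that behaves like a volume.\<close>

definition dominates :: "real \<Rightarrow> real \<Rightarrow> 'a::euclidean_space set \<Rightarrow> 'a multiset \<Rightarrow> bool" where
  "dominates s r A \<omega> \<longleftrightarrow> (\<forall>y\<in>A. ennreal (r powr - s) \<le> potential s \<omega> y)"

lemma riesz_kernel_scale:
  assumes "c > 0" "s > 0" "norm (x' - y') \<le> c * norm (x - y)"
  shows "ennreal (c powr - s) * riesz_kernel s x y \<le> riesz_kernel s x' y'"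
proof (cases "x' = y'")
  case False
  then have "x \<noteq> y" using assms(3) by auto
  have "c powr - s * norm (x - y) powr - s = (c * norm (x - y)) powr - s"
    using assms by (simp add: powr_mult)
  also have "\<dots> \<le> norm (x' - y') powr - s"
    using assms False by (intro powr_mono2') auto
  finally show ?thesis using False \<open>x \<noteq> y\<close>
    by (simp add: riesz_kernel_def ennreal_mult[symmetric] ennreal_leI)
qed (simp add: riesz_kernel_def)

lemma potential_image_scale:
  assumes "c > 0" "s > 0" "\<And>x. x \<in># \<omega> \<Longrightarrow> norm (f x - y') \<le> c * norm (x - y)"
  shows "ennreal (c powr - s) * potential s \<omega> y \<le> potential s (image_mset f \<omega>) y'"
  using assms(3)
  by (induction \<omega>) (auto simp: potential_def distrib_left intro!: add_mono riesz_kernel_scale assms(1,2))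

lemma potential_image_mono:
  assumes "s > 0" "\<And>x. x \<in># \<omega> \<Longrightarrow> norm (f x - y') \<le> norm (x - y)"
  shows "potential s \<omega> y \<le> potential s (image_mset f \<omega>) y'"
  using potential_image_scale[of 1 s \<omega> f y' y] assms by simp

lemma potential_plus: "potential s (\<omega> + \<omega>') y = potential s \<omega> y + potential s \<omega>' y"
  by (simp add: potential_def)

lemma potential_subset: "\<omega> \<subseteq># \<omega>' \<Longrightarrow> potential s \<omega> y \<le> potential s \<omega>' y"
  unfolding mset_subset_eq_exists_conv by (auto simp: potential_plus)

lemma kernel_le_potential:
  assumes "x \<in># \<omega>" shows "riesz_kernel s x y \<le> potential s \<omega> y"
  using potential_subset[of "{#x#}" \<omega> s y] assms by (simp add: potential_def)

lemma ennreal_le_kernel: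
  assumes "s > 0" "norm (x - y) \<le> r"
  shows "ennreal (r powr - s) \<le> riesz_kernel s x y"
proof (cases "x = y")
  case False
  then show ?thesis using assms
    by (auto simp: riesz_kernel_def intro!: ennreal_leI powr_mono2')
qed (simp add: riesz_kernel_def)

lemma kernel_le_ennreal:
  assumes "s > 0" "norm (x - y) \<ge> r" "r > 0"
  shows "riesz_kernel s x y \<le> ennreal (r powr - s)"
  using assms by (auto simp: riesz_kernel_def intro!: ennreal_leI powr_mono2')

text \<open>A point close to \<open>y\<close> suffices on its own after the perturbation; if there is none, the
  perturbation changes all distances by a factor of at most \<open>1 + \<eta>\<close>.\<close>

lemma potential_perturb:
  assumes s: "s > 0" and r: "r > 0" and \<eta>: "\<eta> > 0" and e: "0 \<le> e" "e * (1 + \<eta>) \<le> \<eta> * r"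
    and move: "\<And>x. x \<in># \<omega> \<Longrightarrow> norm (f x - y') \<le> norm (x - y) + e"
    and pot: "ennreal (r powr - s) \<le> potential s \<omega> y"
  shows "ennreal (((1 + \<eta>) * r) powr - s) \<le> potential s (image_mset f \<omega>) y'"
proof (cases "\<exists>x\<in>#\<omega>. norm (x - y) + e \<le> r")
  case True
  then obtain x where x: "x \<in># \<omega>" "norm (x - y) + e \<le> r" by blast
  have "ennreal (((1 + \<eta>) * r) powr - s) \<le> ennreal (r powr - s)"
    using r \<eta> s by (intro ennreal_leI powr_mono2') auto
  also have "\<dots> \<le> riesz_kernel s (f x) y'" using move[OF x(1)] x(2) s by (intro ennreal_le_kernel) auto
  also have "\<dots> \<le> potential s (image_mset f \<omega>) y'" using x(1) by (intro kernel_le_potential) auto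
  finally show ?thesis .
next
  case False
  have "norm (f x - y') \<le> (1 + \<eta>) * norm (x - y)" if "x \<in># \<omega>" for x
  proof -
    have "norm (x - y) > r - e" using False that by force
    then have "\<eta> * norm (x - y) \<ge> \<eta> * (r - e)" using \<eta> by (intro mult_left_mono) auto
    also have "\<eta> * (r - e) \<ge> e" using e(2) by (simp add: algebra_simps)
    finally have "e \<le> \<eta> * norm (x - y)" .
    then show ?thesis using move[OF that] by (simp add: algebra_simps)
  qed
  then have "ennreal ((1 + \<eta>) powr - s) * potential s \<omega> y \<le> potential s (image_mset f \<omega>) y'"
    using s \<eta> by (intro potential_image_scale) auto
  moreover have "ennreal ((1 + \<eta>) powr - s) * ennreal (r powr - s) \<le> ennreal ((1 + \<eta>) powr - s) * potential s \<omega> y"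
    by (intro mult_left_mono pot) simp
  ultimately show ?thesis using r \<eta> by (simp add: ennreal_mult[symmetric] powr_mult)
qed

lemma size_mset_sum:
  fixes \<omega> :: "'k \<Rightarrow> 'a multiset"
  shows "finite K \<Longrightarrow> size (\<Sum>k\<in>K. \<omega> k) = (\<Sum>k\<in>K. size (\<omega> k))"
  by (induction K rule: finite_induct) auto

lemma potential_member_sum:
  assumes "finite K" "k \<in> K" shows "potential s (\<omega> k) y \<le> potential s (\<Sum>k\<in>K. \<omega> k) y"
proof -
  have "(\<Sum>k\<in>K. \<omega> k) = \<omega> k + (\<Sum>k\<in>K - {k}. \<omega> k)" using assms by (simp add: sum.remove)
  then show ?thesis by (simp add: potential_plus)
qed

lemma dominates_subset: "dominates s r A \<omega> \<Longrightarrow> B \<subseteq> A \<Longrightarrow> dominates s r B \<omega>"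
  by (auto simp: dominates_def)

lemma dominates_polarization: "dominates s r A \<omega> \<longleftrightarrow> ennreal (r powr - s) \<le> polarization s A \<omega>"
  by (auto simp: dominates_def polarization_def potential_def le_INF_iff)

text \<open>Since \<open>s > d\<close>, the points far away from a set have a negligible influence on it.\<close>

lemma dominates_near:
  fixes A :: "'a::euclidean_space set"
  assumes s: "s > real d" and \<delta>: "\<delta> > 0" and \<eta>: "\<eta> > 0"
  shows "\<forall>\<^sub>F r in at_right 0. \<forall>B \<omega>. (B :: 'a set) \<subseteq> A \<longrightarrow> dominates s r B \<omega> \<longrightarrow> real (size \<omega>) * r ^ d \<le> C \<longrightarrow>
           dominates s ((1 + \<eta>) * r) B (filter_mset (\<lambda>x. x \<in> (\<Union>a\<in>B. ball a \<delta>)) \<omega>)"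
proof -
  have s0: "s > 0" using s by (meson of_nat_0_le_iff order.strict_trans1)
  \<comment> \<open>Passing from level \<open>r\<close> to \<open>(1 + \<eta>) * r\<close> gives up
    the fraction \<open>q\<close> of \<open>r powr - s\<close>. The far points, at most
    \<open>C / r ^ d\<close> of them, contribute at most
    \<open>C * \<delta> powr - s / r ^ d\<close>, which is less than this for small \<open>r\<close>
    because \<open>s > d\<close>.\<close>
  define q where "q = 1 - (1 + \<eta>) powr - s"
  have q: "q > 0" unfolding q_def using \<eta> s0 by (simp add: powr_minus_divide)
  have "((\<lambda>r. C * \<delta> powr - s * r powr (s - real d)) \<longlongrightarrow> C * \<delta> powr - s * 0) (at_right 0)"
  proof (intro tendsto_intros)
    show "((\<lambda>r. r powr (s - real d)) \<longlongrightarrow> 0) (at_right (0::real))"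
    proof (rule tendsto_zero_powrI)
      show "((\<lambda>r. r) \<longlongrightarrow> 0) (at_right (0::real))" by (rule tendsto_ident_at)
    qed (use s in \<open>auto simp: eventually_at_right_less less_imp_le intro: eventually_mono[OF eventually_at_right_less]\<close>)
  qed
  then have "\<forall>\<^sub>F r in at_right 0. C * \<delta> powr - s * r powr (s - real d) < q"
    using q by (intro order_tendstoD(2)) auto
  moreover have "\<forall>\<^sub>F r in at_right (0::real). r > 0" by (rule eventually_at_right_less)
  ultimately show ?thesis
  proof eventually_elim
    case (elim r)
    show ?case
    proof (intro allI impI)
      fix B :: "'a set" and \<omega> assume "B \<subseteq> A" and dom: "dominates s r B \<omega>" and sz: "real (size \<omega>) * r ^ d \<le> C"
      let ?P = "\<lambda>x. x \<in> (\<Union>a\<in>B. ball a \<delta>)"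
      show "dominates s ((1 + \<eta>) * r) B (filter_mset ?P \<omega>)"
        unfolding dominates_def
      proof
        fix y assume y: "y \<in> B"
        have far: "potential s (filter_mset (\<lambda>x. \<not> ?P x) \<omega>) y \<le> ennreal (real (size \<omega>) * \<delta> powr - s)"
        proof -
          have "potential s (filter_mset (\<lambda>x. \<not> ?P x) \<omega>) y \<le> (\<Sum>x\<in>#filter_mset (\<lambda>x. \<not> ?P x) \<omega>. ennreal (\<delta> powr - s))"
            unfolding potential_def
          proof (intro sum_mset_mono kernel_le_ennreal s0 \<delta>)
            fix x assume "x \<in># filter_mset (\<lambda>x. \<not> ?P x) \<omega>"
            then have "x \<notin> ball y \<delta>" using y by auto
            then show "\<delta> \<le> norm (x - y)" by (simp add: dist_norm norm_minus_commute not_less)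
          qed
          also have "\<dots> = ennreal (real (size (filter_mset (\<lambda>x. \<not> ?P x) \<omega>)) * \<delta> powr - s)"
            by (simp add: ennreal_mult ennreal_of_nat_eq_real_of_nat)
          also have "\<dots> \<le> ennreal (real (size \<omega>) * \<delta> powr - s)"
            by (intro ennreal_leI mult_right_mono) (auto simp: size_filter_mset_lesseq)
          finally show ?thesis .
        qed
        have "real (size \<omega>) * \<delta> powr - s \<le> q * r powr - s"
        proof -
          have "r powr - real d * r ^ d = 1" using elim(2) by (simp add: powr_minus powr_realpow)
          then have "real (size \<omega>) = (real (size \<omega>) * r ^ d) * r powr - real d" by (simp add: mult.assoc mult.commute)
          also have "\<dots> \<le> C * r powr - real d" using sz by (intro mult_right_mono) auto
          finally have "real (size \<omega>) * \<delta> powr - s \<le> C * r powr - real d * \<delta> powr - s"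
            by (intro mult_right_mono) auto
          also have "r powr - real d = r powr (s - real d) * r powr - s" using elim(2) by (simp add: powr_add[symmetric])
          also have "C * (r powr (s - real d) * r powr - s) * \<delta> powr - s = (C * \<delta> powr - s * r powr (s - real d)) * r powr - s" by simp
          also have "\<dots> \<le> q * r powr - s" using elim(1) by (intro mult_right_mono) auto
          finally show ?thesis .
        qed
        then have far': "potential s (filter_mset (\<lambda>x. \<not> ?P x) \<omega>) y \<le> ennreal (q * r powr - s)"
          using far ennreal_leI order_trans by blast
        have "potential s \<omega> y = potential s (filter_mset ?P \<omega>) y + potential s (filter_mset (\<lambda>x. \<not> ?P x) \<omega>) y"
          by (subst multiset_partition[of \<omega> ?P]) (rule potential_plus)
        then have "ennreal (r powr - s) \<le> potential s (filter_mset ?P \<omega>) y + ennreal (q * r powr - s)"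
          using dom y far' by (auto simp: dominates_def intro: order_trans add_left_mono)
        moreover have "r powr - s = ((1 + \<eta>) * r) powr - s + q * r powr - s"
          using \<eta> elim(2) powr_mult[of "1 + \<eta>" r "- s"] by (simp add: q_def left_diff_distrib)
        then have "ennreal (r powr - s) = ennreal (((1 + \<eta>) * r) powr - s) + ennreal (q * r powr - s)"
          using q by (simp add: ennreal_plus[symmetric] del: ennreal_plus)
        ultimately show "ennreal (((1 + \<eta>) * r) powr - s) \<le> potential s (filter_mset ?P \<omega>) y"
          by (simp add: add.commute ennreal_add_left_cancel_le)
      qed
    qed
  qed
qed

section \<open>The cost of a potential level\<close>

text \<open>With \<open>n r\<close> the least number of points whose potential is at least \<open>r powr - s\<close> on \<open>A\<close>,
  these express \<open>limsup (n r * r ^ d) \<le> a\<close> (for points in \<open>A\<close>) and \<open>liminf (n r * r ^ d) \<ge> a\<close>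
  (for arbitrary points) as \<open>r\<close> tends to 0.\<close>

definition cost_le :: "real \<Rightarrow> nat \<Rightarrow> 'a::euclidean_space set \<Rightarrow> real \<Rightarrow> bool" where
  "cost_le s d A a \<longleftrightarrow> (\<forall>a'>a. \<forall>\<^sub>F r in at_right 0.
     \<exists>\<omega>. set_mset \<omega> \<subseteq> A \<and> real (size \<omega>) * r ^ d \<le> a' \<and> dominates s r A \<omega>)"

definition cost_ge :: "real \<Rightarrow> nat \<Rightarrow> 'a::euclidean_space set \<Rightarrow> real \<Rightarrow> bool" where
  "cost_ge s d A a \<longleftrightarrow> (\<forall>a'<a. \<forall>\<^sub>F r in at_right 0.
     \<forall>\<omega>. dominates s r A \<omega> \<longrightarrow> a' \<le> real (size \<omega>) * r ^ d)"

lemma cost_leD: "cost_le s d A a \<Longrightarrow> a < a' \<Longrightarrow>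
  \<forall>\<^sub>F r in at_right 0. \<exists>\<omega>. set_mset \<omega> \<subseteq> A \<and> real (size \<omega>) * r ^ d \<le> a' \<and> dominates s r A \<omega>"
  by (simp add: cost_le_def)

lemma cost_geD: "cost_ge s d A a \<Longrightarrow> a' < a \<Longrightarrow>
  \<forall>\<^sub>F r in at_right 0. \<forall>\<omega>. dominates s r A \<omega> \<longrightarrow> a' \<le> real (size \<omega>) * r ^ d"
  by (simp add: cost_ge_def)

lemma eventually_at_right_scale:
  assumes "\<forall>\<^sub>F r in at_right (0::real). P r" "c > 0"
  shows "\<forall>\<^sub>F r in at_right 0. P (c * r)"
proof -
  obtain b where b: "b > 0" "\<And>y. y > 0 \<Longrightarrow> y < b \<Longrightarrow> P y"
    using assms(1) eventually_at_right[of 0 1 P] by auto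
  have "\<forall>\<^sub>F r in at_right 0. 0 < r \<and> r < b / c" using b assms(2) by (intro eventually_at_right_small) simp
  then show ?thesis by eventually_elim (use b assms(2) in \<open>auto simp: field_simps\<close>)
qed

lemma cost_le_Un:
  assumes "cost_le s d A a" "cost_le s d B b" shows "cost_le s d (A \<union> B) (a + b)"
  unfolding cost_le_def
proof (intro allI impI)
  fix c assume "a + b < c"
  define t where "t = (c - a - b) / 2"
  have t: "t > 0" using \<open>a + b < c\<close> by (simp add: t_def)
  have "\<forall>\<^sub>F r in at_right 0. \<exists>\<omega>. set_mset \<omega> \<subseteq> A \<and> real (size \<omega>) * r ^ d \<le> a + t \<and> dominates s r A \<omega>"
    using assms(1) t by (intro cost_leD) auto
  moreover have "\<forall>\<^sub>F r in at_right 0. \<exists>\<omega>. set_mset \<omega> \<subseteq> B \<and> real (size \<omega>) * r ^ d \<le> b + t \<and> dominates s r B \<omega>"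
    using assms(2) t by (intro cost_leD) auto
  ultimately show "\<forall>\<^sub>F r in at_right 0. \<exists>\<omega>. set_mset \<omega> \<subseteq> A \<union> B \<and> real (size \<omega>) * r ^ d \<le> c \<and> dominates s r (A \<union> B) \<omega>"
  proof eventually_elim
    case (elim r)
    obtain \<omega>1 where 1: "set_mset \<omega>1 \<subseteq> A" "real (size \<omega>1) * r ^ d \<le> a + t" "dominates s r A \<omega>1" using elim(1) by blast
    obtain \<omega>2 where 2: "set_mset \<omega>2 \<subseteq> B" "real (size \<omega>2) * r ^ d \<le> b + t" "dominates s r B \<omega>2" using elim(2) by blast
    have "real (size (\<omega>1 + \<omega>2)) * r ^ d \<le> (a + t) + (b + t)" using 1(2) 2(2) by (simp add: distrib_right)
    also have "\<dots> = c" by (simp add: t_def field_simps)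
    finally have "real (size (\<omega>1 + \<omega>2)) * r ^ d \<le> c" .
    moreover have "dominates s r (A \<union> B) (\<omega>1 + \<omega>2)"
      using 1(3) 2(3) by (auto simp: dominates_def potential_plus intro: add_increasing add_increasing2)
    ultimately show ?case using 1(1) 2(1) by (intro exI[of _ "\<omega>1 + \<omega>2"]) auto
  qed
qed

lemma cost_le_UN:
  assumes "finite J" "\<And>j. j \<in> J \<Longrightarrow> cost_le s d (K j) (a j)"
  shows "cost_le s d (\<Union>j\<in>J. K j) (\<Sum>j\<in>J. a j)"
  using assms
proof (induction J rule: finite_induct)
  case empty
  have "cost_le s d {} 0" by (auto simp: cost_le_def dominates_def intro!: always_eventually exI[of _ "{#}"])
  then show ?case by simp
qed (simp add: cost_le_Un)

lemma cost_le_closed: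
  assumes "\<And>b. b > a \<Longrightarrow> \<exists>c<b. cost_le s d A c" shows "cost_le s d A a"
  using assms unfolding cost_le_def by blast

lemma cost_ge_closed:
  assumes "\<And>b. b < a \<Longrightarrow> \<exists>c>b. cost_ge s d A c" shows "cost_ge s d A a"
  using assms unfolding cost_ge_def by blast

text \<open>The competing configurations are unrestricted, so one for \<open>A\<close> also competes
  for \<open>B\<close>. The argument does not carry over to \<open>cost_le\<close>, whose
  configurations have to lie in the set.\<close>

lemma cost_ge_mono:
  assumes "cost_ge s d B a" "B \<subseteq> A" shows "cost_ge s d A a"
  unfolding cost_ge_def
proof (intro allI impI)
  fix a' assume "a' < a"
  from cost_geD[OF assms(1) this]
  show "\<forall>\<^sub>F r in at_right 0. \<forall>\<omega>. dominates s r A \<omega> \<longrightarrow> a' \<le> real (size \<omega>) * r ^ d"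
    by eventually_elim (use assms(2) dominates_subset in blast)
qed

text \<open>The sets are a distance \<open>\<delta>\<close> apart. By \<open>dominates_near\<close>
  the points within \<open>\<delta>/2\<close> of \<open>A\<close> alone still almost dominate
  \<open>A\<close>, likewise for \<open>B\<close>, and no point is used twice. The size bound
  required there is free, since only configurations of cost below \<open>c\<close> have to be
  excluded.\<close>

lemma cost_ge_disjoint_Un:
  fixes A B :: "'a::euclidean_space set"
  assumes s: "s > real d" and AB: "compact A" "compact B" "A \<inter> B = {}"
    and cost: "cost_ge s d A a" "cost_ge s d B b"
  shows "cost_ge s d (A \<union> B) (a + b)"
  unfolding cost_ge_def
proof (intro allI impI)
  fix c assume c: "c < a + b"
  show "\<forall>\<^sub>F r in at_right 0. \<forall>\<omega>. dominates s r (A \<union> B) \<omega> \<longrightarrow> c \<le> real (size \<omega>) * r ^ d"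
  proof (cases "c \<le> 0")
    case True
    have "\<forall>\<^sub>F r in at_right (0::real). r > 0" by (rule eventually_at_right_less)
    then show ?thesis
    proof eventually_elim
      case (elim r)
      then have "0 \<le> real (size \<omega>) * r ^ d" for \<omega> :: "'a multiset" by simp
      then show ?case using True order_trans by blast
    qed
  next
    case False
    obtain \<delta> where \<delta>: "\<delta> > 0" "\<And>x y. x \<in> A \<Longrightarrow> y \<in> B \<Longrightarrow> \<delta> \<le> dist x y"
      using separate_compact_closed[OF AB(1) compact_imp_closed[OF AB(2)] AB(3)] by auto
    have "((\<lambda>t. (1 + t) ^ d * c) \<longlongrightarrow> (1 + 0) ^ d * c) (at_right (0::real))"
      by (intro tendsto_intros tendsto_ident_at)
    moreover have "((\<lambda>t. (a - t) + (b - t)) \<longlongrightarrow> (a - 0) + (b - 0)) (at_right (0::real))"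
      by (intro tendsto_intros tendsto_ident_at)
    ultimately have "((\<lambda>t. (a - t) + (b - t) - (1 + t) ^ d * c) \<longlongrightarrow> (a - 0) + (b - 0) - (1 + 0) ^ d * c) (at_right (0::real))"
      by (rule tendsto_diff[rotated])
    then have "\<forall>\<^sub>F t in at_right 0. 0 < (a - t) + (b - t) - (1 + t) ^ d * c"
      using c by (intro order_tendstoD(1)) auto
    \<comment> \<open>\<open>t\<close> is both the margin in the two costs and the loss of level,
      which multiplies the count by \<open>(1 + t) ^ d\<close>; together these losses must stay
      below the gap between \<open>c\<close> and \<open>a + b\<close>.\<close>
    then obtain t where t: "t > 0" "0 < (a - t) + (b - t) - (1 + t) ^ d * c"
      by (rule eventually_at_right_ex)
    have "\<forall>\<^sub>F r in at_right 0. \<forall>C \<omega>. C \<subseteq> A \<union> B \<longrightarrow> dominates s r C \<omega> \<longrightarrow> real (size \<omega>) * r ^ d \<le> c \<longrightarrow>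
           dominates s ((1 + t) * r) C (filter_mset (\<lambda>x. x \<in> (\<Union>a\<in>C. ball a (\<delta>/2))) \<omega>)"
      using s t \<delta> by (intro dominates_near) auto
    moreover have "\<forall>\<^sub>F r in at_right 0. \<forall>\<omega>. dominates s ((1 + t) * r) A \<omega> \<longrightarrow> a - t \<le> real (size \<omega>) * ((1 + t) * r) ^ d"
      using t by (intro eventually_at_right_scale cost_geD[OF cost(1)]) auto
    moreover have "\<forall>\<^sub>F r in at_right 0. \<forall>\<omega>. dominates s ((1 + t) * r) B \<omega> \<longrightarrow> b - t \<le> real (size \<omega>) * ((1 + t) * r) ^ d"
      using t by (intro eventually_at_right_scale cost_geD[OF cost(2)]) auto
    moreover have "\<forall>\<^sub>F r in at_right (0::real). r > 0" by (rule eventually_at_right_less)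
    ultimately show ?thesis
    proof eventually_elim
      case (elim r)
      show ?case
      proof (intro allI impI, rule ccontr)
        fix \<omega> assume dom: "dominates s r (A \<union> B) \<omega>" and sm: "\<not> c \<le> real (size \<omega>) * r ^ d"
        define \<omega>1 where "\<omega>1 = filter_mset (\<lambda>x. x \<in> (\<Union>a\<in>A. ball a (\<delta>/2))) \<omega>"
        define \<omega>2 where "\<omega>2 = filter_mset (\<lambda>x. x \<in> (\<Union>a\<in>B. ball a (\<delta>/2))) \<omega>"
        have "dominates s r A \<omega>" "dominates s r B \<omega>" using dom by (auto intro: dominates_subset)
        then have d1: "dominates s ((1 + t) * r) A \<omega>1" and d2: "dominates s ((1 + t) * r) B \<omega>2"
          using elim(1) sm unfolding \<omega>1_def \<omega>2_def by auto
        have disj: False if x: "x \<in> (\<Union>a\<in>A. ball a (\<delta>/2))" "x \<in> (\<Union>a\<in>B. ball a (\<delta>/2))" for x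
        proof -
          obtain u where u: "u \<in> A" "dist u x < \<delta>/2" using x(1) by auto
          obtain v where v: "v \<in> B" "dist v x < \<delta>/2" using x(2) by auto
          have "dist u v < \<delta>" using u v dist_triangle_half_r[of x u \<delta> v] by (simp add: dist_commute)
          then show False using \<delta>(2)[OF u(1) v(1)] by simp
        qed
        have sz: "size \<omega>1 + size \<omega>2 \<le> size \<omega>"
          unfolding \<omega>1_def \<omega>2_def
        proof (induction \<omega>)
          case (add x \<omega>) then show ?case using disj[of x] by (auto intro: le_SucI)
        qed simp
        have "(a - t) + (b - t) \<le> real (size \<omega>1) * ((1 + t) * r) ^ d + real (size \<omega>2) * ((1 + t) * r) ^ d"
          using elim(2,3) d1 d2 by (intro add_mono) auto
        also have "\<dots> = real (size \<omega>1 + size \<omega>2) * ((1 + t) * r) ^ d" by (simp add: distrib_right)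
        also have "\<dots> \<le> real (size \<omega>) * ((1 + t) * r) ^ d"
          using sz elim(4) t(1) by (intro mult_right_mono) auto
        also have "\<dots> = (1 + t) ^ d * (real (size \<omega>) * r ^ d)" by (simp add: power_mult_distrib)
        also have "\<dots> \<le> (1 + t) ^ d * c" using sm t(1) by (intro mult_left_mono) auto
        finally show False using t(2) by simp
      qed
    qed
  qed
qed

lemma cost_ge_disjoint_UN:
  fixes K :: "'j \<Rightarrow> 'a::euclidean_space set"
  assumes "s > real d" "finite J" "\<And>j. j \<in> J \<Longrightarrow> compact (K j)" "disjoint_family_on K J"
    "\<And>j. j \<in> J \<Longrightarrow> cost_ge s d (K j) (a j)"
  shows "cost_ge s d (\<Union>j\<in>J. K j) (\<Sum>j\<in>J. a j)"
  using assms(2-5)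
proof (induction J rule: finite_induct)
  case empty
  have "\<forall>\<^sub>F r in at_right (0::real). r > 0" by (rule eventually_at_right_less)
  then have "\<forall>\<^sub>F r in at_right 0. \<forall>n::nat. 0 \<le> real n * r ^ d" by eventually_elim auto
  then show ?case unfolding cost_ge_def
    by (auto elim!: eventually_mono) (meson less_imp_le order_trans)
next
  case (insert j J)
  have "K j \<inter> (\<Union>i\<in>J. K i) = {}" using insert.prems(2) insert.hyps by (auto simp: disjoint_family_on_def)
  moreover have "compact (\<Union>i\<in>J. K i)" using insert by (intro compact_UN) auto
  moreover have "cost_ge s d (\<Union>i\<in>J. K i) (\<Sum>i\<in>J. a i)"
    using insert by (intro insert.IH) (auto intro: disjoint_family_on_mono)
  ultimately show ?case using insert by (simp add: cost_ge_disjoint_Un assms(1))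
qed

lemma cost_le_lipschitz_image:
  fixes f :: "'a::euclidean_space \<Rightarrow> 'b::euclidean_space"
  assumes s: "s > 0" and L: "L > 0" and lip: "lipschitz_on L B f" and cost: "cost_le s d B b"
  shows "cost_le s d (f ` B) (L ^ d * b)"
  unfolding cost_le_def
proof (intro allI impI)
  fix c assume "L ^ d * b < c"
  then have "b < c / L ^ d" using L by (simp add: field_simps)
  then have "\<forall>\<^sub>F r in at_right 0. \<exists>\<omega>. set_mset \<omega> \<subseteq> B \<and> real (size \<omega>) * (1 / L * r) ^ d \<le> c / L ^ d \<and> dominates s (1 / L * r) B \<omega>"
    using L by (intro eventually_at_right_scale cost_leD[OF cost]) auto
  moreover have "\<forall>\<^sub>F r in at_right (0::real). r > 0" by (rule eventually_at_right_less)
  ultimately show "\<forall>\<^sub>F r in at_right 0. \<exists>\<omega>. set_mset \<omega> \<subseteq> f ` B \<and> real (size \<omega>) * r ^ d \<le> c \<and> dominates s r (f ` B) \<omega>"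
  proof eventually_elim
    case (elim r)
    then obtain \<omega> where \<omega>: "set_mset \<omega> \<subseteq> B" "real (size \<omega>) * (1 / L * r) ^ d \<le> c / L ^ d" "dominates s (1 / L * r) B \<omega>" by blast
    have "dominates s r (f ` B) (image_mset f \<omega>)"
      unfolding dominates_def
    proof
      fix y' assume "y' \<in> f ` B"
      then obtain y where y: "y \<in> B" "y' = f y" by blast
      have "ennreal (r powr - s) = ennreal (L powr - s) * ennreal ((1 / L * r) powr - s)"
        using L elim(2) powr_mult[of L "1 / L * r" "- s"] by (simp add: ennreal_mult[symmetric])
      also have "\<dots> \<le> ennreal (L powr - s) * potential s \<omega> y"
        using \<omega>(3) y(1) by (intro mult_left_mono) (auto simp: dominates_def)
      also have "\<dots> \<le> potential s (image_mset f \<omega>) y'"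
        using lipschitz_onD[OF lip _ y(1)] \<omega>(1) s L by (intro potential_image_scale) (auto simp: y(2) dist_norm)
      finally show "ennreal (r powr - s) \<le> potential s (image_mset f \<omega>) y'" .
    qed
    moreover have "real (size \<omega>) * r ^ d \<le> c" using \<omega>(2) L by (simp add: field_simps power_mult_distrib)
    ultimately show ?case using \<omega>(1) by (intro exI[of _ "image_mset f \<omega>"]) auto
  qed
qed

text \<open>Contracting a configuration along with \<open>K\<close> can only raise potentials. The
  map has to contract the whole space, because the points of a dominating configuration may lie
  anywhere.\<close>

lemma cost_ge_contraction:
  fixes \<pi> :: "'a::euclidean_space \<Rightarrow> 'b::euclidean_space"
  assumes s: "s > 0" and lip: "lipschitz_on 1 UNIV \<pi>" and cost: "cost_ge s d (\<pi> ` K) b"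
  shows "cost_ge s d K b"
  unfolding cost_ge_def
proof (intro allI impI)
  fix c assume "c < b"
  from cost_geD[OF cost this]
  show "\<forall>\<^sub>F r in at_right 0. \<forall>\<omega>. dominates s r K \<omega> \<longrightarrow> c \<le> real (size \<omega>) * r ^ d"
  proof eventually_elim
    case (elim r)
    show ?case
    proof (intro allI impI)
      fix \<omega> assume dom: "dominates s r K \<omega>"
      have le: "potential s \<omega> y \<le> potential s (image_mset \<pi> \<omega>) (\<pi> y)" for y
        using lipschitz_onD[OF lip] s by (intro potential_image_mono) (auto simp: dist_norm)
      have "dominates s r (\<pi> ` K) (image_mset \<pi> \<omega>)"
        using dom le unfolding dominates_def by (auto intro: order_trans)
      then show "c \<le> real (size \<omega>) * r ^ d" using elim by fastforce
    qed
  qed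
qed

section \<open>The cost of the unit cube\<close>

text \<open>The infimum runs over all levels, not only small ones, and over points anywhere in
  space. Thus each configuration dominating the cube gives an inequality without error term, on
  which the lower bound for general sets relies.\<close>

definition cube_cost :: "'d::finite itself \<Rightarrow> real \<Rightarrow> real" where
  "cube_cost _ s = Inf {real (size \<omega>) * r ^ CARD('d) | r (\<omega> :: (real ^ 'd) multiset). r > 0 \<and> dominates s r unit_cube \<omega>}"

lemma cube_cost_le:
  fixes \<omega> :: "(real ^ 'd::finite) multiset"
  assumes "r > 0" "dominates s r unit_cube \<omega>"
  shows "cube_cost TYPE('d) s \<le> real (size \<omega>) * r ^ CARD('d)"
  unfolding cube_cost_def
proof (rule cInf_lower)
  show "bdd_below {real (size \<omega>) * r ^ CARD('d) | r (\<omega> :: (real ^ 'd) multiset). r > 0 \<and> dominates s r unit_cube \<omega>}"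
    by (rule bdd_belowI[of _ 0]) auto
qed (use assms in blast)

lemma unit_cube_norm_le:
  fixes x y :: "real ^ 'd::finite"
  assumes "x \<in> unit_cube" "y \<in> unit_cube" shows "norm (x - y) \<le> real CARD('d)"
proof -
  have "\<bar>(x - y) $ i\<bar> \<le> 1" for i
    using assms unfolding unit_cube_def by (simp add: abs_le_iff) (smt (verit))
  then have "(\<Sum>i\<in>UNIV. \<bar>(x - y) $ i\<bar>) \<le> real CARD('d)"
    using sum_bounded_above[of UNIV "\<lambda>i. \<bar>(x - y) $ i\<bar>" 1] by simp
  then show ?thesis using norm_le_l1_cart[of "x - y"] by simp
qed

lemma dominates_unit_cube_ex:
  assumes "s > 0"
  shows "dominates s (real CARD('d)) (unit_cube :: (real ^ 'd::finite) set) {#0#}"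
  unfolding dominates_def potential_def
  using assms unit_cube_norm_le[OF zero_in_unit_cube] by (auto intro!: ennreal_le_kernel)

text \<open>The nearest-point projection onto the convex cube takes no point farther from any point
  of the cube, so near-optimal configurations may be assumed to lie inside it. Their copies then
  stay within the closed cells.\<close>

lemma cube_cost_near_optimal:
  assumes "s > 0" "cube_cost TYPE('d::finite) s < c"
  obtains r and \<omega> :: "(real ^ 'd) multiset" where "r > 0" "set_mset \<omega> \<subseteq> unit_cube"
    "dominates s r unit_cube \<omega>" "real (size \<omega>) * r ^ CARD('d) < c"
proof -
  let ?S = "{real (size \<omega>) * r ^ CARD('d) | r (\<omega> :: (real ^ 'd) multiset). r > 0 \<and> dominates s r unit_cube \<omega>}"
  have "?S \<noteq> {}" using dominates_unit_cube_ex[OF assms(1), where 'd='d] zero_less_card_finite[where 'a='d] by fastforce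
  from cInf_lessD[OF this] assms(2) obtain r and \<omega> :: "(real ^ 'd) multiset"
    where r: "r > 0" "dominates s r unit_cube \<omega>" "real (size \<omega>) * r ^ CARD('d) < c"
    unfolding cube_cost_def by blast
  let ?p = "closest_point (unit_cube :: (real ^ 'd) set)"
  note cube = convex_unit_cube[where 'd='d] compact_imp_closed[OF compact_unit_cube[where 'd='d]]
  have ne: "(unit_cube :: (real ^ 'd) set) \<noteq> {}" using zero_in_unit_cube by blast
  have "potential s \<omega> y \<le> potential s (image_mset ?p \<omega>) y" if "y \<in> unit_cube" for y
    using assms(1) closest_point_lipschitz[OF cube ne, of _ y] closest_point_self[OF that]
    by (intro potential_image_mono) (auto simp: dist_norm)
  then have "dominates s r unit_cube (image_mset ?p \<omega>)"
    using r(2) unfolding dominates_def by (meson order_trans)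
  moreover have "set_mset (image_mset ?p \<omega>) \<subseteq> unit_cube"
    using closest_point_in_set[OF cube(2) ne] by auto
  ultimately show thesis using r by (intro that[of r "image_mset ?p \<omega>"]) auto
qed

lemma cube_cost_nonneg: "s > 0 \<Longrightarrow> 0 \<le> cube_cost TYPE('d::finite) s"
proof (rule ccontr)
  assume "s > 0" "\<not> 0 \<le> cube_cost TYPE('d::finite) s"
  then have lt: "cube_cost TYPE('d::finite) s < 0" by simp
  obtain r and \<omega> :: "(real ^ 'd) multiset" where "r > 0" "real (size \<omega>) * r ^ CARD('d) < 0"
    by (rule cube_cost_near_optimal[OF \<open>s > 0\<close> lt])
  then show False by (simp add: mult_less_0_iff)
qed

section \<open>Positivity of the cube constant\<close>

lemma borel_measurable_riesz_kernel [measurable]: "riesz_kernel s x \<in> borel_measurable borel"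
proof -
  have "(\<lambda>y. riesz_kernel s x y) \<in> borel_measurable borel" unfolding riesz_kernel_def by measurable
  then show ?thesis by simp
qed

lemma ennreal_le_suminf: "f k \<le> suminf f" for f :: "nat \<Rightarrow> ennreal"
  using sum_le_suminf[of f "{k}"] by simp

text \<open>Dyadic shells: between the radii \<open>2 ^ k * r\<close> and
  \<open>2 ^ Suc k * r\<close> the kernel is at most \<open>(2 ^ k * r) powr - s\<close>, while the
  volume grows like \<open>(2 ^ k) ^ DIM('a)\<close>. The contributions form a geometric series
  whose ratio \<open>q = 2 powr (DIM('a) - s)\<close> is below 1.\<close>

lemma nn_integral_riesz_kernel_outside_ball:
  assumes s: "s > real DIM('a::euclidean_space)"
  obtains C where "C > 0" "\<And>(x::'a) r. r > 0 \<Longrightarrow>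
    (\<integral>\<^sup>+y. riesz_kernel s x y * indicator (- ball x r) y \<partial>lborel) \<le> ennreal (C * r ^ DIM('a) * r powr - s)"
proof -
  let ?D = "DIM('a)"
  define q where "q = 2 powr (real ?D - s)"
  have q: "0 < q" "q < 1" using s by (auto simp: q_def powr_less_one)
  define \<beta> where "\<beta> = unit_ball_vol (real ?D)"
  have \<beta>: "\<beta> > 0" by (simp add: \<beta>_def)
  define C where "C = \<beta> * 2 ^ ?D * (1 / (1 - q))"
  have C: "C > 0" using \<beta> q by (simp add: C_def)
  show thesis
  proof (rule that[OF C])
    fix x :: 'a and r :: real assume r: "r > 0"
    define g where "g k y = ennreal ((2 ^ k * r) powr - s) * indicator (ball x (2 ^ Suc k * r)) y" for k y
    have g_meas: "g k \<in> borel_measurable lborel" for k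
    proof -
      have "(\<lambda>y. indicator (ball x (2 ^ Suc k * r)) y :: ennreal) \<in> borel_measurable lborel"
        by (rule borel_measurable_indicator) simp
      then have "(\<lambda>y. ennreal ((2 ^ k * r) powr - s) * indicator (ball x (2 ^ Suc k * r)) y) \<in> borel_measurable lborel"
        by (intro borel_measurable_times_ennreal borel_measurable_const)
      then show ?thesis unfolding g_def .
    qed
    have pw: "riesz_kernel s x y * indicator (- ball x r) y \<le> (\<Sum>k. g k y)" for y
    proof (cases "y \<in> ball x r")
      case False
      define \<rho> where "\<rho> = dist x y"
      have \<rho>: "\<rho> \<ge> r" using False by (simp add: \<rho>_def)
      obtain n where "\<rho> / r < 2 ^ n" using real_arch_pow[of 2 "\<rho> / r"] by auto
      then have ex: "\<rho> < 2 ^ n * r" using r by (simp add: field_simps)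
      define m where "m = (LEAST n. \<rho> < 2 ^ n * r)"
      have m: "\<rho> < 2 ^ m * r" unfolding m_def using ex by (rule LeastI)
      have "m \<noteq> 0" using m \<rho> by (cases m) auto
      then obtain k where k: "m = Suc k" using not0_implies_Suc by blast
      have "2 ^ k * r \<le> \<rho>" using not_less_Least[of k "\<lambda>n. \<rho> < 2 ^ n * r"] k unfolding m_def[symmetric] by simp
      then have "riesz_kernel s x y \<le> ennreal ((2 ^ k * r) powr - s)"
        using r s by (intro kernel_le_ennreal) (auto simp: \<rho>_def dist_norm intro: order.strict_trans1[of 0 "real ?D"])
      also have "\<dots> = g k y" using m by (simp add: g_def k \<rho>_def)
      also have "\<dots> \<le> (\<Sum>k. g k y)" by (rule ennreal_le_suminf)
      finally show ?thesis using False by simp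
    qed simp
    have "(\<integral>\<^sup>+y. riesz_kernel s x y * indicator (- ball x r) y \<partial>lborel) \<le> (\<integral>\<^sup>+y. (\<Sum>k. g k y) \<partial>lborel)"
      by (intro nn_integral_mono pw)
    also have "\<dots> = (\<Sum>k. \<integral>\<^sup>+y. g k y \<partial>lborel)" 
      by (rule nn_integral_suminf[OF g_meas])
    also have "\<dots> = (\<Sum>k. ennreal (\<beta> * 2 ^ ?D * r ^ ?D * r powr - s * q ^ k))"
    proof (rule suminf_cong)
      fix k
      have "(\<integral>\<^sup>+y. g k y \<partial>lborel) = ennreal ((2 ^ k * r) powr - s) * emeasure lborel (ball x (2 ^ Suc k * r))"
        unfolding g_def by (rule nn_integral_cmult_indicator) simp
      also have "\<dots> = ennreal ((2 ^ k * r) powr - s * (\<beta> * (2 ^ Suc k * r) ^ ?D))"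
        using r \<beta> by (simp add: emeasure_ball \<beta>_def[symmetric] ennreal_mult del: power_Suc)
      also have "(2 ^ k * r) powr - s * (\<beta> * (2 ^ Suc k * r) ^ ?D) = \<beta> * 2 ^ ?D * r ^ ?D * r powr - s * q ^ k"
      proof -
        have k2: "(2::real) ^ k = 2 powr real k" by (simp add: powr_realpow)
        have "q ^ k = q powr real k" using q by (simp add: powr_realpow)
        also have "\<dots> = 2 powr (real k * real ?D + real k * - s)"
          unfolding q_def powr_powr by (simp add: algebra_simps)
        also have "\<dots> = (2 powr real k) powr real ?D * (2 powr real k) powr - s"
          by (simp only: powr_powr powr_add)
        also have "\<dots> = (2 ^ k) ^ ?D * (2 ^ k) powr - s"
          unfolding k2 by (simp add: powr_realpow)
        finally have qk: "q ^ k = (2 ^ k) ^ ?D * (2 ^ k) powr - s" .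
        have "(2 ^ k * r) powr - s = (2 ^ k) powr - s * r powr - s" using r by (simp add: powr_mult)
        moreover have "(2 ^ Suc k * r) ^ ?D = 2 ^ ?D * (2 ^ k) ^ ?D * r ^ ?D" by (simp add: power_mult_distrib)
        ultimately show ?thesis unfolding qk by (simp add: mult_ac)
      qed
      finally show "(\<integral>\<^sup>+y. g k y \<partial>lborel) = ennreal (\<beta> * 2 ^ ?D * r ^ ?D * r powr - s * q ^ k)" .
    qed
    also have "\<dots> = ennreal (C * r ^ ?D * r powr - s)"
    proof (rule suminf_ennreal_eq)
      have "(\<lambda>k. q ^ k) sums (1 / (1 - q))" using q by (intro geometric_sums) auto
      then have "(\<lambda>k. (\<beta> * 2 ^ ?D * r ^ ?D * r powr - s) * q ^ k) sums ((\<beta> * 2 ^ ?D * r ^ ?D * r powr - s) * (1 / (1 - q)))"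
        by (rule sums_mult)
      then show "(\<lambda>k. \<beta> * 2 ^ ?D * r ^ ?D * r powr - s * q ^ k) sums (C * r ^ ?D * r powr - s)"
        by (simp add: C_def mult_ac)
    qed (use \<beta> q r in auto)
    finally show "(\<integral>\<^sup>+y. riesz_kernel s x y * indicator (- ball x r) y \<partial>lborel) \<le> ennreal (C * r ^ ?D * r powr - s)" .
  qed
qed

lemma borel_measurable_sum_mset_ennreal:
  fixes g :: "'b \<Rightarrow> 'a \<Rightarrow> ennreal"
  assumes "\<And>x. g x \<in> borel_measurable M"
  shows "(\<lambda>y. \<Sum>x\<in>#\<omega>. g x y) \<in> borel_measurable M"
  by (induction \<omega>) (use assms in auto)

lemma nn_integral_sum_mset:
  fixes g :: "'b \<Rightarrow> 'a \<Rightarrow> ennreal"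
  assumes "\<And>x. g x \<in> borel_measurable M"
  shows "(\<integral>\<^sup>+y. (\<Sum>x\<in>#\<omega>. g x y) \<partial>M) = (\<Sum>x\<in>#\<omega>. \<integral>\<^sup>+y. g x y \<partial>M)"
  by (induction \<omega>) (simp_all add: nn_integral_add assms borel_measurable_sum_mset_ennreal)

text \<open>Averaging the potential over the part of the cube that is not within distance \<open>r\<close> of the
  points shows that too few points cannot dominate the cube.\<close>

lemma cube_cost_pos:
  assumes s: "s > real CARD('d::finite)"
  shows "cube_cost TYPE('d) s > 0"
proof -
  let ?d = "CARD('d)"
  have s0: "s > 0" using s by (meson of_nat_0_le_iff order.strict_trans1)
  obtain C where C: "C > 0" "\<And>(x::real^'d) r. r > 0 \<Longrightarrow>
    (\<integral>\<^sup>+y. riesz_kernel s x y * indicator (- ball x r) y \<partial>lborel) \<le> ennreal (C * r ^ ?d * r powr - s)"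
    using nn_integral_riesz_kernel_outside_ball[where 'a="real^'d" and s=s] s by auto
  define \<beta> where "\<beta> = unit_ball_vol (real ?d)"
  have \<beta>: "\<beta> > 0" by (simp add: \<beta>_def)
  \<comment> \<open>For fewer than \<open>c / r ^ ?d\<close> points, the first bound lets the balls
    of radius \<open>r\<close> cover at most half of the cube; the second makes the potential
    integrate to less than \<open>r powr - s / 2\<close> over the remaining part.\<close>
  define c where "c = min (1 / (2 * \<beta>)) (1 / (2 * C))"
  have c: "c > 0" using C \<beta> by (simp add: c_def)
  have "c \<le> cube_cost TYPE('d) s"
  proof (rule ccontr)
    assume "\<not> c \<le> cube_cost TYPE('d) s"
    then have lt: "cube_cost TYPE('d) s < c" by simp
    obtain r and \<omega> :: "(real ^ 'd) multiset" where r: "r > 0"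
      and dom: "dominates s r unit_cube \<omega>" and sz: "real (size \<omega>) * r ^ ?d < c"
      by (rule cube_cost_near_optimal[OF s0 lt])
    define B where "B = (\<Union>x\<in>set_mset \<omega>. ball x r)"
    have Bb: "B \<in> sets borel" unfolding B_def by auto
    have cb: "(unit_cube :: (real ^ 'd) set) \<in> sets borel" by (rule borel_compact[OF compact_unit_cube])
    have "emeasure lborel B \<le> (\<Sum>x\<in>set_mset \<omega>. emeasure lborel (ball x r))"
      unfolding B_def by (rule emeasure_subadditive_finite) auto
    also have "\<dots> = ennreal (real (card (set_mset \<omega>)) * (\<beta> * r ^ ?d))"
      using r \<beta> by (simp add: emeasure_ball \<beta>_def[symmetric] ennreal_mult ennreal_of_nat_eq_real_of_nat)
    also have "\<dots> \<le> ennreal (1 / 2)"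
    proof (rule ennreal_leI)
      have "card (set_mset \<omega>) \<le> size \<omega>"
        by (induction \<omega>) (auto simp: card_insert_if)
      then have "real (card (set_mset \<omega>)) * (\<beta> * r ^ ?d) \<le> \<beta> * (real (size \<omega>) * r ^ ?d)"
        using \<beta> r by (simp add: mult_ac mult_left_mono)
      also have "\<dots> \<le> \<beta> * (1 / (2 * \<beta>))" using sz \<beta> by (intro mult_left_mono) (auto simp: c_def)
      finally show "real (card (set_mset \<omega>)) * (\<beta> * r ^ ?d) \<le> 1 / 2" using \<beta> by simp
    qed
    finally have mB: "emeasure lborel B \<le> ennreal (1/2)" .
    have "1 = emeasure lborel (unit_cube :: (real ^ 'd) set)" by (simp add: emeasure_unit_cube)
    also have "\<dots> \<le> emeasure lborel ((unit_cube - B) \<union> B)" using Bb cb by (intro emeasure_mono) auto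
    also have "\<dots> \<le> emeasure lborel (unit_cube - B) + emeasure lborel B"
      using Bb cb by (intro emeasure_subadditive) auto
    also have "\<dots> \<le> emeasure lborel (unit_cube - B) + ennreal (1/2)" by (intro add_left_mono mB)
    finally have le: "1 \<le> emeasure lborel (unit_cube - B) + ennreal (1/2)" .
    have "ennreal (1/2) + ennreal (1/2) = 1" by (subst ennreal_plus[symmetric]) auto
    with le have "ennreal (1/2) + ennreal (1/2) \<le> ennreal (1/2) + emeasure lborel (unit_cube - B)"
      by (simp only: add.commute)
    then have "ennreal (1/2) = \<infinity> \<or> ennreal (1/2) \<le> emeasure lborel (unit_cube - B)"
      by (simp only: ennreal_add_left_cancel_le)
    then have mD: "ennreal (1/2) \<le> emeasure lborel (unit_cube - B)" by auto
    have pw: "ennreal (r powr - s) * indicator (unit_cube - B) y \<le> (\<Sum>x\<in>#\<omega>. riesz_kernel s x y * indicator (- ball x r) y)" for y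
    proof (cases "y \<in> unit_cube - B")
      case True
      then have "ennreal (r powr - s) \<le> (\<Sum>x\<in>#\<omega>. riesz_kernel s x y)" using dom by (auto simp: dominates_def potential_def)
      also have "\<dots> = (\<Sum>x\<in>#\<omega>. riesz_kernel s x y * indicator (- ball x r) y)"
        using True by (intro arg_cong[where f=sum_mset] image_mset_cong) (auto simp: B_def)
      finally show ?thesis using True by simp
    qed simp
    have "ennreal (r powr - s * (1/2)) = ennreal (r powr - s) * ennreal (1/2)" by (intro ennreal_mult) auto
    also have "\<dots> \<le> ennreal (r powr - s) * emeasure lborel (unit_cube - B)" by (intro mult_left_mono mD) simp
    also have "\<dots> = (\<integral>\<^sup>+y. ennreal (r powr - s) * indicator (unit_cube - B) y \<partial>lborel)"
      using Bb cb by (intro nn_integral_cmult_indicator[symmetric]) auto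
    also have "\<dots> \<le> (\<integral>\<^sup>+y. (\<Sum>x\<in>#\<omega>. riesz_kernel s x y * indicator (- ball x r) y) \<partial>lborel)"
      by (intro nn_integral_mono pw)
    also have "\<dots> = (\<Sum>x\<in>#\<omega>. \<integral>\<^sup>+y. riesz_kernel s x y * indicator (- ball x r) y \<partial>lborel)"
      by (intro nn_integral_sum_mset borel_measurable_times_ennreal borel_measurable_indicator) simp_all
    also have "\<dots> \<le> (\<Sum>x\<in>#\<omega>. ennreal (C * r ^ ?d * r powr - s))" by (intro sum_mset_mono C(2) r)
    also have "\<dots> = ennreal (real (size \<omega>) * (C * r ^ ?d * r powr - s))"
      using C(1) r by (simp add: ennreal_mult ennreal_of_nat_eq_real_of_nat)
    finally have "r powr - s * (1/2) \<le> real (size \<omega>) * (C * r ^ ?d * r powr - s)"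
      using C(1) r by (subst (asm) ennreal_le_iff) auto
    also have "\<dots> = C * (real (size \<omega>) * r ^ ?d) * r powr - s" by simp
    also have "\<dots> < C * c * r powr - s" using sz C(1) r by (intro mult_strict_right_mono mult_strict_left_mono) auto
    also have "\<dots> \<le> C * (1 / (2 * C)) * r powr - s" using C(1) by (intro mult_right_mono mult_left_mono) (auto simp: c_def)
    finally show False using C(1) by simp
  qed
  with c show ?thesis by simp
qed

section \<open>The cost of compact sets of full dimension\<close>

lemma potential_cell_config:
  fixes y :: "real ^ 'd::finite"
  assumes s: "s > 0" and \<rho>: "\<rho> > 0" and dom: "dominates s r unit_cube \<omega>" and y: "grid_cell \<rho> y = k" and r: "r > 0"
  shows "ennreal ((\<rho> * r) powr - s) \<le> potential s (image_mset (cell_point \<rho> k) \<omega>) y"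
proof -
  obtain x where x: "x \<in> unit_cube" "y = cell_point \<rho> k x" by (rule grid_cell_point[OF \<rho> y])
  have "ennreal ((\<rho> * r) powr - s) = ennreal (\<rho> powr - s) * ennreal (r powr - s)"
    using \<rho> r by (simp add: powr_mult ennreal_mult)
  also have "\<dots> \<le> ennreal (\<rho> powr - s) * potential s \<omega> x"
    using dom x(1) by (intro mult_left_mono) (auto simp: dominates_def)
  also have "\<dots> \<le> potential s (image_mset (cell_point \<rho> k) \<omega>) y"
    using s \<rho> by (intro potential_image_scale) (auto simp: x(2) dist_cell_point)
  finally show ?thesis .
qed

text \<open>The bound holds for every \<open>b\<close> in the subcell, so any point of
  \<open>B\<close> found there can replace the cell point.\<close>

lemma subcell_near_cell_point:
  fixes x :: "real ^ 'd::finite"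
  assumes m: "m > 0" and \<rho>: "\<rho> > 0" and x: "x \<in> unit_cube"
  shows "\<exists>j\<in>subcells m k. \<forall>b. grid_cell (\<rho> / real m) b = j \<longrightarrow>
    dist (cell_point \<rho> k x) b \<le> real CARD('d) * (\<rho> / real m)"
proof -
  define \<delta> where "\<delta> = \<rho> / real m"
  have \<delta>: "\<delta> > 0" "\<rho> = \<delta> * real m" using m \<rho> by (simp_all add: \<delta>_def)
  \<comment> \<open>The minimum matters on the faces \<open>x $ i = 1\<close> of the closed cube,
    where the floor alone would point into the next cell.\<close>
  define c where "c i = min \<lfloor>real m * x $ i\<rfloor> (int m - 1)" for i
  have xi: "0 \<le> x $ i" "x $ i \<le> 1" for i using x by (auto simp: unit_cube_def)
  have mx: "0 \<le> real m * x $ i" "real m * x $ i \<le> real m" for i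
    using xi[of i] m by (auto simp: mult_left_le)
  have c: "0 \<le> c i" "c i < int m" for i using mx[of i] m by (auto simp: c_def)
  have cx: "of_int (c i) \<le> real m * x $ i" "real m * x $ i \<le> of_int (c i) + 1" for i
  proof -
    show "of_int (c i) \<le> real m * x $ i" unfolding c_def by linarith
    show "real m * x $ i \<le> of_int (c i) + 1" using mx(2)[of i] unfolding c_def by linarith
  qed
  define j where "j = (\<chi> i. int m * k $ i + c i)"
  have "(int m * k $ i + c i) div int m = k $ i" for i
    using c[of i] by (simp add: div_add1_eq)
  then have j: "j \<in> subcells m k" by (simp add: subcells_def j_def)
  show ?thesis
  proof (intro bexI[OF _ j] allI impI)
    fix b assume "grid_cell (\<rho> / real m) b = j"
    then have b: "\<delta> * of_int (j $ i) \<le> b $ i" "b $ i < \<delta> * (of_int (j $ i) + 1)" for i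
      using grid_cell_eq_iff[OF \<delta>(1)] by (auto simp: \<delta>_def)
    have "\<bar>(cell_point \<rho> k x - b) $ i\<bar> \<le> \<delta>" for i
    proof -
      have p: "cell_point \<rho> k x $ i = \<delta> * (real m * of_int (k $ i)) + \<delta> * (real m * x $ i)"
        unfolding cell_point_def \<delta>(2) by (simp add: algebra_simps)
      have "of_int (j $ i) = real m * of_int (k $ i) + of_int (c i)" by (simp add: j_def)
      then have q: "\<delta> * of_int (j $ i) = \<delta> * (real m * of_int (k $ i)) + \<delta> * of_int (c i)"
        by (simp add: distrib_left)
      have "\<delta> * of_int (c i) \<le> \<delta> * (real m * x $ i)" "\<delta> * (real m * x $ i) \<le> \<delta> * (of_int (c i) + 1)"
        using cx[of i] \<delta>(1) by (intro mult_left_mono; simp)+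
      moreover have "(cell_point \<rho> k x - b) $ i = cell_point \<rho> k x $ i - b $ i" by simp
      ultimately show ?thesis using b[of i] p q unfolding distrib_left mult_1_right abs_le_iff by linarith
    qed
    then have "(\<Sum>i\<in>UNIV. \<bar>(cell_point \<rho> k x - b) $ i\<bar>) \<le> real CARD('d) * \<delta>"
      using sum_bounded_above[of UNIV "\<lambda>i. \<bar>(cell_point \<rho> k x - b) $ i\<bar>" \<delta>] by simp
    then show "dist (cell_point \<rho> k x) b \<le> real CARD('d) * (\<rho> / real m)"
      using norm_le_l1_cart[of "cell_point \<rho> k x - b"] by (simp add: dist_norm \<delta>_def)
  qed
qed

text \<open>Each good cell receives a copy of one fixed near-optimal configuration of the unit cube,
  with every point moved to a nearby point of \<open>B\<close>. In bad cells such points may be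
  missing, so one point of \<open>B\<close> per occupied subcell is used there; this costs a bounded
  number of points per bad cell, and bad cells are rare.\<close>

lemma cost_le_compact:
  fixes B :: "(real ^ 'd::finite) set"
  assumes s: "s > 0" and B: "compact B"
  shows "cost_le s CARD('d) B (cube_cost TYPE('d) s * measure lborel B)"
  unfolding cost_le_def
proof (intro allI impI)
  let ?d = "CARD('d)"
  define \<theta> where "\<theta> = cube_cost TYPE('d) s"
  define L where "L = measure lborel B"
  have \<theta>: "\<theta> \<ge> 0" using cube_cost_nonneg[OF s] by (simp add: \<theta>_def)
  have L: "L \<ge> 0" by (simp add: L_def)
  fix a assume "cube_cost TYPE('d) s * measure lborel B < a"
  then have a: "\<theta> * L < a" by (simp add: \<theta>_def L_def)
  have "((\<lambda>t. (1 + t) ^ ?d * ((\<theta> + t) * (L + t)) + t) \<longlongrightarrow> (1 + 0) ^ ?d * ((\<theta> + 0) * (L + 0)) + 0) (at_right (0::real))"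
    by (intro tendsto_intros tendsto_ident_at)
  then have "\<forall>\<^sub>F t in at_right 0. (1 + t) ^ ?d * ((\<theta> + t) * (L + t)) + t < a"
    using a by (intro order_tendstoD(2)) auto
  then obtain t where t: "t > 0" "(1 + t) ^ ?d * ((\<theta> + t) * (L + t)) + t < a" by (rule eventually_at_right_ex)
  have "cube_cost TYPE('d) s < \<theta> + t" using t(1) by (simp add: \<theta>_def)
  then obtain r0 and \<omega>0 :: "(real ^ 'd) multiset" where r0: "r0 > 0" and \<omega>0: "set_mset \<omega>0 \<subseteq> unit_cube"
    "dominates s r0 unit_cube \<omega>0" "real (size \<omega>0) * r0 ^ ?d < \<theta> + t"
    by (rule cube_cost_near_optimal[OF s])
  \<comment> \<open>\<open>m\<close> is so large that the displacement \<open>e\<close>, the bound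
    on the diameter of a subcell, meets the condition
    \<open>e * (1 + t) \<le> t * (\<rho> * r0)\<close> of \<open>potential_perturb\<close> at every
    scale \<open>\<rho>\<close>.\<close>
  obtain m :: nat where m: "real m > real ?d * (1 + t) / (t * r0)" using reals_Archimedean2 by blast
  have "real ?d * (1 + t) / (t * r0) > 0" using t r0 by simp
  then have m0: "m > 0" using m by linarith
  have me: "real ?d * (1 + t) \<le> t * r0 * real m" using m t r0 by (simp add: field_simps)
  \<comment> \<open>A copy in a cell of side \<open>\<rho>\<close> dominates at level
    \<open>\<rho> * r0\<close>; moving its points into \<open>B\<close> changes this to
    \<open>(1 + t) * \<rho> * r0\<close>, which is \<open>q * \<rho>\<close>.\<close>
  define q where "q = (1 + t) * r0"
  have q: "q > 0" using t r0 by (simp add: q_def)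
  \<comment> \<open>Chosen so that the points spent on the bad cells, at most \<open>m ^ ?d\<close>
    for each, add at most \<open>t\<close> to the cost.\<close>
  define \<epsilon> where "\<epsilon> = t / (real (m ^ ?d) * q ^ ?d)"
  have \<epsilon>: "\<epsilon> > 0" using t m0 q by (simp add: \<epsilon>_def)
  have main: "\<exists>\<omega>. set_mset \<omega> \<subseteq> B \<and> real (size \<omega>) * (q * \<rho>) ^ ?d \<le> a \<and> dominates s (q * \<rho>) B \<omega>"
    if \<rho>: "\<rho> > 0" and N: "real (grid_count \<rho> B) * \<rho> ^ ?d \<le> L + t"
      and bad: "real (card (bad_cells m \<rho> B)) * \<rho> ^ ?d \<le> \<epsilon>" for \<rho>
  proof -
    let ?bad = "bad_cells m \<rho> B"
    define \<delta> where "\<delta> = \<rho> / real m"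
    have \<delta>: "\<delta> > 0" using \<rho> m0 by (simp add: \<delta>_def)
    define e where "e = real ?d * \<delta>"
    have e0: "e \<ge> 0" using \<delta> by (simp add: e_def)
    have e: "e * (1 + t) \<le> t * (\<rho> * r0)"
    proof -
      have "e * (1 + t) = (real ?d * (1 + t)) * \<delta>" by (simp add: e_def)
      also have "\<dots> \<le> (t * r0 * real m) * \<delta>" using me \<delta> by (intro mult_right_mono) auto
      also have "\<dots> = t * (\<rho> * r0)" using m0 by (simp add: \<delta>_def)
      finally show ?thesis .
    qed
    have eq: "e \<le> q * \<rho>"
    proof -
      have "e * 1 \<le> e * (1 + t)" using e0 t by (intro mult_left_mono) auto
      also note e
      also have "t * (\<rho> * r0) \<le> q * \<rho>" using t r0 \<rho> by (simp add: q_def algebra_simps)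
      finally show ?thesis by simp
    qed
    note finG = finite_grid_cells[OF compact_imp_bounded[OF B] \<rho>]
    define G where "G = grid_cell \<rho> ` B - ?bad"
    have fG: "finite G" using finG by (simp add: G_def)
    have fbad: "finite ?bad" using finG by (rule finite_subset[rotated]) (auto simp: bad_cells_def)
    define f where "f k x = (SOME b. b \<in> B \<and> dist (cell_point \<rho> k x) b \<le> e)" for k x
    have f: "f k x \<in> B \<and> dist (cell_point \<rho> k x) (f k x) \<le> e" if kG: "k \<in> G" and x: "x \<in> unit_cube" for k x
    proof -
      obtain j where j: "j \<in> subcells m k" "\<And>b. grid_cell (\<rho> / real m) b = j \<Longrightarrow> dist (cell_point \<rho> k x) b \<le> real CARD('d) * (\<rho> / real m)"
        using subcell_near_cell_point[OF m0 \<rho> x, of k] by blast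
      have "subcells m k \<subseteq> grid_cell (\<rho> / real m) ` B" using kG by (auto simp: G_def bad_cells_def)
      then obtain b where "b \<in> B" "grid_cell (\<rho> / real m) b = j" using j(1) by blast
      then have "b \<in> B \<and> dist (cell_point \<rho> k x) b \<le> e" using j(2) by (simp add: e_def \<delta>_def)
      then show ?thesis unfolding f_def by (rule someI)
    qed
    define B' where "B' = {y \<in> B. grid_cell \<rho> y \<in> ?bad}"
    have bB': "bounded B'" using compact_imp_bounded[OF B] by (rule bounded_subset) (auto simp: B'_def)
    obtain F where F: "finite F" "F \<subseteq> B'" "card F \<le> grid_count \<delta> B'" "B' \<subseteq> (\<Union>x\<in>F. cball x (real ?d * \<delta>))"
      by (rule grid_cover[OF bB' \<delta>])
    have "grid_cell \<delta> ` B' \<subseteq> (\<Union>k\<in>?bad. subcells m k)"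
      using subcells_cell[OF m0, of \<rho>] by (auto simp: B'_def \<delta>_def)
    then have "grid_count \<delta> B' \<le> card (\<Union>k\<in>?bad. subcells m k)"
      unfolding grid_count_def using fbad finite_subcells[OF m0] by (intro card_mono finite_UN_I) auto
    also have "\<dots> \<le> (\<Sum>k\<in>?bad. card (subcells m k))" by (rule card_UN_le[OF fbad])
    also have "\<dots> \<le> (\<Sum>k\<in>?bad. m ^ ?d)" by (intro sum_mono card_subcells m0)
    also have "\<dots> = card ?bad * m ^ ?d" by simp
    finally have cF: "card F \<le> card ?bad * m ^ ?d" using F(3) by simp
    define \<omega> where "\<omega> = (\<Sum>k\<in>G. image_mset (f k) \<omega>0) + mset_set F"
    have "set_mset \<omega> \<subseteq> B"
      using f \<omega>0(1) F(1,2) fG by (auto simp: \<omega>_def B'_def set_mset_sum)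
    moreover have "real (size \<omega>) * (q * \<rho>) ^ ?d \<le> a"
    proof -
      have "size \<omega> = card G * size \<omega>0 + card F" using fG by (simp add: \<omega>_def size_mset_sum)
      also have "\<dots> \<le> grid_count \<rho> B * size \<omega>0 + card ?bad * m ^ ?d"
        using cF finG unfolding G_def grid_count_def by (intro add_mono mult_right_mono card_mono) auto
      finally have "real (size \<omega>) * (q * \<rho>) ^ ?d \<le> real (grid_count \<rho> B * size \<omega>0 + card ?bad * m ^ ?d) * (q * \<rho>) ^ ?d"
        using q \<rho> by (intro mult_right_mono of_nat_mono) simp_all
      also have "\<dots> = (1 + t) ^ ?d * ((real (size \<omega>0) * r0 ^ ?d) * (real (grid_count \<rho> B) * \<rho> ^ ?d))
           + (real (card ?bad) * \<rho> ^ ?d) * (real (m ^ ?d) * q ^ ?d)"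
      proof -
        have qd: "(q * \<rho>) ^ ?d = (1 + t) ^ ?d * (r0 ^ ?d * \<rho> ^ ?d)" by (simp only: q_def power_mult_distrib mult.assoc)
        have "real (grid_count \<rho> B * size \<omega>0) * (q * \<rho>) ^ ?d = (1 + t) ^ ?d * ((real (size \<omega>0) * r0 ^ ?d) * (real (grid_count \<rho> B) * \<rho> ^ ?d))"
          unfolding qd of_nat_mult by (simp only: mult_ac)
        moreover have "real (card ?bad * m ^ ?d) * (q * \<rho>) ^ ?d = (real (card ?bad) * \<rho> ^ ?d) * (real (m ^ ?d) * q ^ ?d)"
          unfolding power_mult_distrib of_nat_mult by (simp only: mult_ac)
        ultimately show ?thesis by (simp only: of_nat_add distrib_right)
      qed
      also have "\<dots> \<le> (1 + t) ^ ?d * ((\<theta> + t) * (L + t)) + \<epsilon> * (real (m ^ ?d) * q ^ ?d)"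
        using N bad \<omega>0(3) t \<theta> r0 \<rho> q by (intro add_mono mult_left_mono mult_mono mult_right_mono) auto
      also have "\<epsilon> * (real (m ^ ?d) * q ^ ?d) = t" using m0 q by (simp add: \<epsilon>_def)
      finally show ?thesis using t(2) by simp
    qed
    moreover have "dominates s (q * \<rho>) B \<omega>"
      unfolding dominates_def
    proof
      fix y assume y: "y \<in> B"
      define k where "k = grid_cell \<rho> y"
      show "ennreal ((q * \<rho>) powr - s) \<le> potential s \<omega> y"
      proof (cases "k \<in> ?bad")
        case True
        then have "y \<in> B'" using y by (simp add: B'_def k_def)
        then obtain x where x: "x \<in> F" "y \<in> cball x (real ?d * \<delta>)" using F(4) by blast
        then have "norm (x - y) \<le> q * \<rho>" using eq by (simp add: dist_norm e_def)
        then have "ennreal ((q * \<rho>) powr - s) \<le> riesz_kernel s x y" using s by (rule ennreal_le_kernel[rotated])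
        also have "\<dots> \<le> potential s \<omega> y" using x(1) F(1) by (intro kernel_le_potential) (simp add: \<omega>_def)
        finally show ?thesis .
      next
        case False
        then have kG: "k \<in> G" using y by (simp add: G_def k_def)
        let ?\<omega>k = "image_mset (cell_point \<rho> k) \<omega>0"
        have pk: "ennreal ((\<rho> * r0) powr - s) \<le> potential s ?\<omega>k y"
          by (rule potential_cell_config[OF s \<rho> \<omega>0(2) k_def[symmetric] r0])
        \<comment> \<open>The same choice as \<open>f k\<close>, but as a function of the
          transplanted point, the form in which \<open>potential_perturb\<close> takes a
          displacement.\<close>
        define g where "g p = (SOME b. b \<in> B \<and> dist p b \<le> e)" for p
        have fg: "f k x = g (cell_point \<rho> k x)" for x by (simp add: f_def g_def)
        have "ennreal (((1 + t) * (\<rho> * r0)) powr - s) \<le> potential s (image_mset g ?\<omega>k) y"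
        proof (rule potential_perturb[OF s _ t(1) e0 e _ pk])
          show "\<rho> * r0 > 0" using \<rho> r0 by simp
          fix p assume "p \<in># ?\<omega>k"
          then obtain x where x: "x \<in> unit_cube" "p = cell_point \<rho> k x" using \<omega>0(1) by auto
          have "dist p (g p) \<le> e" using f[OF kG x(1)] by (simp add: fg x(2))
          then show "norm (g p - y) \<le> norm (p - y) + e"
            using dist_triangle[of "g p" y p] by (simp add: dist_norm norm_minus_commute)
        qed
        also have "image_mset g ?\<omega>k = image_mset (f k) \<omega>0"
          using ext[of "f k", OF fg] by (simp add: multiset.map_comp o_def)
        also have "potential s (image_mset (f k) \<omega>0) y \<le> potential s (\<Sum>k\<in>G. image_mset (f k) \<omega>0) y"
          by (rule potential_member_sum[OF fG kG])
        also have "\<dots> \<le> potential s \<omega> y" by (simp add: \<omega>_def potential_plus)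
        finally show ?thesis by (simp add: q_def mult_ac)
      qed
    qed
    ultimately show ?thesis by blast
  qed
  have "\<forall>\<^sub>F \<rho> in at_right 0. 0 < \<rho> \<and> real (grid_count \<rho> B) * \<rho> ^ ?d \<le> L + t \<and> real (card (bad_cells m \<rho> B)) * \<rho> ^ ?d \<le> \<epsilon>"
    using grid_count_le_measure[OF B t(1)] bad_cells_negligible[OF B m0 \<epsilon>]
    by (simp add: eventually_conj_iff L_def eventually_at_right_less)
  then have "\<forall>\<^sub>F \<rho> in at_right 0. \<exists>\<omega>. set_mset \<omega> \<subseteq> B \<and> real (size \<omega>) * (q * \<rho>) ^ ?d \<le> a \<and> dominates s (q * \<rho>) B \<omega>"
    by (rule eventually_mono) (use main in blast)
  from eventually_at_right_scale[OF this, of "1/q"] q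
  show "\<forall>\<^sub>F r in at_right 0. \<exists>\<omega>. set_mset \<omega> \<subseteq> B \<and> real (size \<omega>) * r ^ ?d \<le> a \<and> dominates s r B \<omega>"
    by simp
qed


text \<open>The similarity of ratio \<open>1 / (2 * b)\<close> takes the big cube to the unit cube,
  where the infimum applies at every level.\<close>

lemma dominates_centered_cube_cost:
  fixes \<omega> :: "(real ^ 'd::finite) multiset"
  assumes s: "s > 0" and r: "r > 0" and b: "b > 0" and dom: "dominates s r (centered_cube b) \<omega>"
  shows "cube_cost TYPE('d) s * (2 * b) ^ CARD('d) \<le> real (size \<omega>) * r ^ CARD('d)"
proof -
  let ?c = "1 / (2 * b)" and ?f = "cube_map b :: real ^ 'd \<Rightarrow> real ^ 'd"
  have c: "?c > 0" using b by simp
  have "dominates s (?c * r) unit_cube (image_mset ?f \<omega>)"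
    unfolding dominates_def cube_map_image[OF b, symmetric]
  proof
    fix y :: "real ^ 'd" assume "y \<in> ?f ` centered_cube b"
    then obtain z where z: "z \<in> centered_cube b" "y = ?f z" by blast
    have "ennreal ((?c * r) powr - s) = ennreal (?c powr - s) * ennreal (r powr - s)"
      using b r powr_mult[of ?c r "- s"] by (simp add: ennreal_mult)
    also have "\<dots> \<le> ennreal (?c powr - s) * potential s \<omega> z"
      using dom z(1) by (intro mult_left_mono) (auto simp: dominates_def)
    also have "\<dots> \<le> potential s (image_mset ?f \<omega>) y"
      unfolding z(2) by (rule potential_image_scale[OF c s]) (simp only: norm_cube_map[OF b] order_refl)
    finally show "ennreal ((?c * r) powr - s) \<le> potential s (image_mset ?f \<omega>) y" .
  qed
  then have "cube_cost TYPE('d) s \<le> real (size (image_mset ?f \<omega>)) * (?c * r) ^ CARD('d)"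
    using r b by (intro cube_cost_le) auto
  then have "cube_cost TYPE('d) s * (2 * b) ^ CARD('d) \<le> real (size \<omega>) * (?c * r) ^ CARD('d) * (2 * b) ^ CARD('d)"
    using b by (intro mult_right_mono) auto
  also have "\<dots> = real (size \<omega>) * (?c * r * (2 * b)) ^ CARD('d)" by (simp only: power_mult_distrib mult.assoc)
  also have "?c * r * (2 * b) = r" using b by simp
  finally show ?thesis .
qed

text \<open>A configuration dominating \<open>B\<close> nearly dominates the cells in which \<open>B\<close> is dense on the
  scale of the subcells. Filling the remaining cells of a large cube with nearly optimal
  configurations gives a configuration for the large cube.\<close>

lemma cost_ge_compact:
  fixes B :: "(real ^ 'd::finite) set"
  assumes s: "s > 0" and B: "compact B"
  shows "cost_ge s CARD('d) B (cube_cost TYPE('d) s * measure lborel B)"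
  unfolding cost_ge_def
proof (intro allI impI)
  let ?d = "CARD('d)"
  define \<theta> where "\<theta> = cube_cost TYPE('d) s"
  define L where "L = measure lborel B"
  have \<theta>: "\<theta> \<ge> 0" using cube_cost_nonneg[OF s] by (simp add: \<theta>_def)
  obtain b where b: "b > 0" and BW': "B \<subseteq> centered_cube b"
    by (rule bounded_subset_centered_cube[OF compact_imp_bounded[OF B]])
  define W :: "(real ^ 'd) set" where "W = centered_cube b"
  have BW: "B \<subseteq> W" using BW' by (simp add: W_def)
  have W: "compact W" by (simp add: W_def centered_cube_def)
  define V where "V = (2 * b) ^ ?d"
  have V: "measure lborel W = V"
    using b by (simp add: measure_def W_def V_def emeasure_centered_cube)
  fix a assume "a < cube_cost TYPE('d) s * measure lborel B"
  then have a: "a < \<theta> * L" by (simp add: \<theta>_def L_def)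
  have "((\<lambda>t. \<theta> * V - (\<theta> + t) * (V - L + 2 * t) - (1 + t) ^ ?d * a) \<longlongrightarrow> \<theta> * V - (\<theta> + 0) * (V - L + 2 * 0) - (1 + 0) ^ ?d * a) (at_right (0::real))"
    by (intro tendsto_intros tendsto_ident_at)
  then have "\<forall>\<^sub>F t in at_right 0. 0 < \<theta> * V - (\<theta> + t) * (V - L + 2 * t) - (1 + t) ^ ?d * a"
    using a by (intro order_tendstoD(1)) (auto simp: algebra_simps)
  \<comment> \<open>\<open>V - L + 2 * t\<close> will bound the volume of the filled cells: the
    excess of the grid count of \<open>W\<close> and the bad cells account for one \<open>t\<close>
    each.\<close>
  then obtain t where t: "t > 0" "0 < \<theta> * V - (\<theta> + t) * (V - L + 2 * t) - (1 + t) ^ ?d * a" by (rule eventually_at_right_ex)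
  have "cube_cost TYPE('d) s < \<theta> + t" using t(1) by (simp add: \<theta>_def)
  then obtain r0 and \<omega>0 :: "(real ^ 'd) multiset" where r0: "r0 > 0" and \<omega>0: "set_mset \<omega>0 \<subseteq> unit_cube"
    "dominates s r0 unit_cube \<omega>0" "real (size \<omega>0) * r0 ^ ?d < \<theta> + t"
    by (rule cube_cost_near_optimal[OF s])
  \<comment> \<open>There are two factors \<open>1 + t\<close> because the displacement is measured
    against the level \<open>q * \<rho> = \<rho> * r0 / (1 + t)\<close>.\<close>
  obtain m :: nat where m: "real m > real ?d * ((1 + t) * (1 + t)) / (t * r0)" using reals_Archimedean2 by blast
  have "real ?d * ((1 + t) * (1 + t)) / (t * r0) > 0" using t r0 by simp
  then have m0: "m > 0" using m by linarith
  have me: "real ?d * ((1 + t) * (1 + t)) \<le> t * r0 * real m" using m t r0 by (simp add: field_simps)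
  \<comment> \<open>Passing from \<open>B\<close> to whole cells changes the level
    \<open>q * \<rho>\<close> to \<open>(1 + t) * q * \<rho> = \<rho> * r0\<close>, the level at
    which the filling copies dominate their cells.\<close>
  define q where "q = r0 / (1 + t)"
  have q: "q > 0" "(1 + t) * q = r0" using t r0 by (simp_all add: q_def)
  have main: "\<forall>\<omega>. dominates s (q * \<rho>) B \<omega> \<longrightarrow> a \<le> real (size \<omega>) * (q * \<rho>) ^ ?d"
    if \<rho>: "\<rho> > 0" and N: "real (grid_count \<rho> W) * \<rho> ^ ?d \<le> V + t"
      and bad: "real (card (bad_cells m \<rho> B)) * \<rho> ^ ?d \<le> t" for \<rho>
  proof (intro allI impI)
    fix \<omega> assume dom: "dominates s (q * \<rho>) B \<omega>"
    let ?bad = "bad_cells m \<rho> B"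
    define e where "e = real ?d * (\<rho> / real m)"
    have e0: "e \<ge> 0" using \<rho> by (simp add: e_def)
    have e: "e * (1 + t) \<le> t * (q * \<rho>)"
    proof -
      have "e * (1 + t) * (1 + t) = (real ?d * ((1 + t) * (1 + t))) * (\<rho> / real m)" by (simp add: e_def)
      also have "\<dots> \<le> (t * r0 * real m) * (\<rho> / real m)" using me \<rho> by (intro mult_right_mono) auto
      also have "\<dots> = t * (q * \<rho>) * (1 + t)" using m0 q(2) by (simp add: mult_ac)
      finally show ?thesis using t by simp
    qed
    note finW = finite_grid_cells[OF compact_imp_bounded[OF W] \<rho>]
    have finB: "finite (grid_cell \<rho> ` B)" using finW BW by (meson finite_subset image_mono)
    have badB: "?bad \<subseteq> grid_cell \<rho> ` B" by (auto simp: bad_cells_def)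
    define G where "G = (grid_cell \<rho> ` W - grid_cell \<rho> ` B) \<union> ?bad"
    have fG: "finite G" using finW finB badB by (auto simp: G_def intro: finite_subset)
    have cG: "real (card G) * \<rho> ^ ?d \<le> V - L + 2 * t"
    proof -
      have "card G \<le> card (grid_cell \<rho> ` W - grid_cell \<rho> ` B) + card ?bad" unfolding G_def by (rule card_Un_le)
      also have "card (grid_cell \<rho> ` W - grid_cell \<rho> ` B) = grid_count \<rho> W - grid_count \<rho> B"
        unfolding grid_count_def using BW finB by (intro card_Diff_subset image_mono) auto
      finally have "card G + grid_count \<rho> B \<le> grid_count \<rho> W + card ?bad"
        using card_mono[OF finW image_mono[OF BW]] by (simp add: grid_count_def)
      then have "real (card G) + real (grid_count \<rho> B) \<le> real (grid_count \<rho> W) + real (card ?bad)" by linarith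
      then have "(real (card G) + real (grid_count \<rho> B)) * \<rho> ^ ?d \<le> (real (grid_count \<rho> W) + real (card ?bad)) * \<rho> ^ ?d"
        using \<rho> by (intro mult_right_mono) auto
      moreover have "L \<le> real (grid_count \<rho> B) * \<rho> ^ ?d"
        unfolding L_def by (rule measure_le_grid_count[OF compact_imp_bounded[OF B] \<rho>])
      ultimately show ?thesis using N bad by (simp add: distrib_right)
    qed
    define \<omega>' where "\<omega>' = \<omega> + (\<Sum>k\<in>G. image_mset (cell_point \<rho> k) \<omega>0)"
    have "dominates s (\<rho> * r0) W \<omega>'"
      unfolding dominates_def
    proof
      fix y assume y: "y \<in> W"
      define k where "k = grid_cell \<rho> y"
      show "ennreal ((\<rho> * r0) powr - s) \<le> potential s \<omega>' y"
      proof (cases "k \<in> G")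
        case True
        have "ennreal ((\<rho> * r0) powr - s) \<le> potential s (image_mset (cell_point \<rho> k) \<omega>0) y"
          by (rule potential_cell_config[OF s \<rho> \<omega>0(2) k_def[symmetric] r0])
        also have "\<dots> \<le> potential s (\<Sum>k\<in>G. image_mset (cell_point \<rho> k) \<omega>0) y"
          by (rule potential_member_sum[OF fG True])
        also have "\<dots> \<le> potential s \<omega>' y" by (simp add: \<omega>'_def potential_plus)
        finally show ?thesis .
      next
        case False
        then have "k \<in> grid_cell \<rho> ` B" "k \<notin> ?bad" using y by (auto simp: G_def k_def)
        then have "subcells m k \<subseteq> grid_cell (\<rho> / real m) ` B" by (auto simp: bad_cells_def)
        moreover have "grid_cell (\<rho> / real m) y \<in> subcells m k" unfolding k_def by (rule subcells_cell[OF m0])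
        ultimately have "grid_cell (\<rho> / real m) y \<in> grid_cell (\<rho> / real m) ` B" by (rule subsetD)
        then obtain z where z: "z \<in> B" "grid_cell (\<rho> / real m) z = grid_cell (\<rho> / real m) y" by (metis imageE)
        have zy: "dist z y \<le> e" unfolding e_def using \<rho> m0 z(2) by (intro grid_cell_dist) auto
        have "ennreal (((1 + t) * (q * \<rho>)) powr - s) \<le> potential s (image_mset (\<lambda>x. x) \<omega>) y"
        proof (rule potential_perturb[OF s _ t(1) e0 e])
          show "q * \<rho> > 0" using q \<rho> by simp
          show "norm (x - y) \<le> norm (x - z) + e" for x
            using dist_triangle[of x y z] zy by (simp add: dist_norm)
          show "ennreal ((q * \<rho>) powr - s) \<le> potential s \<omega> z" using dom z(1) by (simp add: dominates_def)
        qed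
        moreover have "(1 + t) * (q * \<rho>) = \<rho> * r0" using q(2) by (simp add: mult_ac)
        ultimately have "ennreal ((\<rho> * r0) powr - s) \<le> potential s \<omega> y" by simp
        also have "\<dots> \<le> potential s \<omega>' y" by (simp add: \<omega>'_def potential_plus)
        finally show ?thesis .
      qed
    qed
    \<comment> \<open>The exact inequality for the big cube; subtracting the cost of the filling
      leaves the bound for \<open>\<omega>\<close>.\<close>
    then have "\<theta> * V \<le> real (size \<omega>') * (\<rho> * r0) ^ ?d"
      unfolding \<theta>_def V_def W_def using \<rho> r0 b by (intro dominates_centered_cube_cost s) auto
    also have "size \<omega>' = size \<omega> + card G * size \<omega>0" using fG by (simp add: \<omega>'_def size_mset_sum)
    also have "real (size \<omega> + card G * size \<omega>0) * (\<rho> * r0) ^ ?d =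
        (1 + t) ^ ?d * (real (size \<omega>) * (q * \<rho>) ^ ?d) + (real (size \<omega>0) * r0 ^ ?d) * (real (card G) * \<rho> ^ ?d)"
    proof -
      have "(1 + t) ^ ?d * (q * \<rho>) ^ ?d = ((1 + t) * q * \<rho>) ^ ?d"
        unfolding power_mult_distrib[symmetric] by (simp only: mult.assoc)
      then have "(1 + t) ^ ?d * (real (size \<omega>) * (q * \<rho>) ^ ?d) = real (size \<omega>) * (\<rho> * r0) ^ ?d"
        unfolding q(2) by (metis mult.commute mult.left_commute)
      then show ?thesis unfolding power_mult_distrib of_nat_add of_nat_mult distrib_right by (simp only: mult_ac)
    qed
    also have "\<dots> \<le> (1 + t) ^ ?d * (real (size \<omega>) * (q * \<rho>) ^ ?d) + (\<theta> + t) * (V - L + 2 * t)"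
      using \<omega>0(3) cG \<theta> t(1) \<rho> by (intro add_left_mono mult_mono) auto
    finally have "(1 + t) ^ ?d * a \<le> (1 + t) ^ ?d * (real (size \<omega>) * (q * \<rho>) ^ ?d)" using t(2) by simp
    then show "a \<le> real (size \<omega>) * (q * \<rho>) ^ ?d" using t(1) by (simp add: mult_le_cancel_left_pos)
  qed
  have "\<forall>\<^sub>F \<rho> in at_right 0. 0 < \<rho> \<and> real (grid_count \<rho> W) * \<rho> ^ ?d \<le> V + t \<and> real (card (bad_cells m \<rho> B)) * \<rho> ^ ?d \<le> t"
    using grid_count_le_measure[OF W t(1)] bad_cells_negligible[OF B m0 t(1)]
    by (simp add: eventually_conj_iff V eventually_at_right_less)
  then have "\<forall>\<^sub>F \<rho> in at_right 0. \<forall>\<omega>. dominates s (q * \<rho>) B \<omega> \<longrightarrow> a \<le> real (size \<omega>) * (q * \<rho>) ^ ?d"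
    by (rule eventually_mono) (use main in blast)
  from eventually_at_right_scale[OF this, of "1/q"] q
  show "\<forall>\<^sub>F r in at_right 0. \<forall>\<omega>. dominates s r B \<omega> \<longrightarrow> a \<le> real (size \<omega>) * r ^ ?d"
    by simp
qed

section \<open>Strongly rectifiable sets\<close>

lemma upper_minkowski_content_mono:
  "S \<subseteq> T \<Longrightarrow> upper_minkowski_content d S \<le> upper_minkowski_content d (T :: 'a::euclidean_space set)"
  unfolding upper_minkowski_content_def
  by (intro Limsup_mono always_eventually allI divide_right_mono_ennreal emeasure_mono) (auto intro!: borel_open)

text \<open>Intersect all pieces with \<open>B\<close>. This makes the cost formula available for
  every compact subset of \<open>A\<close>, as the weak convergence requires.\<close>

lemma strongly_rectifiable_subset:
  assumes "strongly_rectifiable d A" "compact B" "B \<subseteq> A"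
  shows "strongly_rectifiable d B"
  unfolding strongly_rectifiable_def
proof (intro allI impI)
  fix \<epsilon> :: real assume "\<epsilon> > 0"
  then obtain R K and k :: nat where *: "compact R" "upper_minkowski_content d R < ennreal \<epsilon>"
    "\<forall>j\<in>{1..k}. compact (K j)" "disjoint_family_on K {1..k}" "A = R \<union> (\<Union>j\<in>{1..k}. K j)"
    "\<forall>j\<in>{1..k}. \<exists>G. lipschitz_graph d \<epsilon> G \<and> K j \<subseteq> G"
    using assms(1) unfolding strongly_rectifiable_def by blast
  have "upper_minkowski_content d (R \<inter> B) \<le> upper_minkowski_content d R"
    by (rule upper_minkowski_content_mono) auto
  then have "upper_minkowski_content d (R \<inter> B) < ennreal \<epsilon>" using *(2) by (rule order.strict_trans1)
  moreover have "B = (R \<inter> B) \<union> (\<Union>j\<in>{1..k}. K j \<inter> B)" using *(5) assms(3) by blast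
  moreover have "\<forall>j\<in>{1..k}. \<exists>G. lipschitz_graph d \<epsilon> G \<and> K j \<inter> B \<subseteq> G" using *(6) by blast
  moreover have "disjoint_family_on (\<lambda>j. K j \<inter> B) {1..k}" using *(4) by (auto simp: disjoint_family_on_def)
  moreover have "\<forall>j\<in>{1..k}. compact (K j \<inter> B)" "compact (R \<inter> B)" using *(1,3) assms(2) by (auto intro: compact_Int)
  ultimately show "\<exists>R (k::nat) K. compact R \<and> upper_minkowski_content d R < ennreal \<epsilon> \<and>
        (\<forall>j\<in>{1..k}. compact (K j)) \<and> disjoint_family_on K {1..k} \<and> B = R \<union> (\<Union>j\<in>{1..k}. K j) \<and>
        (\<forall>j\<in>{1..k}. \<exists>G. lipschitz_graph d \<epsilon> G \<and> K j \<subseteq> G)"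
    by (intro exI[of _ "R \<inter> B"] exI[of _ k] exI[of _ "\<lambda>j. K j \<inter> B"]) blast
qed

text \<open>Let \<open>F\<close> be a largest subset of \<open>R\<close> with mutual distances at
  least \<open>r\<close>; by maximality its \<open>r\<close>-balls cover \<open>R\<close>. Its balls
  of radius \<open>r/2\<close> are disjoint and lie in the \<open>r/2\<close>-neighbourhood of
  \<open>R\<close>, whose volume the content controls. \<open>C\<close> collects the ball volumes
  and the factor \<open>2 ^ d\<close> from halving the radius.\<close>

lemma minkowski_cover:
  fixes R :: "'a::euclidean_space set"
  assumes d: "d \<le> DIM('a)" and content: "upper_minkowski_content d R < ennreal \<epsilon>"
  defines "C \<equiv> 2 ^ d * unit_ball_vol (real (DIM('a) - d)) / unit_ball_vol (real DIM('a))"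
  shows "\<forall>\<^sub>F r in at_right 0. \<exists>F. finite F \<and> F \<subseteq> R \<and> real (card F) * r ^ d \<le> C * \<epsilon> \<and> R \<subseteq> (\<Union>x\<in>F. cball x r)"
proof -
  let ?p = "DIM('a)"
  define \<beta> where "\<beta> = unit_ball_vol (real ?p)"
  define \<beta>' where "\<beta>' = unit_ball_vol (real (?p - d))"
  have \<beta>: "\<beta> > 0" "\<beta>' > 0" by (simp_all add: \<beta>_def \<beta>'_def)
  have \<epsilon>: "\<epsilon> > 0" using content by (metis ennreal_neg not_less not_less_zero)
  have "\<forall>\<^sub>F r in at_right 0. emeasure lborel (\<Union>x\<in>R. ball x r) / ennreal (\<beta>' * r ^ (?p - d)) < ennreal \<epsilon>"
    using content unfolding upper_minkowski_content_def \<beta>'_def by (rule Limsup_lessD)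
  then have "\<forall>\<^sub>F r in at_right 0. emeasure lborel (\<Union>x\<in>R. ball x (1/2 * r)) / ennreal (\<beta>' * (1/2 * r) ^ (?p - d)) < ennreal \<epsilon>"
    by (rule eventually_at_right_scale) simp
  moreover have "\<forall>\<^sub>F r in at_right (0::real). r > 0" by (rule eventually_at_right_less)
  ultimately show ?thesis
  proof eventually_elim
    case (elim r)
    define h where "h = 1/2 * r"
    have h: "h > 0" using elim(2) by (simp add: h_def)
    have vol: "emeasure lborel (\<Union>x\<in>R. ball x h) \<le> ennreal (\<epsilon> * (\<beta>' * h ^ (?p - d)))"
    proof -
      have "ennreal (\<beta>' * h ^ (?p - d)) \<noteq> 0" using \<beta> h by simp
      then have "emeasure lborel (\<Union>x\<in>R. ball x h) < ennreal \<epsilon> * ennreal (\<beta>' * h ^ (?p - d))"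
        using elim(1) unfolding h_def[symmetric] by (subst (asm) divide_less_ennreal) auto
      then show ?thesis using \<epsilon> \<beta> h by (simp add: ennreal_mult less_imp_le)
    qed
    define P where "P F \<longleftrightarrow> finite F \<and> F \<subseteq> R \<and> (\<forall>x\<in>F. \<forall>y\<in>F. x \<noteq> y \<longrightarrow> r \<le> dist x y)" for F
    have cardP: "real (card F) * r ^ d \<le> C * \<epsilon>" if F: "P F" for F
    proof -
      have disj: "disjoint_family_on (\<lambda>x. ball x h) F"
        unfolding disjoint_family_on_def
      proof (intro ballI impI)
        fix x y assume "x \<in> F" "y \<in> F" "x \<noteq> y"
        then have "r \<le> dist x y" using F by (auto simp: P_def)
        then show "ball x h \<inter> ball y h = {}" by (intro disjoint_ballI) (simp add: h_def)
      qed
      have "ennreal (real (card F) * (\<beta> * h ^ ?p)) = (\<Sum>x\<in>F. emeasure lborel (ball x h))"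
        using h \<beta> by (simp add: emeasure_ball \<beta>_def[symmetric] ennreal_mult ennreal_of_nat_eq_real_of_nat)
      also have "\<dots> = emeasure lborel (\<Union>x\<in>F. ball x h)"
        using F disj by (intro sum_emeasure) (auto simp: P_def)
      also have "\<dots> \<le> emeasure lborel (\<Union>x\<in>R. ball x h)"
        using F by (intro emeasure_mono) (auto simp: P_def intro!: borel_open)
      also note vol
      finally have "real (card F) * (\<beta> * h ^ ?p) \<le> \<epsilon> * (\<beta>' * h ^ (?p - d))"
        using \<epsilon> \<beta> h by (subst (asm) ennreal_le_iff) auto
      also have "h ^ ?p = h ^ (?p - d) * h ^ d" using d by (simp add: power_add[symmetric])
      finally have "(real (card F) * \<beta> * h ^ d) * h ^ (?p - d) \<le> (\<epsilon> * \<beta>') * h ^ (?p - d)" by (simp add: mult_ac)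
      then have "real (card F) * \<beta> * h ^ d \<le> \<epsilon> * \<beta>'" using h by (simp add: mult_le_cancel_right_pos)
      then have "real (card F) * (2 * h) ^ d \<le> 2 ^ d * \<beta>' / \<beta> * \<epsilon>" using \<beta> by (simp add: power_mult_distrib field_simps)
      then show ?thesis by (simp add: C_def \<beta>_def \<beta>'_def h_def)
    qed
    have "\<forall>F. P F \<longrightarrow> card F < Suc (nat \<lceil>C * \<epsilon> / r ^ d\<rceil>)"
    proof (intro allI impI)
      fix F assume "P F"
      have "real (card F) \<le> C * \<epsilon> / r ^ d" using cardP[OF \<open>P F\<close>] elim(2) by (simp add: field_simps)
      then show "card F < Suc (nat \<lceil>C * \<epsilon> / r ^ d\<rceil>)" by linarith
    qed
    moreover have "P {}" by (simp add: P_def)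
    ultimately have "\<exists>F. P F \<and> (\<forall>F'. P F' \<longrightarrow> card F' \<le> card F)"
      by (intro ex_has_greatest_nat[where k="{}"])
    then obtain F where F: "P F" "\<And>F'. P F' \<Longrightarrow> card F' \<le> card F" by blast
    have "R \<subseteq> (\<Union>x\<in>F. cball x r)"
    proof (rule ccontr)
      assume "\<not> R \<subseteq> (\<Union>x\<in>F. cball x r)"
      then obtain y where yR: "y \<in> R" and yn: "y \<notin> (\<Union>x\<in>F. cball x r)" by blast
      have y: "y \<in> R" "\<forall>x\<in>F. r < dist x y" using yR yn by (auto simp: not_le)
      then have "y \<notin> F" using elim(2) by fastforce
      have "P (insert y F)" using F(1) y unfolding P_def by (auto simp: dist_commute less_imp_le)
      from F(2)[OF this] show False using F(1) \<open>y \<notin> F\<close> by (simp add: P_def)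
    qed
    then show ?case using F(1) cardP[OF F(1)] by (auto simp: P_def)
  qed
qed

lemma cost_le_minkowski:
  fixes R :: "'a::euclidean_space set"
  assumes "s > 0" "\<forall>\<^sub>F r in at_right 0. \<exists>F. finite F \<and> F \<subseteq> R \<and> real (card F) * r ^ d \<le> c \<and> R \<subseteq> (\<Union>x\<in>F. cball x r)"
  shows "cost_le s d R c"
  unfolding cost_le_def
proof (intro allI impI)
  fix c' assume c': "c < c'"
  from assms(2) show "\<forall>\<^sub>F r in at_right 0. \<exists>\<omega>. set_mset \<omega> \<subseteq> R \<and> real (size \<omega>) * r ^ d \<le> c' \<and> dominates s r R \<omega>"
  proof eventually_elim
    case (elim r)
    then obtain F where F: "finite F" "F \<subseteq> R" "real (card F) * r ^ d \<le> c" "R \<subseteq> (\<Union>x\<in>F. cball x r)" by blast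
    have "dominates s r R (mset_set F)"
      unfolding dominates_def
    proof
      fix y assume "y \<in> R"
      then obtain x where x: "x \<in> F" "y \<in> cball x r" using F(4) by blast
      then have "ennreal (r powr - s) \<le> riesz_kernel s x y"
        using assms(1) by (intro ennreal_le_kernel) (simp_all add: dist_norm)
      also have "\<dots> \<le> potential s (mset_set F) y" using x(1) F(1) by (intro kernel_le_potential) simp
      finally show "ennreal (r powr - s) \<le> potential s (mset_set F) y" .
    qed
    then show ?case using F c' by (intro exI[of _ "mset_set F"]) auto
  qed
qed

lemma hausdorff_outer_minkowski:
  fixes R :: "'a::euclidean_space set"
  assumes d: "d > 0" and ev: "\<forall>\<^sub>F r in at_right 0. \<exists>F. finite F \<and> F \<subseteq> R \<and> real (card F) * r ^ d \<le> c \<and> R \<subseteq> (\<Union>x\<in>F. cball x r)"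
  shows "hausdorff_outer d R \<le> ennreal (2 ^ d * c)"
  unfolding hausdorff_outer_def
proof (rule SUP_least)
  fix \<delta> :: real assume "\<delta> \<in> {0<..}"
  then have "\<forall>\<^sub>F r in at_right 0. 0 < r \<and> r < \<delta> / 2" by (intro eventually_at_right_small) simp
  from eventually_conj[OF this ev] obtain r where r: "0 < r" "r < \<delta> / 2"
    "\<exists>F. finite F \<and> F \<subseteq> R \<and> real (card F) * r ^ d \<le> c \<and> R \<subseteq> (\<Union>x\<in>F. cball x r)"
    by (rule eventually_at_right_ex) blast
  then obtain F where F: "finite F" "real (card F) * r ^ d \<le> c" "R \<subseteq> (\<Union>x\<in>F. cball x r)" by blast
  have "hausdorff_premeasure d \<delta> R \<le> ennreal (real (card F) * (2 * r) ^ d)"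
    by (rule hausdorff_premeasure_le_card[OF F(1,3)]) (use r d in auto)
  also have "\<dots> \<le> ennreal (2 ^ d * c)"
    using F(2) by (intro ennreal_leI) (simp add: power_mult_distrib mult.left_commute)
  finally show "hausdorff_premeasure d \<delta> R \<le> ennreal (2 ^ d * c)" .
qed

text \<open>\<open>\<pi>\<close> is the orthogonal projection onto the base \<open>H\<close> of the
  graph, read in isometric coordinates, and \<open>\<phi>\<close> lifts the coordinates back to the
  graph. That \<open>\<pi>\<close> contracts the whole space is what
  \<open>cost_ge_contraction\<close> asks for.\<close>

lemma lipschitz_graph_parametrization:
  fixes G :: "'a::euclidean_space set"
  assumes G: "lipschitz_graph CARD('d::finite) \<epsilon> G"
  obtains \<pi> :: "'a \<Rightarrow> real ^ 'd" and \<phi> where "lipschitz_on 1 UNIV \<pi>" "lipschitz_on (1 + \<epsilon>) UNIV \<phi>"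
    "\<And>x. x \<in> G \<Longrightarrow> \<phi> (\<pi> x) = x"
proof -
  obtain H \<psi> where H: "subspace H" "dim H = CARD('d)" "\<psi> ` H \<subseteq> orthogonal_comp H" "lipschitz_on \<epsilon> H \<psi>"
    "G = {h + \<psi> h | h. h \<in> H}"
    using G unfolding lipschitz_graph_def by blast
  have dims: "dim H = dim (UNIV :: (real ^ 'd) set)" using H(2) by simp
  obtain f :: "'a \<Rightarrow> real ^ 'd" and g where fg: "linear f" "linear g" "f ` H = UNIV" "g ` UNIV = H"
    "\<forall>x\<in>H. norm (f x) = norm x" "\<forall>y. norm (g y) = norm y" "\<forall>x\<in>H. g (f x) = x"
    by (rule isometries_subspaces[OF H(1) subspace_UNIV dims]) simp
  have gH: "g u \<in> H" for u using fg(4) by blast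
  have H': "convex H" "closed H" "H \<noteq> {}"
    using H(1) subspace_imp_convex closed_subspace subspace_0 by blast+
  let ?P = "closest_point H"
  have PH: "?P x \<in> H" for x by (rule closest_point_in_set[OF H'(2,3)])
  show thesis
  proof (rule that)
    show "lipschitz_on 1 UNIV (\<lambda>x. f (?P x))"
    proof (rule lipschitz_onI)
      fix x y
      have "dist (f (?P x)) (f (?P y)) = norm (f (?P x - ?P y))" by (simp add: dist_norm linear_diff[OF fg(1)])
      also have "\<dots> = dist (?P x) (?P y)"
        using fg(5) subspace_diff[OF H(1) PH PH] by (simp add: dist_norm)
      also have "\<dots> \<le> dist x y" by (rule closest_point_lipschitz[OF H'])
      finally show "dist (f (?P x)) (f (?P y)) \<le> 1 * dist x y" by simp
    qed simp
    show "lipschitz_on (1 + \<epsilon>) UNIV (\<lambda>u. g u + \<psi> (g u))"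
    proof (rule lipschitz_onI)
      fix u v
      have "norm (g u - g v) = norm (u - v)" using fg(6) linear_diff[OF fg(2), of u v] by metis
      then have g: "dist (g u) (g v) = dist u v" by (simp add: dist_norm)
      have "dist (g u + \<psi> (g u)) (g v + \<psi> (g v)) \<le> dist (g u) (g v) + dist (\<psi> (g u)) (\<psi> (g v))"
        by (rule dist_triangle_add)
      also have "\<dots> \<le> dist u v + \<epsilon> * dist u v"
        using lipschitz_onD[OF H(4) gH gH, of u v] g by simp
      finally show "dist (g u + \<psi> (g u)) (g v + \<psi> (g v)) \<le> (1 + \<epsilon>) * dist u v" by (simp add: distrib_right)
    qed (use lipschitz_on_nonneg[OF H(4)] in simp)
    fix x assume "x \<in> G"
    then obtain h where h: "h \<in> H" "x = h + \<psi> h" using H(5) by blast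
    \<comment> \<open>Since \<open>\<psi> h\<close> is orthogonal to \<open>H\<close>, Pythagoras
      shows that \<open>h\<close> is the point of \<open>H\<close> nearest to
      \<open>h + \<psi> h\<close>; so the projection undoes the graph map.\<close>
    have "dist x h \<le> dist x z" if z: "z \<in> H" for z
    proof -
      have "h - z \<in> H" using subspace_diff[OF H(1) h(1) z] .
      then have orth: "orthogonal (h - z) (\<psi> h)" using H(3) h(1) by (auto simp: orthogonal_comp_def)
      have "(norm (\<psi> h))\<^sup>2 \<le> (norm (h - z))\<^sup>2 + (norm (\<psi> h))\<^sup>2" by simp
      also have "\<dots> = (norm (h - z + \<psi> h))\<^sup>2" by (rule norm_add_Pythagorean[OF orth, symmetric])
      finally have "norm (\<psi> h) \<le> norm (h - z + \<psi> h)" by (rule power2_le_imp_le) simp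
      then show ?thesis by (simp add: dist_norm h(2) algebra_simps)
    qed
    then have "h = ?P x" using H'(1,2) h(1) by (intro closest_point_unique) auto
    then show "g (f (?P x)) + \<psi> (g (f (?P x))) = x" using fg(7) h by simp
  qed
qed

text \<open>\<open>b\<close> is the Lebesgue measure of the projection of \<open>K\<close> to
  coordinates. The contraction \<open>\<pi>\<close> bounds cost and Hausdorff measure of
  \<open>K\<close> from below by those of the projection, and the
  \<open>(1 + \<epsilon>)\<close>-Lipschitz lift \<open>\<phi>\<close> bounds them from
  above.\<close>

lemma rectifiable_piece_cost:
  fixes K :: "'a::euclidean_space set"
  assumes s: "s > 0" and \<epsilon>: "\<epsilon> > 0" and G: "lipschitz_graph CARD('d::finite) \<epsilon> G" and K: "compact K" "K \<subseteq> G"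
  defines "\<theta> \<equiv> cube_cost TYPE('d) s" and "\<mu> \<equiv> hausdorff_measure TYPE('d)"
  shows "\<exists>b\<ge>0. cost_le s CARD('d) K ((1 + \<epsilon>) ^ CARD('d) * (\<theta> * b)) \<and> cost_ge s CARD('d) K (\<theta> * b) \<and>
    ennreal b \<le> emeasure \<mu> K \<and> emeasure \<mu> K \<le> ennreal ((1 + \<epsilon>) ^ CARD('d) * b)"
proof -
  obtain \<pi> :: "'a \<Rightarrow> real ^ 'd" and \<phi> where \<pi>: "lipschitz_on 1 UNIV \<pi>" "lipschitz_on (1 + \<epsilon>) UNIV \<phi>"
    "\<And>x. x \<in> G \<Longrightarrow> \<phi> (\<pi> x) = x"
    by (rule lipschitz_graph_parametrization[OF G]) blast
  define B where "B = \<pi> ` K"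
  have \<pi>K: "lipschitz_on 1 K \<pi>" and \<phi>B: "lipschitz_on (1 + \<epsilon>) B \<phi>"
    using \<pi>(1,2) by (auto intro: lipschitz_on_subset)
  have B: "compact B" unfolding B_def
    by (rule compact_continuous_image[OF lipschitz_on_continuous_on[OF \<pi>K] K(1)])
  have KB: "K = \<phi> ` B" using \<pi>(3) K(2) by (force simp: B_def)
  have eB: "emeasure (hausdorff_measure TYPE('d)) B = ennreal (measure lborel B)"
    using hausdorff_measure_eq_lborel[of B] B emeasure_compact_finite[OF B]
    by (simp add: borel_compact compact_imp_bounded emeasure_eq_ennreal_measure less_top)
  have "cost_le s CARD('d) (\<phi> ` B) ((1 + \<epsilon>) ^ CARD('d) * (\<theta> * measure lborel B))"
    using s \<epsilon> \<phi>B B unfolding \<theta>_def by (intro cost_le_lipschitz_image cost_le_compact) auto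
  moreover have "cost_ge s CARD('d) K (\<theta> * measure lborel B)"
    using cost_ge_compact[OF s B] unfolding \<theta>_def B_def by (rule cost_ge_contraction[OF s \<pi>(1)])
  moreover have "ennreal (measure lborel B) \<le> emeasure \<mu> K"
    using hausdorff_measure_lipschitz_image[OF \<pi>K, where 'd='d] B K(1)
    by (simp add: B_def[symmetric] eB \<mu>_def borel_compact)
  moreover have "emeasure \<mu> K \<le> ennreal ((1 + \<epsilon>) ^ CARD('d) * measure lborel B)"
    using hausdorff_measure_lipschitz_image[OF \<phi>B, where 'd='d] B K(1) \<epsilon>
    by (simp add: KB[symmetric] eB \<mu>_def borel_compact ennreal_mult)
  ultimately show ?thesis unfolding KB[symmetric] by (intro exI[of _ "measure lborel B"]) simp
qed


text \<open>\<open>b\<close> adds up the projected measures of the graph pieces. The lower bounds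
  drop the remainder and use that the pieces are disjoint; the upper bounds pay
  \<open>C * \<epsilon>\<close> for the remainder, which may overlap the pieces. As \<open>C\<close>
  does not depend on \<open>\<epsilon>\<close>, the limit \<open>\<epsilon>\<close> to 0 is
  possible.\<close>

lemma strongly_rectifiable_decomposition:
  fixes A :: "'a::euclidean_space set"
  assumes s: "s > real CARD('d::finite)" and d: "CARD('d) \<le> DIM('a)"
    and A: "compact A" "strongly_rectifiable CARD('d) A"
  defines "\<theta> \<equiv> cube_cost TYPE('d) s" and "\<mu> \<equiv> hausdorff_measure TYPE('d)"
  obtains C where "C \<ge> 0" "\<forall>\<epsilon>>0. \<exists>b\<ge>0.
    cost_le s CARD('d) A (C * \<epsilon> + (1 + \<epsilon>) ^ CARD('d) * (\<theta> * b)) \<and> cost_ge s CARD('d) A (\<theta> * b) \<and>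
    ennreal b \<le> emeasure \<mu> A \<and> emeasure \<mu> A \<le> ennreal (C * \<epsilon> + (1 + \<epsilon>) ^ CARD('d) * b)"
proof -
  let ?d = "CARD('d)"
  have s0: "s > 0" using s by (meson of_nat_0_le_iff order.strict_trans1)
  define C1 where "C1 = 2 ^ ?d * unit_ball_vol (real (DIM('a) - ?d)) / unit_ball_vol (real DIM('a))"
  define c where "c = enn2real (hausdorff_cube TYPE('d))"
  have c: "hausdorff_cube TYPE('d) = ennreal c" "c > 0"
    using hausdorff_cube_finite[where 'd='d] hausdorff_cube_pos[where 'd='d]
    by (simp_all add: c_def enn2real_positive_iff)
  \<comment> \<open>One constant for both uses of the covers of \<open>R\<close>: times
    \<open>\<epsilon>\<close>, the first entry bounds its cost and the second its normalized
    Hausdorff measure.\<close>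
  define C where "C = max C1 (2 ^ ?d * C1 / c)"
  have C1: "C1 \<ge> 0" by (simp add: C1_def)
  have C: "C1 \<le> C" "2 ^ ?d * C1 / c \<le> C" by (simp_all add: C_def)
  show thesis
  proof (rule that)
    show "C \<ge> 0" using C1 C by linarith
    show "\<forall>\<epsilon>>0. \<exists>b\<ge>0. cost_le s ?d A (C * \<epsilon> + (1 + \<epsilon>) ^ ?d * (\<theta> * b)) \<and> cost_ge s ?d A (\<theta> * b) \<and>
      ennreal b \<le> emeasure \<mu> A \<and> emeasure \<mu> A \<le> ennreal (C * \<epsilon> + (1 + \<epsilon>) ^ ?d * b)" (is "\<forall>\<epsilon>>0. ?dec \<epsilon>")
    proof (intro allI impI)
      fix \<epsilon> :: real assume \<epsilon>: "\<epsilon> > 0"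
      obtain R K and k :: nat where *: "compact R" "upper_minkowski_content ?d R < ennreal \<epsilon>"
        "\<forall>j\<in>{1..k}. compact (K j)" "disjoint_family_on K {1..k}" "A = R \<union> (\<Union>j\<in>{1..k}. K j)"
        "\<forall>j\<in>{1..k}. \<exists>G. lipschitz_graph ?d \<epsilon> G \<and> K j \<subseteq> G"
        using A(2) \<epsilon> unfolding strongly_rectifiable_def by blast
      let ?J = "{1..k}" and ?U = "\<Union>j\<in>{1..k}. K j"
      have "\<forall>j\<in>?J. \<exists>b\<ge>0. cost_le s ?d (K j) ((1 + \<epsilon>) ^ ?d * (\<theta> * b)) \<and> cost_ge s ?d (K j) (\<theta> * b) \<and>
          ennreal b \<le> emeasure \<mu> (K j) \<and> emeasure \<mu> (K j) \<le> ennreal ((1 + \<epsilon>) ^ ?d * b)" (is "\<forall>j\<in>?J. ?piece j")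
      proof
        fix j assume j: "j \<in> ?J"
        then obtain G where G: "lipschitz_graph ?d \<epsilon> G" "K j \<subseteq> G" using *(6) by blast
        show "?piece j"
          unfolding \<theta>_def \<mu>_def by (rule rectifiable_piece_cost[OF s0 \<epsilon> G(1) _ G(2)]) (use *(3) j in blast)
      qed
      then obtain b where "\<forall>j\<in>?J. b j \<ge> 0 \<and> cost_le s ?d (K j) ((1 + \<epsilon>) ^ ?d * (\<theta> * b j)) \<and> cost_ge s ?d (K j) (\<theta> * b j) \<and>
          ennreal (b j) \<le> emeasure \<mu> (K j) \<and> emeasure \<mu> (K j) \<le> ennreal ((1 + \<epsilon>) ^ ?d * b j)"
        by (auto dest!: bchoice)
      then have b: "b j \<ge> 0" "cost_le s ?d (K j) ((1 + \<epsilon>) ^ ?d * (\<theta> * b j))" "cost_ge s ?d (K j) (\<theta> * b j)"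
          "ennreal (b j) \<le> emeasure \<mu> (K j)" "emeasure \<mu> (K j) \<le> ennreal ((1 + \<epsilon>) ^ ?d * b j)" if "j \<in> ?J" for j
        using that by blast+
      define S where "S = (\<Sum>j\<in>?J. b j)"
      have S: "S \<ge> 0" unfolding S_def by (intro sum_nonneg b)
      note cover = minkowski_cover[OF d *(2), folded C1_def]
      have Kb: "K ` ?J \<subseteq> sets \<mu>" using *(3) by (auto simp: \<mu>_def borel_compact)
      have Ub: "?U \<in> sets \<mu>" using Kb by auto
      have Rb: "R \<in> sets \<mu>" using *(1) by (simp add: \<mu>_def borel_compact)
      have "cost_le s ?d ?U (\<Sum>j\<in>?J. (1 + \<epsilon>) ^ ?d * (\<theta> * b j))"
        by (intro cost_le_UN b) auto
      also have "(\<Sum>j\<in>?J. (1 + \<epsilon>) ^ ?d * (\<theta> * b j)) = (1 + \<epsilon>) ^ ?d * (\<theta> * S)"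
        by (simp add: S_def sum_distrib_left)
      finally have "cost_le s ?d A (C1 * \<epsilon> + (1 + \<epsilon>) ^ ?d * (\<theta> * S))"
        unfolding *(5) by (intro cost_le_Un cost_le_minkowski[OF s0 cover])
      then have 1: "cost_le s ?d A (C * \<epsilon> + (1 + \<epsilon>) ^ ?d * (\<theta> * S))"
      proof -
        have "C1 * \<epsilon> \<le> C * \<epsilon>" using C(1) \<epsilon> by simp
        then show ?thesis using \<open>cost_le s ?d A (C1 * \<epsilon> + (1 + \<epsilon>) ^ ?d * (\<theta> * S))\<close>
          unfolding cost_le_def by (meson add_le_cancel_right order.strict_trans1)
      qed
      have "cost_ge s ?d ?U (\<Sum>j\<in>?J. \<theta> * b j)"
        using s *(3,4) b by (intro cost_ge_disjoint_UN) auto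
      then have 2: "cost_ge s ?d A (\<theta> * S)"
        unfolding S_def sum_distrib_left by (rule cost_ge_mono) (use *(5) in blast)
      have "ennreal S = (\<Sum>j\<in>?J. ennreal (b j))" unfolding S_def using b by (intro sum_ennreal[symmetric]) auto
      also have "\<dots> \<le> (\<Sum>j\<in>?J. emeasure \<mu> (K j))" by (intro sum_mono b)
      also have "\<dots> = emeasure \<mu> ?U" using Kb *(4) by (intro sum_emeasure) auto
      also have "\<dots> \<le> emeasure \<mu> A" using Ub Rb *(5) by (intro emeasure_mono) auto
      finally have 3: "ennreal S \<le> emeasure \<mu> A" .
      have "emeasure \<mu> R = hausdorff_outer ?d R / ennreal c"
        unfolding \<mu>_def using *(1) by (simp add: emeasure_hausdorff_measure borel_compact c(1))
      also have "\<dots> \<le> ennreal (2 ^ ?d * (C1 * \<epsilon>)) / ennreal c"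
        by (intro divide_right_mono_ennreal hausdorff_outer_minkowski cover) simp
      also have "\<dots> = ennreal (2 ^ ?d * C1 / c * \<epsilon>)" using C1 \<epsilon> c(2) by (simp add: divide_ennreal)
      also have "\<dots> \<le> ennreal (C * \<epsilon>)" using C(2) \<epsilon> by (intro ennreal_leI mult_right_mono) auto
      finally have muR: "emeasure \<mu> R \<le> ennreal (C * \<epsilon>)" .
      have "emeasure \<mu> A \<le> emeasure \<mu> R + emeasure \<mu> ?U"
        unfolding *(5) by (rule emeasure_subadditive[OF Rb Ub])
      also have "emeasure \<mu> ?U \<le> (\<Sum>j\<in>?J. emeasure \<mu> (K j))"
        using Kb by (intro emeasure_subadditive_finite) auto
      also have "\<dots> \<le> (\<Sum>j\<in>?J. ennreal ((1 + \<epsilon>) ^ ?d * b j))" by (intro sum_mono b)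
      also have "\<dots> = ennreal ((1 + \<epsilon>) ^ ?d * S)"
        unfolding S_def sum_distrib_left using b \<epsilon> by (intro sum_ennreal) auto
      also note muR
      also have "ennreal (C * \<epsilon>) + ennreal ((1 + \<epsilon>) ^ ?d * S) = ennreal (C * \<epsilon> + (1 + \<epsilon>) ^ ?d * S)"
        using C1 C \<epsilon> S by (intro ennreal_plus[symmetric]) auto
      finally have 4: "emeasure \<mu> A \<le> ennreal (C * \<epsilon> + (1 + \<epsilon>) ^ ?d * S)" by (simp add: add_right_mono)
      show "?dec \<epsilon>" using S 1 2 3 4 by blast
    qed
  qed
qed

text \<open>A single \<open>\<epsilon>\<close> gives finiteness. As \<open>\<epsilon>\<close> tends
  to 0, the bounds on the measure force \<open>b\<close> towards the measure of \<open>A\<close>,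
  and the two cost bounds close up with it.\<close>

theorem strongly_rectifiable_cost:
  fixes A :: "'a::euclidean_space set"
  assumes s: "s > real CARD('d::finite)" and d: "CARD('d) \<le> DIM('a)"
    and A: "compact A" "strongly_rectifiable CARD('d) A"
  defines "\<theta> \<equiv> cube_cost TYPE('d) s" and "\<mu> \<equiv> hausdorff_measure TYPE('d)"
  shows "emeasure \<mu> A < \<infinity>" "cost_le s CARD('d) A (\<theta> * measure \<mu> A)" "cost_ge s CARD('d) A (\<theta> * measure \<mu> A)"
proof -
  let ?d = "CARD('d)"
  obtain C where C: "C \<ge> 0" "\<forall>\<epsilon>>0. \<exists>b\<ge>0.
    cost_le s CARD('d) A (C * \<epsilon> + (1 + \<epsilon>) ^ CARD('d) * (\<theta> * b)) \<and> cost_ge s CARD('d) A (\<theta> * b) \<and>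
    ennreal b \<le> emeasure \<mu> A \<and> emeasure \<mu> A \<le> ennreal (C * \<epsilon> + (1 + \<epsilon>) ^ CARD('d) * b)"
    unfolding \<theta>_def \<mu>_def by (rule strongly_rectifiable_decomposition[OF s d A])
  have \<theta>: "\<theta> > 0" unfolding \<theta>_def by (rule cube_cost_pos[OF s])
  obtain b1 where "emeasure \<mu> A \<le> ennreal (C * 1 + (1 + 1) ^ ?d * b1)" using C(2) by (meson zero_less_one)
  also have "\<dots> < \<infinity>" by simp
  finally show fin: "emeasure \<mu> A < \<infinity>" .
  define M where "M = measure \<mu> A"
  have M: "emeasure \<mu> A = ennreal M" using fin by (simp add: M_def emeasure_eq_ennreal_measure less_top)
  have M0: "M \<ge> 0" by (simp add: M_def)
  have dec: "\<exists>b. b \<ge> 0 \<and> cost_le s ?d A (C * \<epsilon> + (1 + \<epsilon>) ^ ?d * (\<theta> * b)) \<and> cost_ge s ?d A (\<theta> * b) \<and>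
      b \<le> M \<and> M \<le> C * \<epsilon> + (1 + \<epsilon>) ^ ?d * b" if \<epsilon>: "\<epsilon> > 0" for \<epsilon>
  proof -
    obtain b where b: "b \<ge> 0" "cost_le s ?d A (C * \<epsilon> + (1 + \<epsilon>) ^ ?d * (\<theta> * b))" "cost_ge s ?d A (\<theta> * b)"
      "ennreal b \<le> emeasure \<mu> A" "emeasure \<mu> A \<le> ennreal (C * \<epsilon> + (1 + \<epsilon>) ^ ?d * b)" using C(2) \<epsilon> by meson
    have nn: "0 \<le> C * \<epsilon> + (1 + \<epsilon>) ^ ?d * b" using C(1) b(1) \<epsilon> by simp
    have "b \<le> M" using b(4) unfolding M by (subst (asm) ennreal_le_iff[OF M0])
    moreover have "M \<le> C * \<epsilon> + (1 + \<epsilon>) ^ ?d * b" using b(5) unfolding M by (subst (asm) ennreal_le_iff[OF nn])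
    ultimately show ?thesis using b(1-3) by blast
  qed
  show "cost_le s ?d A (\<theta> * measure \<mu> A)"
    unfolding M_def[symmetric]
  proof (rule cost_le_closed)
    fix a assume a: "\<theta> * M < a"
    have "((\<lambda>e. C * e + (1 + e) ^ ?d * (\<theta> * M)) \<longlongrightarrow> C * 0 + (1 + 0) ^ ?d * (\<theta> * M)) (at_right (0::real))"
      by (intro tendsto_intros tendsto_ident_at)
    then have "\<forall>\<^sub>F e in at_right 0. C * e + (1 + e) ^ ?d * (\<theta> * M) < a"
      using a by (intro order_tendstoD(2)) auto
    then obtain e where e: "e > 0" "C * e + (1 + e) ^ ?d * (\<theta> * M) < a" by (rule eventually_at_right_ex)
    obtain b where b: "cost_le s ?d A (C * e + (1 + e) ^ ?d * (\<theta> * b))" "b \<le> M" using dec[OF e(1)] by meson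
    have "C * e + (1 + e) ^ ?d * (\<theta> * b) \<le> C * e + (1 + e) ^ ?d * (\<theta> * M)"
      using b(2) \<theta> e(1) by (intro add_left_mono mult_left_mono) auto
    then show "\<exists>c<a. cost_le s ?d A c" using b(1) e(2) by (meson order.strict_trans1)
  qed
  show "cost_ge s ?d A (\<theta> * measure \<mu> A)"
    unfolding M_def[symmetric]
  proof (rule cost_ge_closed)
    fix a assume a: "a < \<theta> * M"
    have "((\<lambda>e. \<theta> * M - \<theta> * (C * e) - (1 + e) ^ ?d * a) \<longlongrightarrow> \<theta> * M - \<theta> * (C * 0) - (1 + 0) ^ ?d * a) (at_right (0::real))"
      by (intro tendsto_intros tendsto_ident_at)
    then have "\<forall>\<^sub>F e in at_right 0. 0 < \<theta> * M - \<theta> * (C * e) - (1 + e) ^ ?d * a"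
      using a by (intro order_tendstoD(1)) auto
    then obtain e where e: "e > 0" "0 < \<theta> * M - \<theta> * (C * e) - (1 + e) ^ ?d * a" by (rule eventually_at_right_ex)
    obtain b where b: "cost_ge s ?d A (\<theta> * b)" "M \<le> C * e + (1 + e) ^ ?d * b" using dec[OF e(1)] by meson
    have "\<theta> * M \<le> \<theta> * (C * e + (1 + e) ^ ?d * b)" using b(2) \<theta> by (intro mult_left_mono) auto
    also have "\<dots> = \<theta> * (C * e) + (1 + e) ^ ?d * (\<theta> * b)" by (simp add: algebra_simps)
    finally have "(1 + e) ^ ?d * a < (1 + e) ^ ?d * (\<theta> * b)" using e(2) by linarith
    then have "a < \<theta> * b" using e(1) by (simp add: mult_less_cancel_left_pos)
    then show "\<exists>c>a. cost_ge s ?d A c" using b(1) by blast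
  qed
qed

section \<open>Limits of the polarization\<close>

text \<open>This is the level \<open>r\<close> at which \<open>N\<close> points have cost
  \<open>N * r ^ d = a\<close>. Through it, statements for \<open>r\<close> tending to 0 become
  statements for \<open>N\<close> tending to infinity.\<close>

lemma filterlim_level:
  fixes a :: real
  assumes "a > 0" "d > 0"
  shows "filterlim (\<lambda>N. (a / real N) powr (1 / real d)) (at_right 0) sequentially"
  unfolding filterlim_at
proof
  show "\<forall>\<^sub>F N in sequentially. (a / real N) powr (1 / real d) \<in> {0<..} \<and> (a / real N) powr (1 / real d) \<noteq> 0"
    using eventually_gt_at_top[of "0::nat"] by eventually_elim (use assms(1) in simp)
  have "(\<lambda>N. a / real N) \<longlonglongrightarrow> 0" by (rule lim_const_over_n)
  then show "(\<lambda>N. (a / real N) powr (1 / real d)) \<longlonglongrightarrow> 0"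
    by (rule tendsto_zero_powrI[OF _ tendsto_const]) (use assms in \<open>auto intro!: always_eventually\<close>)
qed

lemma level_power:
  fixes a :: real
  assumes "a > 0" "d > 0" "N > 0"
  shows "((a / real N) powr (1 / real d)) ^ d = a / real N"
    and "((a / real N) powr (1 / real d)) powr - s = (real N / a) powr (s / real d)"
proof -
  have pos: "a / real N > 0" using assms by simp
  have "((a / real N) powr (1 / real d)) ^ d = ((a / real N) powr (1 / real d)) powr real d"
    by (rule powr_realpow[symmetric]) (use assms in simp)
  also have "\<dots> = a / real N" using assms by (simp add: powr_powr)
  finally show "((a / real N) powr (1 / real d)) ^ d = a / real N" .
  have "((a / real N) powr (1 / real d)) powr - s = (a / real N) powr - (s / real d)" by (simp add: powr_powr)
  also have "\<dots> = (real N / a) powr (s / real d)"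
    using assms by (simp add: powr_minus powr_divide)
  finally show "((a / real N) powr (1 / real d)) powr - s = (real N / a) powr (s / real d)" .
qed

lemma max_polarization_lower:
  fixes A :: "'a::euclidean_space set"
  assumes cost: "cost_le s d A a" and a: "0 \<le> a" "a < a'" and "A \<noteq> {}" and d: "d > 0"
  shows "\<forall>\<^sub>F N in sequentially. ennreal ((real N / a') powr (s / real d)) \<le> max_polarization s A N"
proof -
  have a': "a' > 0" using a by simp
  obtain x0 where x0: "x0 \<in> A" using \<open>A \<noteq> {}\<close> by blast
  have "\<forall>\<^sub>F N in sequentially. \<exists>\<omega>. set_mset \<omega> \<subseteq> A \<and> real (size \<omega>) * ((a' / real N) powr (1 / real d)) ^ d \<le> a' \<and>
      dominates s ((a' / real N) powr (1 / real d)) A \<omega>"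
    by (rule eventually_compose_filterlim[OF cost_leD[OF cost a(2)] filterlim_level[OF a' d]])
  then show ?thesis using eventually_gt_at_top[of "0::nat"]
  proof eventually_elim
    case (elim N)
    then obtain \<omega> where \<omega>: "set_mset \<omega> \<subseteq> A" "real (size \<omega>) * ((a' / real N) powr (1 / real d)) ^ d \<le> a'"
      "dominates s ((a' / real N) powr (1 / real d)) A \<omega>" by blast
    note lp = level_power[OF a' d elim(2)]
    have sz: "size \<omega> \<le> N" using \<omega>(2) a' elim(2) unfolding lp(1) by (simp add: field_simps)
    \<comment> \<open>The cost bound provides at most \<open>N\<close> points; the missing ones are
      put at some point of \<open>A\<close>, which can only raise the potential.\<close>
    define \<omega>' where "\<omega>' = \<omega> + replicate_mset (N - size \<omega>) x0"
    have \<omega>': "size \<omega>' = N" "set_mset \<omega>' \<subseteq> A" using sz \<omega>(1) x0 by (auto simp: \<omega>'_def)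
    have "dominates s ((a' / real N) powr (1 / real d)) A \<omega>'"
      using \<omega>(3) unfolding dominates_def \<omega>'_def potential_plus by (auto intro: add_increasing2)
    then have "ennreal ((real N / a') powr (s / real d)) \<le> polarization s A \<omega>'"
      unfolding dominates_polarization lp(2) .
    also have "\<dots> \<le> max_polarization s A N"
      unfolding max_polarization_def using \<omega>' by (intro SUP_upper) auto
    finally show ?case .
  qed
qed

lemma max_polarization_unconstrained_upper:
  fixes A :: "'a::euclidean_space set"
  assumes cost: "cost_ge s d A a" and a: "0 < a'" "a' < a" and d: "d > 0"
  shows "\<forall>\<^sub>F N in sequentially. max_polarization_unconstrained s A N \<le> ennreal ((real N / a') powr (s / real d))"
proof -
  \<comment> \<open>At this level \<open>N\<close> points have cost exactly \<open>a'\<close>, so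
    ruling out domination takes a lower bound strictly above \<open>a'\<close>.\<close>
  obtain b where b: "a' < b" "b < a" using a dense by blast
  have "\<forall>\<^sub>F N in sequentially. \<forall>\<omega>. dominates s ((a' / real N) powr (1 / real d)) A \<omega> \<longrightarrow>
      b \<le> real (size \<omega>) * ((a' / real N) powr (1 / real d)) ^ d"
    by (rule eventually_compose_filterlim[OF cost_geD[OF cost b(2)] filterlim_level[OF a(1) d]])
  then show ?thesis using eventually_gt_at_top[of "0::nat"]
  proof eventually_elim
    case (elim N)
    note lp = level_power[OF a(1) d elim(2)]
    show ?case
      unfolding max_polarization_unconstrained_def
    proof (rule SUP_least)
      fix \<omega> :: "'a multiset" assume "\<omega> \<in> {\<omega>. size \<omega> = N}"
      then have "\<not> b \<le> real (size \<omega>) * ((a' / real N) powr (1 / real d)) ^ d"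
        using b(1) elim(2) unfolding lp(1) by simp
      then have "\<not> dominates s ((a' / real N) powr (1 / real d)) A \<omega>" using elim(1) by blast
      then show "polarization s A \<omega> \<le> ennreal ((real N / a') powr (s / real d))"
        unfolding dominates_polarization lp(2) by (rule less_imp_le[OF not_le_imp_less])
    qed
  qed
qed

lemma scaled_polarization_le_unconstrained:
  "scaled_polarization s d A N \<le> scaled_polarization_unconstrained s d A N"
  unfolding scaled_polarization_def scaled_polarization_unconstrained_def
    max_polarization_def max_polarization_unconstrained_def
  by (intro divide_right_mono_ennreal SUP_subset_mono) auto

lemma scaled_level:
  assumes "a > 0" "N > 0"
  shows "ennreal ((real N / a) powr t) / ennreal (real N powr t) = ennreal (a powr - t)"
  using assms by (simp add: divide_ennreal powr_divide powr_minus_divide)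

text \<open>The constrained values lie below the unconstrained ones, so a lower bound for the former
  and an upper bound for the latter settle both limits. For positive \<open>a\<close> these come
  from costs \<open>a'\<close> close to \<open>a\<close>, by continuity of the power; for
  \<open>a = 0\<close> the limit is infinite and only the lower bound has content.\<close>

lemma polarization_tendsto:
  fixes A :: "'a::euclidean_space set"
  assumes cost: "cost_le s d A a" "cost_ge s d A a" and a: "0 \<le> a" and A: "A \<noteq> {}" and d: "d > 0" and s: "s > 0"
  defines "l \<equiv> (if a = 0 then \<infinity> else ennreal (a powr - (s / real d)))"
  shows "scaled_polarization s d A \<longlonglongrightarrow> l" "scaled_polarization_unconstrained s d A \<longlonglongrightarrow> l"
proof -
  let ?t = "s / real d"
  have t: "?t > 0" using s d by simp
  have lower: "\<forall>\<^sub>F N in sequentially. y < scaled_polarization s d A N" if y: "y < l" for y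
  proof -
    obtain a' where a': "a < a'" "y < ennreal (a' powr - ?t)"
    proof (cases "a = 0")
      case True
      then obtain z where z: "y = ennreal z" "z \<ge> 0" using y by (cases y) (auto simp: l_def)
      show thesis
      \<comment> \<open>The solution \<open>a'\<close> of \<open>a' powr - ?t = z + 1\<close>, a
        value above \<open>y\<close>.\<close>
      proof (rule that[of "(z + 1) powr - (1 / ?t)"])
        show "a < (z + 1) powr - (1 / ?t)" using True z(2) by simp
        have "((z + 1) powr - (1 / ?t)) powr - ?t = (z + 1) powr (- (1 / ?t) * - ?t)" by (rule powr_powr)
        also have "- (1 / u) * - u = 1" if "u > 0" for u :: real using that by simp
        note this[OF t]
        finally have "((z + 1) powr - (1 / ?t)) powr - ?t = z + 1" using z(2) by simp
        then show "y < ennreal (((z + 1) powr - (1 / ?t)) powr - ?t)" using z by (simp add: ennreal_lessI)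
      qed
    next
      case False
      then have apos: "a > 0" using a by simp
      have "((\<lambda>x. ennreal (x powr - ?t)) \<longlongrightarrow> ennreal (a powr - ?t)) (at_right a)"
        using apos by (intro tendsto_intros tendsto_ident_at) auto
      then have "\<forall>\<^sub>F x in at_right a. y < ennreal (x powr - ?t)"
        using y False by (intro order_tendstoD(1)) (auto simp: l_def)
      moreover have "\<forall>\<^sub>F x in at_right a. a < x" by (rule eventually_at_right_less)
      ultimately have "\<forall>\<^sub>F x in at_right a. a < x \<and> y < ennreal (x powr - ?t)" by eventually_elim simp
      then show thesis using that eventually_happens'[OF trivial_limit_at_right_real] by blast
    qed
    have a'0: "a' > 0" using a a'(1) by simp
    show ?thesis using max_polarization_lower[OF cost(1) a a'(1) A d] eventually_gt_at_top[of "0::nat"]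
    proof eventually_elim
      case (elim N)
      have "y < ennreal (a' powr - ?t)" by (rule a'(2))
      also have "\<dots> = ennreal ((real N / a') powr ?t) / ennreal (real N powr ?t)" by (rule scaled_level[OF a'0 elim(2), symmetric])
      also have "\<dots> \<le> scaled_polarization s d A N"
        unfolding scaled_polarization_def by (rule divide_right_mono_ennreal[OF elim(1)])
      finally show ?case .
    qed
  qed
  have upper: "\<forall>\<^sub>F N in sequentially. scaled_polarization_unconstrained s d A N < y" if y: "l < y" for y
  proof -
    have apos: "a > 0" using y a by (cases "a = 0") (auto simp: l_def)
    have "((\<lambda>x. ennreal (x powr - ?t)) \<longlongrightarrow> ennreal (a powr - ?t)) (at_left a)"
      using apos by (intro tendsto_intros tendsto_ident_at) auto
    then have "\<forall>\<^sub>F x in at_left a. ennreal (x powr - ?t) < y"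
      using y apos by (intro order_tendstoD(2)) (auto simp: l_def)
    moreover have "\<forall>\<^sub>F x in at_left a. x \<in> {0<..<a}" using apos by (rule eventually_at_left_real)
    ultimately have "\<forall>\<^sub>F x in at_left a. 0 < x \<and> x < a \<and> ennreal (x powr - ?t) < y" by eventually_elim simp
    then obtain a' where a': "0 < a'" "a' < a" "ennreal (a' powr - ?t) < y"
      using eventually_happens'[OF trivial_limit_at_left_real] by blast
    show ?thesis using max_polarization_unconstrained_upper[OF cost(2) a'(1,2) d] eventually_gt_at_top[of "0::nat"]
    proof eventually_elim
      case (elim N)
      have "scaled_polarization_unconstrained s d A N \<le> ennreal ((real N / a') powr ?t) / ennreal (real N powr ?t)"
        unfolding scaled_polarization_unconstrained_def by (rule divide_right_mono_ennreal[OF elim(1)])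
      also have "\<dots> = ennreal (a' powr - ?t)" by (rule scaled_level[OF a'(1) elim(2)])
      also have "\<dots> < y" by (rule a'(3))
      finally show ?case .
    qed
  qed
  show "scaled_polarization s d A \<longlonglongrightarrow> l"
  proof (rule order_tendstoI)
    fix y assume "l < y"
    from upper[OF this] show "\<forall>\<^sub>F N in sequentially. scaled_polarization s d A N < y"
      by eventually_elim (rule order.strict_trans1[OF scaled_polarization_le_unconstrained])
  qed (rule lower)
  show "scaled_polarization_unconstrained s d A \<longlonglongrightarrow> l"
  proof (rule order_tendstoI)
    fix y assume "y < l"
    from lower[OF this] show "\<forall>\<^sub>F N in sequentially. y < scaled_polarization_unconstrained s d A N"
      by eventually_elim (rule order.strict_trans2[OF _ scaled_polarization_le_unconstrained])
  qed (rule upper)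
qed

text \<open>The unit cube has measure 1, so its cost is the infimum itself; this connects the
  infimum with the constant in the limit formula.\<close>

lemma cube_polarization_const_eq:
  assumes s: "s > real CARD('d::finite)"
  shows "cube_polarization_const TYPE('d) s = ennreal (cube_cost TYPE('d) s powr - (s / real CARD('d)))"
proof -
  have s0: "s > 0" using s by (meson of_nat_0_le_iff order.strict_trans1)
  have pos: "cube_cost TYPE('d) s > 0" by (rule cube_cost_pos[OF s])
  have m: "measure lborel (unit_cube :: (real ^ 'd) set) = 1" by (simp add: measure_def emeasure_unit_cube)
  have ne: "(unit_cube :: (real ^ 'd) set) \<noteq> {}" using zero_in_unit_cube by blast
  have "cost_le s CARD('d) (unit_cube :: (real ^ 'd) set) (cube_cost TYPE('d) s)"
    using cost_le_compact[OF s0 compact_unit_cube[where 'd='d]] by (simp add: m)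
  moreover have "cost_ge s CARD('d) (unit_cube :: (real ^ 'd) set) (cube_cost TYPE('d) s)"
    using cost_ge_compact[OF s0 compact_unit_cube[where 'd='d]] by (simp add: m)
  ultimately have "scaled_polarization s CARD('d) (unit_cube :: (real ^ 'd) set) \<longlonglongrightarrow>
      ennreal (cube_cost TYPE('d) s powr - (s / real CARD('d)))"
    using polarization_tendsto(1)[of s "CARD('d)" unit_cube "cube_cost TYPE('d) s"] pos ne s0 by simp
  then show ?thesis unfolding cube_polarization_const_def polarization_limit_def by (rule limI)
qed

lemma limit_value_eq:
  fixes A :: "'a::euclidean_space set"
  assumes s: "s > real CARD('d::finite)" and fin: "emeasure (hausdorff_measure TYPE('d)) A < \<infinity>"
  defines "a \<equiv> cube_cost TYPE('d) s * measure (hausdorff_measure TYPE('d)) A"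
  shows "limit_value TYPE('d) s A = (if a = 0 then \<infinity> else ennreal (a powr - (s / real CARD('d))))"
proof -
  let ?\<mu> = "hausdorff_measure TYPE('d) :: 'a measure"
  have pos: "cube_cost TYPE('d) s > 0" by (rule cube_cost_pos[OF s])
  have M: "emeasure ?\<mu> A = ennreal (measure ?\<mu> A)" using fin by (simp add: emeasure_eq_ennreal_measure less_top)
  show ?thesis
  proof (cases "measure ?\<mu> A = 0")
    case True then show ?thesis using M by (simp add: limit_value_def a_def)
  next
    case False
    then have Mpos: "measure ?\<mu> A > 0" by (simp add: less_le)
    then have "limit_value TYPE('d) s A = ennreal (cube_cost TYPE('d) s powr - (s / real CARD('d))) / ennreal (measure ?\<mu> A powr (s / real CARD('d)))"
      unfolding limit_value_def cube_polarization_const_eq[OF s] ennreal_powr_def M by simp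
    also have "\<dots> = ennreal (a powr - (s / real CARD('d)))"
      using Mpos pos by (simp add: divide_ennreal a_def powr_mult powr_minus field_simps)
    finally show ?thesis using Mpos pos by (simp add: a_def)
  qed
qed

section \<open>Distribution of extremal configurations\<close>

text \<open>\<open>m\<close> stands for either maximal polarization. Extremality makes the
  polarization of \<open>\<omega> N\<close>, divided by \<open>N powr (s / d)\<close>, tend to
  \<open>a powr - (s / d)\<close>, which exceeds the value \<open>a' powr - (s / d)\<close>
  belonging to the level.\<close>

lemma extremal_eventually_dominates:
  fixes A :: "'a::euclidean_space set"
  assumes m: "(\<lambda>N. m N / ennreal (real N powr (s / real d))) \<longlonglongrightarrow> ennreal (a powr - (s / real d))"
    and \<omega>: "(\<lambda>N. polarization s A (\<omega> N) / m N) \<longlonglongrightarrow> 1"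
    and a: "0 < a" "a < a'" and d: "d > 0" and s: "s > 0"
  shows "\<forall>\<^sub>F N in sequentially. dominates s ((a' / real N) powr (1 / real d)) A (\<omega> N)"
proof -
  let ?t = "s / real d"
  have t: "?t > 0" using s d by simp
  have lpos: "0 < ennreal (a powr - ?t)" using a(1) by simp
  have "(\<lambda>N. (polarization s A (\<omega> N) / m N) * (m N / ennreal (real N powr ?t))) \<longlonglongrightarrow> 1 * ennreal (a powr - ?t)"
    by (intro tendsto_mult_ennreal \<omega> m) auto
  moreover have "ennreal (a' powr - ?t) < 1 * ennreal (a powr - ?t)"
    using a t by (simp add: ennreal_less_iff powr_less_mono2_neg)
  ultimately have "\<forall>\<^sub>F N in sequentially. ennreal (a' powr - ?t) < (polarization s A (\<omega> N) / m N) * (m N / ennreal (real N powr ?t))"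
    by (rule order_tendstoD(1))
  moreover have "\<forall>\<^sub>F N in sequentially. 0 < m N / ennreal (real N powr ?t)"
    by (rule order_tendstoD(1)[OF m lpos])
  moreover have "\<forall>\<^sub>F N in sequentially. m N / ennreal (real N powr ?t) < top"
    by (rule order_tendstoD(2)[OF m]) simp
  ultimately show ?thesis using eventually_gt_at_top[of "0::nat"]
  proof eventually_elim
    case (elim N)
    have a': "a' > 0" using a by simp
    have Npos: "ennreal (real N powr ?t) \<noteq> 0" "ennreal (real N powr ?t) \<noteq> top" using elim(4) by auto
    \<comment> \<open>Cancelling \<open>m N\<close> in \<open>ennreal\<close> requires that it be
      neither 0 nor top; both hold because the scaled limit is positive and finite.\<close>
    have m0: "m N \<noteq> 0" using elim(2) by (metis ennreal_zero_divide less_irrefl)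
    have mtop: "m N \<noteq> top" using elim(3) Npos by (auto simp: ennreal_top_divide)
    have "(polarization s A (\<omega> N) / m N) * (m N / ennreal (real N powr ?t)) = polarization s A (\<omega> N) / ennreal (real N powr ?t)"
      using m0 mtop by (simp add: ennreal_times_divide ennreal_divide_times mult_divide_eq_ennreal)
    then have "ennreal ((real N / a') powr ?t) / ennreal (real N powr ?t) \<le> polarization s A (\<omega> N) / ennreal (real N powr ?t)"
      using elim(1) unfolding scaled_level[OF a' elim(4)] by simp
    then have "ennreal ((real N / a') powr ?t) / ennreal (real N powr ?t) * ennreal (real N powr ?t) \<le> polarization s A (\<omega> N) / ennreal (real N powr ?t) * ennreal (real N powr ?t)"
      by (rule mult_right_mono) simp
    then have "ennreal ((real N / a') powr ?t) \<le> polarization s A (\<omega> N)"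
      using Npos by (simp add: ennreal_divide_times mult_divide_eq_ennreal)
    then show ?case unfolding dominates_polarization level_power(2)[OF a' d elim(4)] .
  qed
qed

text \<open>The configuration dominates \<open>A\<close>, hence \<open>K\<close>, at a level with
  \<open>r ^ d\<close> close to \<open>a / N\<close>. The points within \<open>\<delta>\<close> of
  \<open>K\<close> alone still almost dominate \<open>K\<close>, so their number is at least about
  \<open>k / r ^ d\<close>, a fraction \<open>k / a\<close> of all points.\<close>

lemma extremal_near_count:
  fixes K A :: "'a::euclidean_space set"
  assumes dom: "\<And>a'. a < a' \<Longrightarrow> \<forall>\<^sub>F N in sequentially. dominates s ((a' / real N) powr (1 / real d)) A (\<omega> N)"
    and sz: "\<And>N. N \<ge> 1 \<Longrightarrow> size (\<omega> N) = N"
    and K: "K \<subseteq> A" "cost_ge s d K k" and a: "0 < a" and s: "s > real d" and d: "d > 0" and \<delta>: "\<delta> > 0"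
    and \<eta>: "\<eta> * a < k"
  shows "\<forall>\<^sub>F N in sequentially. \<eta> \<le> real (size (filter_mset (\<lambda>x. x \<in> (\<Union>a\<in>K. ball a \<delta>)) (\<omega> N))) / real N"
proof -
  have "((\<lambda>t. (k - t) - \<eta> * (1 + t) ^ d * (a + t)) \<longlongrightarrow> (k - 0) - \<eta> * (1 + 0) ^ d * (a + 0)) (at_right (0::real))"
    by (intro tendsto_intros tendsto_ident_at)
  then have "\<forall>\<^sub>F t in at_right 0. 0 < (k - t) - \<eta> * (1 + t) ^ d * (a + t)"
    using \<eta> by (intro order_tendstoD(1)) auto
  then obtain t where t: "t > 0" "0 < (k - t) - \<eta> * (1 + t) ^ d * (a + t)" by (rule eventually_at_right_ex)
  define b where "b = a + t"
  have b: "b > 0" "a < b" using a t by (auto simp: b_def)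
  define r where "r N = (b / real N) powr (1 / real d)" for N
  have lim: "filterlim r (at_right 0) sequentially" unfolding r_def by (rule filterlim_level[OF b(1) d])
  have "\<forall>\<^sub>F N in sequentially. \<forall>B \<omega>. B \<subseteq> A \<longrightarrow> dominates s (r N) B \<omega> \<longrightarrow> real (size \<omega>) * r N ^ d \<le> b \<longrightarrow>
           dominates s ((1 + t) * r N) B (filter_mset (\<lambda>x. x \<in> (\<Union>a\<in>B. ball a \<delta>)) \<omega>)"
    by (rule eventually_compose_filterlim[OF dominates_near[OF s \<delta> t(1)] lim])
  moreover have "\<forall>\<^sub>F N in sequentially. \<forall>\<omega>. dominates s ((1 + t) * r N) K \<omega> \<longrightarrow> k - t \<le> real (size \<omega>) * ((1 + t) * r N) ^ d"
    by (rule eventually_compose_filterlim[OF eventually_at_right_scale[OF cost_geD[OF K(2)]] lim]) (use t(1) in auto)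
  moreover have "\<forall>\<^sub>F N in sequentially. dominates s (r N) A (\<omega> N)" unfolding r_def by (rule dom[OF b(2)])
  ultimately show ?thesis using eventually_ge_at_top[of "1::nat"]
  proof eventually_elim
    case (elim N)
    have N: "N > 0" using elim(4) by simp
    have rd: "r N ^ d = b / real N" unfolding r_def by (rule level_power(1)[OF b(1) d N])
    let ?f = "filter_mset (\<lambda>x. x \<in> (\<Union>a\<in>K. ball a \<delta>)) (\<omega> N)"
    have "real (size (\<omega> N)) * r N ^ d \<le> b" using sz[OF elim(4)] N by (simp add: rd)
    then have "dominates s ((1 + t) * r N) K ?f" using elim(1) K(1) dominates_subset[OF elim(3) K(1)] by blast
    then have "k - t \<le> real (size ?f) * ((1 + t) * r N) ^ d" using elim(2) by blast
    also have "\<dots> = (real (size ?f) / real N) * ((1 + t) ^ d * b)" by (simp add: power_mult_distrib rd)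
    finally have "\<eta> * ((1 + t) ^ d * b) \<le> (real (size ?f) / real N) * ((1 + t) ^ d * b)"
      using t(2) by (simp add: b_def mult.assoc)
    then show ?case using b(1) t(1) by (simp only: mult_le_cancel_right_pos[OF mult_pos_pos[OF zero_less_power[of "1 + t" d]], of b])
  qed
qed

section \<open>Empirical measures and a portmanteau criterion\<close>

lemma
  fixes \<omega> :: "'a::euclidean_space multiset"
  shows sets_empirical_measure: "sets (empirical_measure \<omega>) = sets borel"
    and prob_space_empirical_measure: "prob_space (empirical_measure \<omega>)"
  unfolding empirical_measure_def by (auto intro!: measure_pmf.prob_space_distr)

lemma measure_empirical_measure:
  fixes \<omega> :: "'a::euclidean_space multiset"
  assumes "\<omega> \<noteq> {#}" "S \<in> sets borel"
  shows "measure (empirical_measure \<omega>) S = real (size (filter_mset (\<lambda>x. x \<in> S) \<omega>)) / real (size \<omega>)"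
proof -
  have "measure (empirical_measure \<omega>) S = measure (measure_pmf (pmf_of_multiset \<omega>)) S"
    unfolding empirical_measure_def using assms(2) by (subst measure_distr) auto
  also have "\<dots> = measure (measure_pmf (pmf_of_multiset \<omega>)) (S \<inter> set_mset \<omega>)"
    using measure_Int_set_pmf[of "pmf_of_multiset \<omega>" S] assms(1) by simp
  also have "\<dots> = (\<Sum>x\<in>S \<inter> set_mset \<omega>. pmf (pmf_of_multiset \<omega>) x)"
    by (rule measure_measure_pmf_finite) simp
  also have "\<dots> = (\<Sum>x\<in>S \<inter> set_mset \<omega>. real (count \<omega> x)) / real (size \<omega>)"
    using assms(1) by (simp add: sum_divide_distrib)
  also have "(\<Sum>x\<in>S \<inter> set_mset \<omega>. real (count \<omega> x)) = real (size (filter_mset (\<lambda>x. x \<in> S) \<omega>))"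
    by (simp add: size_multiset_overloaded_eq Int_def conj_commute)
  finally show ?thesis .
qed

text \<open>A discrete layer-cake formula with error at most 1. In expectation it replaces an
  integral by finitely many probabilities of superlevel sets.\<close>

lemma layer_count:
  fixes y :: real
  assumes "0 \<le> y" "y \<le> 1" "n > 0"
  shows "(\<Sum>i=1..n. if real i / real n < y then 1 else 0 :: real) \<le> real n * y"
    and "real n * y \<le> 1 + (\<Sum>i=1..n. if real i / real n < y then 1 else 0 :: real)"
proof -
  let ?S = "{i\<in>{1..n}. real i / real n < y}"
  have eq: "(\<Sum>i=1..n. if real i / real n < y then 1 else 0 :: real) = real (card ?S)"
    by (simp add: sum.If_cases Int_def)
  have lt: "real i / real n < y \<longleftrightarrow> real i < real n * y" for i using assms(3) by (simp add: field_simps)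
  have "?S \<subseteq> {1..nat \<lfloor>real n * y\<rfloor>}" by (auto simp: lt le_nat_iff le_floor_iff)
  then have "card ?S \<le> nat \<lfloor>real n * y\<rfloor>" using card_mono[of "{1..nat \<lfloor>real n * y\<rfloor>}" ?S] by simp
  then have "real (card ?S) \<le> real (nat \<lfloor>real n * y\<rfloor>)" by simp
  also have "\<dots> \<le> real n * y" using assms by (simp add: of_nat_nat)
  finally show "(\<Sum>i=1..n. if real i / real n < y then 1 else 0 :: real) \<le> real n * y" unfolding eq .
  have ny: "real n * y \<le> real n" using assms by (simp add: mult_left_le)
  have "{1..nat (\<lceil>real n * y\<rceil> - 1)} \<subseteq> ?S"
  proof
    fix i assume "i \<in> {1..nat (\<lceil>real n * y\<rceil> - 1)}"
    then have i: "1 \<le> i" "int i \<le> \<lceil>real n * y\<rceil> - 1" by auto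
    then have "real i < real n * y" by linarith
    then show "i \<in> ?S" using i(1) ny lt by auto
  qed
  then have "nat (\<lceil>real n * y\<rceil> - 1) \<le> card ?S" using card_mono[of ?S "{1..nat (\<lceil>real n * y\<rceil> - 1)}"] by simp
  then show "real n * y \<le> 1 + (\<Sum>i=1..n. if real i / real n < y then 1 else 0 :: real)"
    unfolding eq by linarith
qed

lemma (in prob_space) expectation_layers:
  assumes g: "g \<in> borel_measurable M" "\<And>x. 0 \<le> g x" "\<And>x. g x \<le> (1::real)" and n: "n > 0"
  shows "(\<Sum>i=1..n. prob {x\<in>space M. real i / real n < g x}) \<le> real n * expectation g"
    and "real n * expectation g \<le> 1 + (\<Sum>i=1..n. prob {x\<in>space M. real i / real n < g x})"
proof -
  let ?h = "\<lambda>x. \<Sum>i=1..n. indicat_real {x\<in>space M. real i / real n < g x} x"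
  have meas: "{x\<in>space M. real i / real n < g x} \<in> events" for i using g(1) by measurable
  have gi: "integrable M g" using g by (intro integrable_const_bound[where B=1]) auto
  have ii: "integrable M (indicat_real {x\<in>space M. real i / real n < g x})" for i
    by (intro integrable_real_indicator meas) (simp add: emeasure_eq_measure)
  have hi: "integrable M ?h" by (intro Bochner_Integration.integrable_sum ii)
  have h: "expectation ?h = (\<Sum>i=1..n. prob {x\<in>space M. real i / real n < g x})"
    using ii meas by (subst Bochner_Integration.integral_sum) auto
  have hx: "?h x = (\<Sum>i=1..n. if real i / real n < g x then 1 else 0)" if "x \<in> space M" for x
    using that by (intro sum.cong) (auto simp: indicator_def)
  have "expectation ?h \<le> expectation (\<lambda>x. real n * g x)"
  proof (rule integral_mono[OF hi])
    fix x assume "x \<in> space M"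
    show "?h x \<le> real n * g x" unfolding hx[OF \<open>x \<in> space M\<close>] by (rule layer_count(1)[OF g(2,3) n])
  qed (use gi in simp)
  then show "(\<Sum>i=1..n. prob {x\<in>space M. real i / real n < g x}) \<le> real n * expectation g"
    unfolding h using gi by simp
  have "expectation (\<lambda>x. real n * g x) \<le> expectation (\<lambda>x. 1 + ?h x)"
  proof (rule integral_mono)
    fix x assume "x \<in> space M"
    show "real n * g x \<le> 1 + ?h x" unfolding hx[OF \<open>x \<in> space M\<close>] by (rule layer_count(2)[OF g(2,3) n])
  qed (use gi hi in simp_all)
  also have "\<dots> = 1 + expectation ?h" using hi by (subst Bochner_Integration.integral_add) (auto simp: prob_space)
  finally show "real n * expectation g \<le> 1 + (\<Sum>i=1..n. prob {x\<in>space M. real i / real n < g x})"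
    unfolding h using gi by simp
qed

text \<open>The superlevel sets of a continuous function are open. For values in [0,1] the layers
  therefore turn lower bounds on open sets into lower bounds on integrals; applied to a bounded
  function and to its negative, these give convergence.\<close>

lemma weak_star_convI:
  fixes \<mu> :: "nat \<Rightarrow> 'a::euclidean_space measure"
  assumes \<mu>: "\<And>N. prob_space (\<mu> N)" "\<And>N. sets (\<mu> N) = sets borel"
    and \<nu>: "prob_space \<nu>" "sets \<nu> = sets borel"
    and op: "\<And>G \<eta>. open G \<Longrightarrow> \<eta> < measure \<nu> G \<Longrightarrow> \<forall>\<^sub>F N in sequentially. \<eta> \<le> measure (\<mu> N) G"
  shows "weak_star_conv \<mu> \<nu>"
proof -
  have sp: "space (\<mu> N) = UNIV" "space \<nu> = UNIV" for N
    using sets_eq_imp_space_eq[OF \<mu>(2)] sets_eq_imp_space_eq[OF \<nu>(2)] by simp_all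
  have half: "\<forall>\<^sub>F N in sequentially. integral\<^sup>L \<nu> g - e \<le> integral\<^sup>L (\<mu> N) g"
    if g: "continuous_on UNIV g" "\<And>x. 0 \<le> g x" "\<And>x. g x \<le> 1" and e: "e > 0" for g :: "'a \<Rightarrow> real" and e
  proof -
    \<comment> \<open>Half of \<open>e\<close> pays for the rounding error \<open>1 / n\<close> of
      the layers, the other half for the open sets.\<close>
    obtain n :: nat where n: "real n > 2 / e" using reals_Archimedean2 by blast
    have "2 / e > 0" using e by simp
    then have n0: "n > 0" using n by linarith
    have ne: "1 \<le> real n * (e / 2)" using n e by (simp add: field_simps)
    have gm: "g \<in> borel_measurable borel" using g(1) by (rule borel_measurable_continuous_onI)
    let ?G = "\<lambda>i. {x. real i / real n < g x}"
    have "open (?G i)" for i using g(1) by (intro open_Collect_less continuous_intros)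
    then have "\<forall>\<^sub>F N in sequentially. \<forall>i\<in>{1..n}. measure \<nu> (?G i) - e / 2 \<le> measure (\<mu> N) (?G i)"
      using e by (intro eventually_ball_finite ballI op) auto
    then show ?thesis
    proof eventually_elim
      case (elim N)
      interpret \<mu>: prob_space "\<mu> N" by (rule \<mu>(1))
      interpret \<nu>: prob_space \<nu> by (rule \<nu>(1))
      have gm': "g \<in> borel_measurable (\<mu> N)" "g \<in> borel_measurable \<nu>"
        using gm measurable_cong_sets[OF \<mu>(2)] measurable_cong_sets[OF \<nu>(2)] by blast+
      have "real n * integral\<^sup>L \<nu> g \<le> 1 + (\<Sum>i=1..n. measure \<nu> (?G i))"
        using \<nu>.expectation_layers(2)[OF gm'(2) g(2,3) n0] by (simp add: sp)
      also have "\<dots> \<le> 1 + (\<Sum>i=1..n. measure (\<mu> N) (?G i) + e / 2)"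
        using elim by (intro add_left_mono sum_mono) (auto simp: diff_le_eq)
      also have "\<dots> = 1 + (\<Sum>i=1..n. measure (\<mu> N) (?G i)) + real n * (e / 2)" by (simp add: sum.distrib)
      also have "\<dots> \<le> (\<Sum>i=1..n. measure (\<mu> N) (?G i)) + real n * e" using ne by (simp add: field_simps)
      also have "(\<Sum>i=1..n. measure (\<mu> N) (?G i)) \<le> real n * integral\<^sup>L (\<mu> N) g"
        using \<mu>.expectation_layers(1)[OF gm'(1) g(2,3) n0] by (simp add: sp)
      finally have "real n * integral\<^sup>L \<nu> g \<le> real n * (integral\<^sup>L (\<mu> N) g + e)" by (simp add: distrib_left)
      then show ?case using n0 by (simp add: mult_le_cancel_left_pos)
    qed
  qed
  show ?thesis
    unfolding weak_star_conv_def
  proof (intro allI impI)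
    fix f :: "'a \<Rightarrow> real" assume f: "continuous_on UNIV f \<and> bounded (range f)"
    obtain b where b: "b > 0" "\<And>x. \<bar>f x\<bar> \<le> b" using f bounded_pos[of "range f"] by auto
    have fm: "f \<in> borel_measurable borel" using f by (intro borel_measurable_continuous_onI) auto
    \<comment> \<open>With \<open>c = 1\<close> and \<open>c = -1\<close> these affine maps bring
      \<open>f\<close> and its negative into [0,1], where the one-sided bound applies.\<close>
    have int: "integral\<^sup>L P (\<lambda>x. (b + c * f x) / (2 * b)) = (b + c * integral\<^sup>L P f) / (2 * b)"
      if P: "prob_space P" "sets P = sets borel" for P and c :: real
    proof -
      interpret prob_space P by (rule P(1))
      have "f \<in> borel_measurable P" using fm measurable_cong_sets[OF P(2)] by blast
      then have "integrable P f" using b(2) by (intro integrable_const_bound[where B=b]) auto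
      then show ?thesis by (simp add: prob_space)
    qed
    have range: "0 \<le> (b + c * f x) / (2 * b)" "(b + c * f x) / (2 * b) \<le> 1" if "c = 1 \<or> c = -1" for c x
      using b(1) b(2)[of x] that by (auto simp: abs_le_iff)
    have main: "\<forall>\<^sub>F N in sequentially. c * integral\<^sup>L \<nu> f - e \<le> c * integral\<^sup>L (\<mu> N) f"
      if c: "c = 1 \<or> c = -1" and e: "e > 0" for c e
    proof -
      have "\<forall>\<^sub>F N in sequentially. (b + c * integral\<^sup>L \<nu> f) / (2 * b) - e / (2 * b) \<le> (b + c * integral\<^sup>L (\<mu> N) f) / (2 * b)"
        unfolding int[OF \<nu>, symmetric] int[OF \<mu>, symmetric]
        using f e b(1) by (intro half range[OF c] continuous_intros) auto
      then show ?thesis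
      proof eventually_elim
        case (elim N)
        then have "(b + c * integral\<^sup>L \<nu> f - e) / (2 * b) \<le> (b + c * integral\<^sup>L (\<mu> N) f) / (2 * b)"
          by (simp add: diff_divide_distrib)
        then show ?case using b(1) by (simp add: divide_le_cancel)
      qed
    qed
    show "(\<lambda>N. integral\<^sup>L (\<mu> N) f) \<longlonglongrightarrow> integral\<^sup>L \<nu> f"
    proof (rule tendstoI)
      fix e :: real assume e: "e > 0"
      have e2: "e / 2 > 0" using e by simp
      have "\<forall>\<^sub>F N in sequentially. 1 * integral\<^sup>L \<nu> f - e / 2 \<le> 1 * integral\<^sup>L (\<mu> N) f"
        by (rule main[OF _ e2]) simp
      moreover have "\<forall>\<^sub>F N in sequentially. -1 * integral\<^sup>L \<nu> f - e / 2 \<le> -1 * integral\<^sup>L (\<mu> N) f"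
        by (rule main[OF _ e2]) simp
      ultimately show "\<forall>\<^sub>F N in sequentially. dist (integral\<^sup>L (\<mu> N) f) (integral\<^sup>L \<nu> f) < e"
        by eventually_elim (use e in \<open>simp add: dist_real_def abs_less_iff\<close>)
    qed
  qed
qed

theorem theorem1p14:
  fixes A :: "(real ^ 'p::finite) set" and s :: real
  defines "d \<equiv> CARD('d::finite)"
  assumes "d \<le> CARD('p)"
    and "A \<noteq> {}" and "compact A" and "strongly_rectifiable d A"
    and "s > real d"
  shows "convergent (scaled_polarization s d A) \<and>
         convergent (scaled_polarization_unconstrained s d A) \<and>
         polarization_limit s d A = limit_value TYPE('d) s A \<and>
         polarization_limit_unconstrained s d A = limit_value TYPE('d) s A \<and>
         (emeasure (hausdorff_measure TYPE('d)) A > 0 \<longrightarrow>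
           (\<forall>\<omega>. asymp_extremal s A \<omega> \<or> asymp_extremal_unconstrained s A \<omega> \<longrightarrow>
             weak_star_conv (\<lambda>N. empirical_measure (\<omega> N))
               (uniform_measure (hausdorff_measure TYPE('d)) A)))"
proof -
  let ?\<mu> = "hausdorff_measure TYPE('d) :: (real ^ 'p) measure"
  define \<theta> where "\<theta> = cube_cost TYPE('d) s"
  define a where "a = \<theta> * measure ?\<mu> A"
  have d0: "d > 0" by (simp add: d_def)
  have s: "s > real CARD('d)" using \<open>s > real d\<close> by (simp add: d_def)
  have s0: "s > 0" using s by (meson of_nat_0_le_iff order.strict_trans1)
  have dim: "CARD('d) \<le> DIM(real ^ 'p)" using \<open>d \<le> CARD('p)\<close> by (simp add: d_def)
  have \<theta>: "\<theta> > 0" unfolding \<theta>_def by (rule cube_cost_pos[OF s])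
  have rect: "strongly_rectifiable CARD('d) A" using \<open>strongly_rectifiable d A\<close> by (simp add: d_def)
  note cost = strongly_rectifiable_cost[OF s dim \<open>compact A\<close> rect, folded d_def \<theta>_def]
  have a0: "a \<ge> 0" using \<theta> by (simp add: a_def)
  have lv: "limit_value TYPE('d) s A = (if a = 0 then \<infinity> else ennreal (a powr - (s / real d)))"
    using limit_value_eq[OF s cost(1)] by (simp add: a_def \<theta>_def d_def)
  note lim = polarization_tendsto[OF cost(2,3)[folded a_def] a0 \<open>A \<noteq> {}\<close> d0 s0, folded lv]
  have weak: "weak_star_conv (\<lambda>N. empirical_measure (\<omega> N)) (uniform_measure ?\<mu> A)"
    if pos: "emeasure ?\<mu> A > 0" and ex: "asymp_extremal s A \<omega> \<or> asymp_extremal_unconstrained s A \<omega>" for \<omega>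
  proof -
    have M: "emeasure ?\<mu> A = ennreal (measure ?\<mu> A)" using cost(1) by (simp add: emeasure_eq_ennreal_measure less_top)
    then have Mpos: "measure ?\<mu> A > 0" using pos by simp
    then have apos: "a > 0" using \<theta> by (simp add: a_def)
    then have lv': "limit_value TYPE('d) s A = ennreal (a powr - (s / real d))" using lv by simp
    have sz: "size (\<omega> N) = N" if "N \<ge> 1" for N
      using ex that by (auto simp: asymp_extremal_def asymp_extremal_unconstrained_def)
    have dom: "\<forall>\<^sub>F N in sequentially. dominates s ((a' / real N) powr (1 / real d)) A (\<omega> N)" if "a < a'" for a'
      using ex
    proof
      assume "asymp_extremal s A \<omega>"
      then show ?thesis using lim(1)[unfolded lv' scaled_polarization_def] apos that d0 s0
        unfolding asymp_extremal_def by (intro extremal_eventually_dominates[where m="max_polarization s A"]) auto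
    next
      assume "asymp_extremal_unconstrained s A \<omega>"
      then show ?thesis using lim(2)[unfolded lv' scaled_polarization_unconstrained_def] apos that d0 s0
        unfolding asymp_extremal_unconstrained_def
        by (intro extremal_eventually_dominates[where m="max_polarization_unconstrained s A"]) auto
    qed
    have Ab: "A \<in> sets borel" using \<open>compact A\<close> by (rule borel_compact)
    define \<nu> where "\<nu> = uniform_measure ?\<mu> A"
    have prob: "prob_space \<nu>"
      unfolding \<nu>_def using pos cost(1) by (intro prob_space_uniform_measure) auto
    have sets: "sets \<nu> = sets borel" by (simp add: \<nu>_def)
    have \<nu>: "measure \<nu> S = measure ?\<mu> (A \<inter> S) / measure ?\<mu> A" if "S \<in> sets borel" for S
      unfolding \<nu>_def using pos cost(1) that by (intro measure_uniform_measure) auto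
    show ?thesis
      unfolding \<nu>_def[symmetric]
    proof (rule weak_star_convI[OF prob_space_empirical_measure sets_empirical_measure prob sets])
      fix G :: "(real ^ 'p) set" and \<eta> assume G: "open G" "\<eta> < measure \<nu> G"
      interpret \<nu>: prob_space \<nu> by (rule prob)
      have GA: "G \<inter> A \<in> sets borel" using G(1) Ab by auto
      have eq: "measure \<nu> G = measure \<nu> (G \<inter> A)" using G(1) Ab by (simp add: \<nu> Int_ac)
      show "\<forall>\<^sub>F N in sequentially. \<eta> \<le> measure (empirical_measure (\<omega> N)) G"
      \<comment> \<open>\<open>ennreal\<close> would truncate a negative \<open>\<eta>\<close> to 0,
        so this trivial case is split off.\<close>
      proof (cases "\<eta> < 0")
        case True
        then show ?thesis by (intro always_eventually allI) (meson less_imp_le measure_nonneg order_trans)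
      next
        case False
        \<comment> \<open>Since \<open>\<nu>\<close> lives on \<open>A\<close>, inner regularity
          yields a compact \<open>K\<close> inside \<open>G \<inter> A\<close> whose measure still
          exceeds \<open>\<eta>\<close>. For such a \<open>K\<close> the cost is known, and a
          neighbourhood of it lies in \<open>G\<close>.\<close>
        have "ennreal \<eta> < emeasure \<nu> (G \<inter> A)"
          using G(2) False by (simp add: eq \<nu>.emeasure_eq_measure ennreal_less_iff)
        also have "\<dots> = (SUP K\<in>{K. K \<subseteq> G \<inter> A \<and> compact K}. emeasure \<nu> K)"
          by (rule inner_regular[OF sets _ GA]) simp
        finally obtain K where K: "K \<subseteq> G" "K \<subseteq> A" "compact K" "ennreal \<eta> < emeasure \<nu> K"
          unfolding less_SUP_iff by auto
        have Kb: "K \<in> sets borel" using K(3) by (rule borel_compact)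
        have "\<eta> < measure \<nu> K"
          using K(4) False by (simp add: \<nu>.emeasure_eq_measure ennreal_less_iff)
        then have "\<eta> < measure ?\<mu> K / measure ?\<mu> A" using K(2) Kb by (simp add: \<nu> Int_absorb1)
        \<comment> \<open>As \<open>a\<close> is \<open>\<theta>\<close> times the measure of
          \<open>A\<close>, the ratio of the costs of \<open>K\<close> and \<open>A\<close> is
          exactly the \<open>\<nu>\<close>-measure of \<open>K\<close>.\<close>
        then have "\<eta> * a < \<theta> * measure ?\<mu> K" using Mpos \<theta> by (simp add: a_def field_simps)
        moreover have "cost_ge s d K (\<theta> * measure ?\<mu> K)"
          using strongly_rectifiable_cost(3)[OF s dim K(3) strongly_rectifiable_subset[OF rect K(3,2)]]
          by (simp add: \<theta>_def d_def)
        moreover obtain \<delta> where \<delta>: "\<delta> > 0" "(\<Union>x\<in>K. ball x \<delta>) \<subseteq> G"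
          by (rule compact_subset_open_imp_ball_epsilon_subset[OF K(3) G(1) K(1)])
        ultimately have "\<forall>\<^sub>F N in sequentially. \<eta> \<le> real (size (filter_mset (\<lambda>x. x \<in> (\<Union>a\<in>K. ball a \<delta>)) (\<omega> N))) / real N"
          using K(2) apos \<open>s > real d\<close> d0 by (intro extremal_near_count[OF dom sz]) auto
        then show ?thesis using eventually_ge_at_top[of "1::nat"]
        proof eventually_elim
          case (elim N)
          have "size (filter_mset (\<lambda>x. x \<in> (\<Union>a\<in>K. ball a \<delta>)) \<omega>') \<le> size (filter_mset (\<lambda>x. x \<in> G) \<omega>')" for \<omega>'
            by (intro size_mset_mono filter_mset_mono_strong subset_mset.order_refl) (rule subsetD[OF \<delta>(2)])
          then have "real (size (filter_mset (\<lambda>x. x \<in> (\<Union>a\<in>K. ball a \<delta>)) (\<omega> N))) / real N \<le> real (size (filter_mset (\<lambda>x. x \<in> G) (\<omega> N))) / real N"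
            by (intro divide_right_mono) auto
          also have "\<dots> = measure (empirical_measure (\<omega> N)) G"
            using G(1) sz[OF elim(2)] elim(2) by (subst measure_empirical_measure) auto
          finally show ?case using elim(1) by linarith
        qed
      qed
    qed
  qed
  have "convergent (scaled_polarization s d A)" "convergent (scaled_polarization_unconstrained s d A)"
    using lim by (auto intro: convergentI)
  moreover have "polarization_limit s d A = limit_value TYPE('d) s A" "polarization_limit_unconstrained s d A = limit_value TYPE('d) s A"
    unfolding polarization_limit_def polarization_limit_unconstrained_def using lim by (auto intro: limI)
  ultimately show ?thesis using weak by blast
qed

end
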